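(* Let $H$ be a quasi-Hopf algebra, $\mathcal A$ an $H$-bimodule algebra and $\mathbb A$ an $H$-bicomodule algebra. Then the two generalized left diagonal crossed products $\mathcal A\bowtie\mathbb A$ and $\mathcal A\blacktriangleright\!\blacktriangleleft\mathbb A$ are isomorphic as algebras, and moreover they are equivalent extensions of $\mathbb A$. Likewise, the two generalized right diagonal crossed products $\mathbb A\bowtie\mathcal A$ and $\mathbb A\blacktriangleright\!\blacktriangleleft\mathcal A$ are isomorphic as algebras and are equivalent extensions of $\mathbb A$.
   Context: All algebras and spaces are over a field $k$, $\otimes=\otimes_k$; summation is understood. A quasi-bialgebra $(H,\Delta,\varepsilon,\Phi)$: a unital associative algebra $H$, algebra maps $\Delta:H\to H\otimes H$ ($\Delta(h)=h_1\otimes h_2$), $\varepsilon:H\to k$, and an invertible $\Phi=X^1\otimes X^2\otimes X^3\in H^{\otimes3}$, $\Phi^{-1}=x^1\otimes x^2\otimes x^3$, with $(id\otimes\Delta)(\Delta(h))=\Phi(\Delta\otimes id)(\Delta(h))\Phi^{-1}$, $(id\otimes\varepsilon)\Delta=id=(\varepsilon\otimes id)\Delta$, $(1\otimes\Phi)(id\otimes\Delta\otimes id)(\Phi)(\Phi\otimes1)=(id\otimes id\otimes\Delta)(\Phi)(\Delta\otimes id\otimes id)(\Phi)$, $(id\otimes\varepsilon\otimes id)(\Phi)=1\otimes1$. A quasi-Hopf algebra is a quasi-bialgebra with an algebra anti-automorphism $S$ (so $S$ is bijective) and $\alpha,\beta\in H$ such that $S(h_1)\alpha h_2=\varepsilon(h)\alpha$,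 $h_1\beta S(h_2)=\varepsilon(h)\beta$, $X^1\beta S(X^2)\alpha X^3=1$, $S(x^1)\alpha x^2\beta S(x^3)=1$; by rescaling one assumes $\varepsilon(\alpha)=\varepsilon(\beta)=1$ and $\varepsilon\circ S=\varepsilon$. Drinfeld twist: $f=f^1\otimes f^2=(S\otimes S)(\Delta^{cop}(x^1))\,\gamma\,\Delta(x^2\beta S(x^3))\in H\otimes H$, where $\Delta^{cop}(h)=h_2\otimes h_1$, $\gamma=S(A^2)\alpha A^3\otimes S(A^1)\alpha A^4$, $A^1\otimes A^2\otimes A^3\otimes A^4=(\Phi\otimes1)(\Delta\otimes id\otimes id)(\Phi^{-1})$; it is invertible, $f^{-1}=g^1\otimes g^2$. An $H$-bimodule algebra: an $H$-bimodule $\mathcal A$ with a bilinear multiplication and a two-sided unit $1_{\mathcal A}$ such that $(\varphi\varphi')\varphi''=(X^1\cdot\varphi\cdot x^1)[(X^2\cdot\varphi'\cdot x^2)(X^3\cdot\varphi''\cdot x^3)]$, $h\cdot(\varphi\varphi')=(h_1\cdot\varphi)(h_2\cdot\varphi')$, $(\varphi\varphi')\cdot h=(\varphi\cdot h_1)(\varphi'\cdot h_2)$, $h\cdot1_{\mathcal A}=\varepsilon(h)1_{\mathcal A}=1_{\mathcal A}\cdot h$. A right $H$-comodule algebra: a unital associative algebra $\mathfrak A$, an algebra map $\rho:\mathfrak A\to\mathfrak A\otimes H$ and an invertible $\Phi_\rho\in\mathfrak A\otimes H\otimes H$ with $\Phi_\rho(\rho\otimes id)(\rho(a))=(id\otimes\Delta)(\rho(a))\Phi_\rho$,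 $(1\otimes\Phi)(id\otimes\Delta\otimes id)(\Phi_\rho)(\Phi_\rho\otimes1)=(id\otimes id\otimes\Delta)(\Phi_\rho)(\rho\otimes id\otimes id)(\Phi_\rho)$, $(id\otimes\varepsilon)\rho=id$, $(id\otimes\varepsilon\otimes id)(\Phi_\rho)=(id\otimes id\otimes\varepsilon)(\Phi_\rho)=1\otimes1$. A left $H$-comodule algebra: a unital associative algebra $\mathfrak B$, an algebra map $\lambda:\mathfrak B\to H\otimes\mathfrak B$ and an invertible $\Phi_\lambda\in H\otimes H\otimes\mathfrak B$ with $(id\otimes\lambda)(\lambda(b))\Phi_\lambda=\Phi_\lambda(\Delta\otimes id)(\lambda(b))$, $(1\otimes\Phi_\lambda)(id\otimes\Delta\otimes id)(\Phi_\lambda)(\Phi\otimes1)=(id\otimes id\otimes\lambda)(\Phi_\lambda)(\Delta\otimes id\otimes id)(\Phi_\lambda)$, $(\varepsilon\otimes id)\lambda=id$, $(id\otimes\varepsilon\otimes id)(\Phi_\lambda)=(\varepsilon\otimes id\otimes id)(\Phi_\lambda)=1\otimes1$. An $H$-bicomodule algebra $(\mathbb A,\lambda,\rho,\Phi_\lambda,\Phi_\rho,\Phi_{\lambda,\rho})$: $(\mathbb A,\lambda,\Phi_\lambda)$ is a left and $(\mathbb A,\rho,\Phi_\rho)$ a right $H$-comodule algebra, and $\Phi_{\lambda,\rho}\in H\otimes\mathbb A\otimes H$ is invertible with $\Phi_{\lambda,\rho}(\lambda\otimes id)(\rho(u))=(id\otimes\rho)(\lambda(u))\Phi_{\lambda,\rho}$,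 $(1\otimes\Phi_{\lambda,\rho})(id\otimes\lambda\otimes id)(\Phi_{\lambda,\rho})(\Phi_\lambda\otimes1)=(id\otimes id\otimes\rho)(\Phi_\lambda)(\Delta\otimes id\otimes id)(\Phi_{\lambda,\rho})$, $(1\otimes\Phi_\rho)(id\otimes\rho\otimes id)(\Phi_{\lambda,\rho})(\Phi_{\lambda,\rho}\otimes1)=(id\otimes id\otimes\Delta)(\Phi_{\lambda,\rho})(\lambda\otimes id\otimes id)(\Phi_\rho)$. For an $H$-bicomodule algebra $\mathbb A$ put $\delta_l=(\lambda\otimes id_H)\rho$, $\Psi_l=(id_H\otimes\lambda\otimes id_H^{\otimes2})\big((\Phi_{\lambda,\rho}\otimes1_H)(\lambda\otimes id_H^{\otimes2})(\Phi_\rho^{-1})\big)[\Phi_\lambda\otimes1_H^{\otimes2}]$; $\delta_r=(id_H\otimes\rho)\lambda$, $\Psi_r=(id_H^{\otimes2}\otimes\rho\otimes id_H)\big((1_H\otimes\Phi_{\lambda,\rho}^{-1})(id_H^{\otimes2}\otimes\rho)(\Phi_\lambda)\big)[1_H^{\otimes2}\otimes\Phi_\rho^{-1}]$. For $(\delta,\Psi)$ either of $(\delta_l,\Psi_l)$, $(\delta_r,\Psi_r)$ write $\delta(u)=u_{(-1)}\otimes u_{(0)}\otimes u_{(1)}$, $\Psi=\Psi^1\otimes\cdots\otimes\Psi^5$, $\Psi^{-1}=\overline\Psi^1\otimes\cdots\otimes\overline\Psi^5$, and $\Omega_\delta=\Omega_\delta^1\otimes\cdots\otimes\Omega_\delta^5=\overline\Psi^1\otimes\overline\Psi^2\otimes\overline\Psi^3\otimes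 S^{-1}(f^1\overline\Psi^4)\otimes S^{-1}(f^2\overline\Psi^5)$, $\Omega'_\delta=\Omega'^1_\delta\otimes\cdots\otimes\Omega'^5_\delta=S^{-1}(\Psi^1g^1)\otimes S^{-1}(\Psi^2g^2)\otimes\Psi^3\otimes\Psi^4\otimes\Psi^5$. The (associative unital) algebra $\mathcal A\bowtie_\delta\mathbb A$ is $\mathcal A\otimes\mathbb A$ with $(\varphi\bowtie_\delta u)(\varphi'\bowtie_\delta u')=(\Omega^1_\delta\cdot\varphi\cdot\Omega^5_\delta)(\Omega^2_\delta u_{(-1)}\cdot\varphi'\cdot S^{-1}(u_{(1)})\Omega^4_\delta)\bowtie_\delta\Omega^3_\delta u_{(0)}u'$, and $\mathbb A\bowtie_\delta\mathcal A$ is $\mathbb A\otimes\mathcal A$ with $(u\bowtie_\delta\varphi)(u'\bowtie_\delta\varphi')=uu'_{(0)}\Omega'^3_\delta\bowtie_\delta(\Omega'^2_\delta S^{-1}(u'_{(-1)})\cdot\varphi\cdot u'_{(1)}\Omega'^4_\delta)(\Omega'^1_\delta\cdot\varphi'\cdot\Omega'^5_\delta)$. Units are $1_{\mathcal A}\otimes 1_{\mathbb A}$, resp. $1_{\mathbb A}\otimes1_{\mathcal A}$. Notation: $\mathcal A\bowtie\mathbb A=\mathcal A\bowtie_{\delta_l}\mathbb A$, $\mathcal A\blacktriangleright\!\blacktriangleleft\mathbb A=\mathcal A\bowtie_{\delta_r}\mathbb A$, $\mathbb A\bowtie\mathcal A=\mathbb A\bowtie_{\delta_l}\mathcal A$,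 $\mathbb A\blacktriangleright\!\blacktriangleleft\mathcal A=\mathbb A\bowtie_{\delta_r}\mathcal A$. All these contain $\mathbb A$ as unital subalgebra via $u\mapsto1_{\mathcal A}\otimes u$ (resp. $u\mapsto u\otimes1_{\mathcal A}$). Two algebras containing $\mathbb A$ are equivalent extensions of $\mathbb A$ if there is an algebra isomorphism between them restricting to the identity on $\mathbb A$. *)

theory Defs
  imports "HOL-Algebra.Module"
begin

section \<open>Algebras over a field\<close>

text \<open>
  Following HOL-Algebra, algebras over \<open>K\<close> are carried by \<^type>\<open>module_ext\<close> records; the
  ring component supplies the multiplication and the unit.  (The locale \<^locale>\<open>algebra\<close> of
  the library is for commutative algebras only.)
\<close>

locale assoc_algebra = field K + module K A + ring A for K (structure) and A (structure) +
  assumes smult_mult_left: "\<lbrakk> c \<in> carrier K; x \<in> carrier A; y \<in> carrier A \<rbrakk> \<Longrightarrow>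
      (c \<odot>\<^bsub>A\<^esub> x) \<otimes>\<^bsub>A\<^esub> y = c \<odot>\<^bsub>A\<^esub> (x \<otimes>\<^bsub>A\<^esub> y)"
    and smult_mult_right: "\<lbrakk> c \<in> carrier K; x \<in> carrier A; y \<in> carrier A \<rbrakk> \<Longrightarrow>
      x \<otimes>\<^bsub>A\<^esub> (c \<odot>\<^bsub>A\<^esub> y) = c \<odot>\<^bsub>A\<^esub> (x \<otimes>\<^bsub>A\<^esub> y)"

definition alg_hom ::
  "('k, 'm) ring_scheme \<Rightarrow> ('k, 'a, 'x) module_scheme \<Rightarrow> ('k, 'b, 'y) module_scheme \<Rightarrow> ('a \<Rightarrow> 'b) set"
  where "alg_hom K A B = {F \<in> ring_hom A B.
    \<forall>c \<in> carrier K. \<forall>x \<in> carrier A. F (c \<odot>\<^bsub>A\<^esub> x) = c \<odot>\<^bsub>B\<^esub> F x}"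

definition alg_iso ::
  "('k, 'm) ring_scheme \<Rightarrow> ('k, 'a, 'x) module_scheme \<Rightarrow> ('k, 'b, 'y) module_scheme \<Rightarrow> ('a \<Rightarrow> 'b) set"
  where "alg_iso K A B = {F \<in> alg_hom K A B. bij_betw F (carrier A) (carrier B)}"

definition alg_isomorphic ::
  "('k, 'm) ring_scheme \<Rightarrow> ('k, 'a, 'x) module_scheme \<Rightarrow> ('k, 'b, 'y) module_scheme \<Rightarrow> bool"
  where "alg_isomorphic K A B \<longleftrightarrow> alg_iso K A B \<noteq> {}"

text \<open>\<open>A\<close> and \<open>B\<close> contain \<open>C\<close> via the maps \<open>i\<close> and \<open>j\<close>.\<close>

definition equivalent_extensions ::
  "('k, 'm) ring_scheme \<Rightarrow> ('k, 'c, 'z) module_scheme \<Rightarrow>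
   ('k, 'a, 'x) module_scheme \<Rightarrow> ('c \<Rightarrow> 'a) \<Rightarrow> ('k, 'b, 'y) module_scheme \<Rightarrow> ('c \<Rightarrow> 'b) \<Rightarrow> bool"
  where "equivalent_extensions K C A i B j \<longleftrightarrow>
    (\<exists>F \<in> alg_iso K A B. \<forall>u \<in> carrier C. F (i u) = j u)"

definition alg_anti_automorphism ::
  "('k, 'm) ring_scheme \<Rightarrow> ('k, 'a, 'x) module_scheme \<Rightarrow> ('a \<Rightarrow> 'a) \<Rightarrow> bool"
  where "alg_anti_automorphism K A S \<longleftrightarrow>
    bij_betw S (carrier A) (carrier A) \<and> S \<one>\<^bsub>A\<^esub> = \<one>\<^bsub>A\<^esub> \<and>
    (\<forall>x \<in> carrier A. \<forall>y \<in> carrier A. S (x \<oplus>\<^bsub>A\<^esub> y) = S x \<oplus>\<^bsub>A\<^esub> S y) \<and>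
    (\<forall>c \<in> carrier K. \<forall>x \<in> carrier A. S (c \<odot>\<^bsub>A\<^esub> x) = c \<odot>\<^bsub>A\<^esub> S x) \<and>
    (\<forall>x \<in> carrier A. \<forall>y \<in> carrier A. S (x \<otimes>\<^bsub>A\<^esub> y) = S y \<otimes>\<^bsub>A\<^esub> S x)"


section \<open>Tensor products\<close>

text \<open>
  An element of \<open>V \<otimes> W\<close> is a class of formal finite sums of simple tensors \<open>v \<otimes> w\<close>, a formal
  sum being a list of pairs.  The lists up to \<open>comm\<close> form the free commutative monoid on
  \<open>V \<times> W\<close>; \<open>zero\<close> is needed because the relations are imposed on a monoid rather than on a
  group.
\<close>

type_synonym ('v, 'w) tens = "('v \<times> 'w) list set"

inductive_set tens_rel ::
  "('k, 'm) ring_scheme \<Rightarrow> ('k, 'v, 'x) module_scheme \<Rightarrow> ('k, 'w, 'y) module_scheme \<Rightarrow>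
   (('v \<times> 'w) list \<times> ('v \<times> 'w) list) set"
  for K and V and W
where
  refl: "set xs \<subseteq> carrier V \<times> carrier W \<Longrightarrow> (xs, xs) \<in> tens_rel K V W"
| sym: "(xs, ys) \<in> tens_rel K V W \<Longrightarrow> (ys, xs) \<in> tens_rel K V W"
| trans: "\<lbrakk> (xs, ys) \<in> tens_rel K V W; (ys, zs) \<in> tens_rel K V W \<rbrakk> \<Longrightarrow> (xs, zs) \<in> tens_rel K V W"
| append: "\<lbrakk> (xs, xs') \<in> tens_rel K V W; (ys, ys') \<in> tens_rel K V W \<rbrakk> \<Longrightarrow>
    (xs @ ys, xs' @ ys') \<in> tens_rel K V W"
| comm: "\<lbrakk> set xs \<subseteq> carrier V \<times> carrier W; set ys \<subseteq> carrier V \<times> carrier W \<rbrakk> \<Longrightarrow>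
    (xs @ ys, ys @ xs) \<in> tens_rel K V W"
| add_left: "\<lbrakk> v \<in> carrier V; v' \<in> carrier V; w \<in> carrier W \<rbrakk> \<Longrightarrow>
    ([(v \<oplus>\<^bsub>V\<^esub> v', w)], [(v, w), (v', w)]) \<in> tens_rel K V W"
| add_right: "\<lbrakk> v \<in> carrier V; w \<in> carrier W; w' \<in> carrier W \<rbrakk> \<Longrightarrow>
    ([(v, w \<oplus>\<^bsub>W\<^esub> w')], [(v, w), (v, w')]) \<in> tens_rel K V W"
| balanced: "\<lbrakk> c \<in> carrier K; v \<in> carrier V; w \<in> carrier W \<rbrakk> \<Longrightarrow>
    ([(c \<odot>\<^bsub>V\<^esub> v, w)], [(v, c \<odot>\<^bsub>W\<^esub> w)]) \<in> tens_rel K V W"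
| zero: "w \<in> carrier W \<Longrightarrow> ([(\<zero>\<^bsub>V\<^esub>, w)], []) \<in> tens_rel K V W"

definition tens_class ::
  "('k, 'm) ring_scheme \<Rightarrow> ('k, 'v, 'x) module_scheme \<Rightarrow> ('k, 'w, 'y) module_scheme \<Rightarrow>
   ('v \<times> 'w) list \<Rightarrow> ('v, 'w) tens"
  where "tens_class K V W xs = tens_rel K V W `` {xs}"

definition tens_rep :: "('v, 'w) tens \<Rightarrow> ('v \<times> 'w) list"
  where "tens_rep t = (SOME xs. xs \<in> t)"

text \<open>
  Multiplication and unit are meaningful when \<open>V\<close> and \<open>W\<close> are algebras; the operator is right
  associative, so iterated tensor products are bracketed to the right throughout.
\<close>

definition tensor ::
  "('k, 'm) ring_scheme \<Rightarrow> ('k, 'v, 'x) module_scheme \<Rightarrow> ('k, 'w, 'y) module_scheme \<Rightarrow>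
   ('k, ('v, 'w) tens) module"  (infixr \<open>\<boxtimes>\<index>\<close> 75)
  where "V \<boxtimes>\<^bsub>K\<^esub> W = \<lparr>
    carrier = {xs. set xs \<subseteq> carrier V \<times> carrier W} // tens_rel K V W,
    mult = (\<lambda>s t. tens_class K V W
      (concat (map (\<lambda>(v, w). map (\<lambda>(v', w'). (v \<otimes>\<^bsub>V\<^esub> v', w \<otimes>\<^bsub>W\<^esub> w')) (tens_rep t)) (tens_rep s)))),
    one = tens_class K V W [(\<one>\<^bsub>V\<^esub>, \<one>\<^bsub>W\<^esub>)],
    zero = tens_class K V W [],
    add = (\<lambda>s t. tens_class K V W (tens_rep s @ tens_rep t)),
    smult = (\<lambda>c t. tens_class K V W (map (\<lambda>(v, w). (c \<odot>\<^bsub>V\<^esub> v, w)) (tens_rep t))) \<rparr>"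

definition etens ::
  "('k, 'm) ring_scheme \<Rightarrow> ('k, 'v, 'x) module_scheme \<Rightarrow> ('k, 'w, 'y) module_scheme \<Rightarrow>
   'v \<Rightarrow> 'w \<Rightarrow> ('v, 'w) tens"
  where "etens K V W v w = tens_class K V W [(v, w)]"

text \<open>
  Sweedler-style sums: for \<open>t = \<Sum> t\<^sub>1 \<otimes> t\<^sub>2\<close>, \<open>tsum2 X f t\<close> is \<open>\<Sum> f t\<^sub>1 t\<^sub>2\<close> in \<open>X\<close>.  The value
  is independent of the representative if \<open>f\<close> is bilinear (lemma \<open>tsum2_tens_class\<close> below).
\<close>

definition lsum :: "('k, 'a, 'x) module_scheme \<Rightarrow> ('v \<Rightarrow> 'w \<Rightarrow> 'a) \<Rightarrow> ('v \<times> 'w) list \<Rightarrow> 'a"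
  where "lsum X f xs = foldr (\<lambda>(v, w) s. f v w \<oplus>\<^bsub>X\<^esub> s) xs \<zero>\<^bsub>X\<^esub>"

definition tsum2 :: "('k, 'a, 'x) module_scheme \<Rightarrow> ('v \<Rightarrow> 'w \<Rightarrow> 'a) \<Rightarrow> ('v, 'w) tens \<Rightarrow> 'a"
  where "tsum2 X f t = lsum X f (tens_rep t)"

definition tsum3 ::
  "('k, 'a, 'x) module_scheme \<Rightarrow> ('t1 \<Rightarrow> 't2 \<Rightarrow> 't3 \<Rightarrow> 'a) \<Rightarrow> ('t1, ('t2, 't3) tens) tens \<Rightarrow> 'a"
  where "tsum3 X f t = tsum2 X (\<lambda>a s. tsum2 X (f a) s) t"

definition tsum4 ::
  "('k, 'a, 'x) module_scheme \<Rightarrow> ('t1 \<Rightarrow> 't2 \<Rightarrow> 't3 \<Rightarrow> 't4 \<Rightarrow> 'a) \<Rightarrow>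
   ('t1, ('t2, ('t3, 't4) tens) tens) tens \<Rightarrow> 'a"
  where "tsum4 X f t = tsum2 X (\<lambda>a s. tsum3 X (f a) s) t"

definition tsum5 ::
  "('k, 'a, 'x) module_scheme \<Rightarrow> ('t1 \<Rightarrow> 't2 \<Rightarrow> 't3 \<Rightarrow> 't4 \<Rightarrow> 't5 \<Rightarrow> 'a) \<Rightarrow>
   ('t1, ('t2, ('t3, ('t4, 't5) tens) tens) tens) tens \<Rightarrow> 'a"
  where "tsum5 X f t = tsum2 X (\<lambda>a s. tsum4 X (f a) s) t"

text \<open>\<open>rtens\<close> is \<open>id \<otimes> f\<close>, with values in \<open>U \<otimes> V\<close>.\<close>

definition rtens ::
  "('k, 'm) ring_scheme \<Rightarrow> ('k, 'u, 'x) module_scheme \<Rightarrow> ('k, 'v, 'y) module_scheme \<Rightarrow>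
   ('w \<Rightarrow> 'v) \<Rightarrow> ('u, 'w) tens \<Rightarrow> ('u, 'v) tens"
  where "rtens K U V f = tsum2 (U \<boxtimes>\<^bsub>K\<^esub> V) (\<lambda>u w. etens K U V u (f w))"

text \<open>
  For \<open>f : X \<rightarrow> U \<otimes> V\<close>, \<open>ltens\<close> is \<open>f \<otimes> id : X \<otimes> W \<rightarrow> (U \<otimes> V) \<otimes> W\<close> followed by the canonical
  isomorphism onto \<open>U \<otimes> (V \<otimes> W)\<close>.
\<close>

definition ltens ::
  "('k, 'm) ring_scheme \<Rightarrow> ('k, 'u, 'x) module_scheme \<Rightarrow> ('k, 'v, 'y) module_scheme \<Rightarrow>
   ('k, 'w, 'z) module_scheme \<Rightarrow> ('a \<Rightarrow> ('u, 'v) tens) \<Rightarrow> ('a, 'w) tens \<Rightarrow> ('u, ('v, 'w) tens) tens"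
  where "ltens K U V W f = tsum2 (U \<boxtimes>\<^bsub>K\<^esub> V \<boxtimes>\<^bsub>K\<^esub> W)
    (\<lambda>a w. tsum2 (U \<boxtimes>\<^bsub>K\<^esub> V \<boxtimes>\<^bsub>K\<^esub> W) (\<lambda>u v. etens K U (V \<boxtimes>\<^bsub>K\<^esub> W) u (etens K V W v w)) (f a))"

text \<open>\<open>t \<otimes> 1\<^sub>X\<close> for a threefold tensor \<open>t\<close>, rebracketed to the right.\<close>

definition tens_one ::
  "('k, 'm) ring_scheme \<Rightarrow> ('k, 'u, 'x) module_scheme \<Rightarrow> ('k, 'v, 'y) module_scheme \<Rightarrow>
   ('k, 'w, 'z) module_scheme \<Rightarrow> ('k, 'a, 'zz) module_scheme \<Rightarrow>
   ('u, ('v, 'w) tens) tens \<Rightarrow> ('u, ('v, ('w, 'a) tens) tens) tens"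
  where "tens_one K U V W X = tsum3 (U \<boxtimes>\<^bsub>K\<^esub> V \<boxtimes>\<^bsub>K\<^esub> W \<boxtimes>\<^bsub>K\<^esub> X)
    (\<lambda>u v w. etens K U (V \<boxtimes>\<^bsub>K\<^esub> W \<boxtimes>\<^bsub>K\<^esub> X) u (etens K V (W \<boxtimes>\<^bsub>K\<^esub> X) v (etens K W X w \<one>\<^bsub>X\<^esub>)))"

text \<open>
  Every bilinear map factors through \<open>V \<otimes> W\<close>; in particular \<open>tsum2 X f (etens K V W v w)\<close> is
  \<open>f v w\<close>.
\<close>

lemma tens_rel_carrier:
  assumes "module K V" "module K W" "(xs, ys) \<in> tens_rel K V W"
  shows "set xs \<subseteq> carrier V \<times> carrier W \<and> set ys \<subseteq> carrier V \<times> carrier W"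
proof -
  interpret V: module K V by fact
  interpret W: module K W by fact
  show ?thesis using assms(3) by induction auto
qed

lemma equiv_tens_rel:
  assumes "module K V" "module K W"
  shows "equiv {xs. set xs \<subseteq> carrier V \<times> carrier W} (tens_rel K V W)"
  using tens_rel_carrier[OF assms]
  by (intro equivI)
    (auto simp: refl_on_def intro!: symI transI intro: tens_rel.refl tens_rel.sym tens_rel.trans)

lemma tsum2_tens_class:
  assumes "module K V" "module K W" "module K X"
    and closed: "\<And>v w. \<lbrakk> v \<in> carrier V; w \<in> carrier W \<rbrakk> \<Longrightarrow> f v w \<in> carrier X"
    and add_l: "\<And>v v' w. \<lbrakk> v \<in> carrier V; v' \<in> carrier V; w \<in> carrier W \<rbrakk> \<Longrightarrow>
      f (v \<oplus>\<^bsub>V\<^esub> v') w = f v w \<oplus>\<^bsub>X\<^esub> f v' w"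
    and add_r: "\<And>v w w'. \<lbrakk> v \<in> carrier V; w \<in> carrier W; w' \<in> carrier W \<rbrakk> \<Longrightarrow>
      f v (w \<oplus>\<^bsub>W\<^esub> w') = f v w \<oplus>\<^bsub>X\<^esub> f v w'"
    and smult_l: "\<And>c v w. \<lbrakk> c \<in> carrier K; v \<in> carrier V; w \<in> carrier W \<rbrakk> \<Longrightarrow>
      f (c \<odot>\<^bsub>V\<^esub> v) w = c \<odot>\<^bsub>X\<^esub> f v w"
    and smult_r: "\<And>c v w. \<lbrakk> c \<in> carrier K; v \<in> carrier V; w \<in> carrier W \<rbrakk> \<Longrightarrow>
      f v (c \<odot>\<^bsub>W\<^esub> w) = c \<odot>\<^bsub>X\<^esub> f v w"
    and xs: "set xs \<subseteq> carrier V \<times> carrier W"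
  shows "tsum2 X f (tens_class K V W xs) = lsum X f xs"
proof -
  interpret V: module K V by fact
  interpret W: module K W by fact
  interpret X: module K X by fact
  have in_X: "lsum X f ys \<in> carrier X" if "set ys \<subseteq> carrier V \<times> carrier W" for ys
    using that by (induction ys) (auto simp: lsum_def closed)
  have app: "lsum X f (ys @ zs) = lsum X f ys \<oplus>\<^bsub>X\<^esub> lsum X f zs"
    if "set ys \<subseteq> carrier V \<times> carrier W" "set zs \<subseteq> carrier V \<times> carrier W" for ys zs
    using that(1)
  proof (induction ys)
    case Nil
    then show ?case using in_X[OF that(2)] by (simp add: lsum_def)
  next
    case (Cons y ys)
    then obtain v w where y: "y = (v, w)" "v \<in> carrier V" "w \<in> carrier W" by auto
    from Cons have "lsum X f (ys @ zs) = lsum X f ys \<oplus>\<^bsub>X\<^esub> lsum X f zs" by auto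
    moreover have "lsum X f ys \<in> carrier X" "lsum X f zs \<in> carrier X"
      using Cons.prems that(2) in_X by auto
    ultimately show ?case using y closed[of v w] by (simp add: lsum_def X.a_assoc)
  qed
  have f0: "f \<zero>\<^bsub>V\<^esub> w = \<zero>\<^bsub>X\<^esub>" if "w \<in> carrier W" for w
    using smult_l[of "\<zero>\<^bsub>K\<^esub>" "\<zero>\<^bsub>V\<^esub>" w] closed[of "\<zero>\<^bsub>V\<^esub>" w] that
    by (simp add: V.smult_l_null X.smult_l_null)
  have resp: "lsum X f ys = lsum X f zs" if "(ys, zs) \<in> tens_rel K V W" for ys zs
    using that
  proof induction
    case (append xs xs' ys ys')
    then show ?case
      using tens_rel_carrier[OF assms(1,2)] app by metis
  next
    case (comm xs ys)
    then show ?case by (simp add: app in_X X.a_comm)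
  qed (auto simp: lsum_def closed add_l add_r smult_l smult_r f0)
  have "(xs, tens_rep (tens_class K V W xs)) \<in> tens_rel K V W"
    unfolding tens_rep_def tens_class_def
    using tens_rel.refl[OF xs] by (metis ImageI Image_singleton_iff singletonI someI_ex)
  then show ?thesis using resp by (simp add: tsum2_def)
qed


section \<open>Quasi-bialgebras and quasi-Hopf algebras\<close>

record ('k, 'h) quasi_bialgebra = "('k, 'h) module" +
  comult :: "'h \<Rightarrow> ('h, 'h) tens"
  counit :: "'h \<Rightarrow> 'k"
  reassoc :: "('h, ('h, 'h) tens) tens"

record ('k, 'h) quasi_hopf = "('k, 'h) quasi_bialgebra" +
  antipode :: "'h \<Rightarrow> 'h"
  alpha :: "'h"
  beta :: "'h"

locale quasi_bialgebra = assoc_algebra K H for K (structure) and H (structure) +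
  assumes comult_hom: "comult H \<in> alg_hom K H (H \<boxtimes>\<^bsub>K\<^esub> H)"
    and counit_hom: "counit H \<in> ring_hom H K"
    and counit_smult: "\<lbrakk> c \<in> carrier K; h \<in> carrier H \<rbrakk> \<Longrightarrow>
      counit H (c \<odot>\<^bsub>H\<^esub> h) = c \<otimes>\<^bsub>K\<^esub> counit H h"
    and reassoc_unit: "reassoc H \<in> Units (H \<boxtimes>\<^bsub>K\<^esub> H \<boxtimes>\<^bsub>K\<^esub> H)"
    and quasi_coassoc: "h \<in> carrier H \<Longrightarrow>
      rtens K H (H \<boxtimes>\<^bsub>K\<^esub> H) (comult H) (comult H h) =
      reassoc H \<otimes>\<^bsub>H \<boxtimes>\<^bsub>K\<^esub> H \<boxtimes>\<^bsub>K\<^esub> H\<^esub> ltens K H H H (comult H) (comult H h)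
        \<otimes>\<^bsub>H \<boxtimes>\<^bsub>K\<^esub> H \<boxtimes>\<^bsub>K\<^esub> H\<^esub> inv\<^bsub>H \<boxtimes>\<^bsub>K\<^esub> H \<boxtimes>\<^bsub>K\<^esub> H\<^esub> (reassoc H)"
    and counit_right: "h \<in> carrier H \<Longrightarrow> tsum2 H (\<lambda>h1 h2. counit H h2 \<odot>\<^bsub>H\<^esub> h1) (comult H h) = h"
    and counit_left: "h \<in> carrier H \<Longrightarrow> tsum2 H (\<lambda>h1 h2. counit H h1 \<odot>\<^bsub>H\<^esub> h2) (comult H h) = h"
    and pentagon:
      "etens K H (H \<boxtimes>\<^bsub>K\<^esub> H \<boxtimes>\<^bsub>K\<^esub> H) \<one>\<^bsub>H\<^esub> (reassoc H)
        \<otimes>\<^bsub>H \<boxtimes>\<^bsub>K\<^esub> H \<boxtimes>\<^bsub>K\<^esub> H \<boxtimes>\<^bsub>K\<^esub> H\<^esub> rtens K H (H \<boxtimes>\<^bsub>K\<^esub> H \<boxtimes>\<^bsub>K\<^esub> H) (ltens K H H H (comult H)) (reassoc H)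
        \<otimes>\<^bsub>H \<boxtimes>\<^bsub>K\<^esub> H \<boxtimes>\<^bsub>K\<^esub> H \<boxtimes>\<^bsub>K\<^esub> H\<^esub> tens_one K H H H H (reassoc H)
       = rtens K H (H \<boxtimes>\<^bsub>K\<^esub> H \<boxtimes>\<^bsub>K\<^esub> H) (rtens K H (H \<boxtimes>\<^bsub>K\<^esub> H) (comult H)) (reassoc H)
        \<otimes>\<^bsub>H \<boxtimes>\<^bsub>K\<^esub> H \<boxtimes>\<^bsub>K\<^esub> H \<boxtimes>\<^bsub>K\<^esub> H\<^esub> ltens K H H (H \<boxtimes>\<^bsub>K\<^esub> H) (comult H) (reassoc H)"
    and counit_reassoc:
      "tsum3 (H \<boxtimes>\<^bsub>K\<^esub> H) (\<lambda>x1 x2 x3. etens K H H (counit H x2 \<odot>\<^bsub>H\<^esub> x1) x3) (reassoc H)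
       = \<one>\<^bsub>H \<boxtimes>\<^bsub>K\<^esub> H\<^esub>"

text \<open>The last three axioms are the usual normalization.\<close>

locale quasi_hopf_algebra = quasi_bialgebra K H for K (structure) and H (structure) +
  assumes antipode_anti_auto: "alg_anti_automorphism K H (antipode H)"
    and alpha_closed: "alpha H \<in> carrier H"
    and beta_closed: "beta H \<in> carrier H"
    and antipode_alpha: "h \<in> carrier H \<Longrightarrow>
      tsum2 H (\<lambda>h1 h2. antipode H h1 \<otimes>\<^bsub>H\<^esub> alpha H \<otimes>\<^bsub>H\<^esub> h2) (comult H h) = counit H h \<odot>\<^bsub>H\<^esub> alpha H"
    and antipode_beta: "h \<in> carrier H \<Longrightarrow>
      tsum2 H (\<lambda>h1 h2. h1 \<otimes>\<^bsub>H\<^esub> beta H \<otimes>\<^bsub>H\<^esub> antipode H h2) (comult H h) = counit H h \<odot>\<^bsub>H\<^esub> beta H"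
    and antipode_reassoc:
      "tsum3 H (\<lambda>x1 x2 x3. x1 \<otimes>\<^bsub>H\<^esub> beta H \<otimes>\<^bsub>H\<^esub> antipode H x2 \<otimes>\<^bsub>H\<^esub> alpha H \<otimes>\<^bsub>H\<^esub> x3)
        (reassoc H) = \<one>\<^bsub>H\<^esub>"
    and antipode_inv_reassoc:
      "tsum3 H (\<lambda>x1 x2 x3. antipode H x1 \<otimes>\<^bsub>H\<^esub> alpha H \<otimes>\<^bsub>H\<^esub> x2 \<otimes>\<^bsub>H\<^esub> beta H \<otimes>\<^bsub>H\<^esub> antipode H x3)
        (inv\<^bsub>H \<boxtimes>\<^bsub>K\<^esub> H \<boxtimes>\<^bsub>K\<^esub> H\<^esub> (reassoc H)) = \<one>\<^bsub>H\<^esub>"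
    and counit_alpha: "counit H (alpha H) = \<one>\<^bsub>K\<^esub>"
    and counit_beta: "counit H (beta H) = \<one>\<^bsub>K\<^esub>"
    and counit_antipode: "h \<in> carrier H \<Longrightarrow> counit H (antipode H h) = counit H h"

definition antipode_inv :: "('k, 'h, 'z) quasi_hopf_scheme \<Rightarrow> 'h \<Rightarrow> 'h"
  where "antipode_inv H = inv_into (carrier H) (antipode H)"

definition twist_A ::
  "('k, 'm) ring_scheme \<Rightarrow> ('k, 'h, 'z) quasi_hopf_scheme \<Rightarrow> ('h, ('h, ('h, 'h) tens) tens) tens"
  where "twist_A K H =
    tens_one K H H H H (reassoc H)
      \<otimes>\<^bsub>H \<boxtimes>\<^bsub>K\<^esub> H \<boxtimes>\<^bsub>K\<^esub> H \<boxtimes>\<^bsub>K\<^esub> H\<^esub> ltens K H H (H \<boxtimes>\<^bsub>K\<^esub> H) (comult H) (inv\<^bsub>H \<boxtimes>\<^bsub>K\<^esub> H \<boxtimes>\<^bsub>K\<^esub> H\<^esub> (reassoc H))"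

definition twist_gamma ::
  "('k, 'm) ring_scheme \<Rightarrow> ('k, 'h, 'z) quasi_hopf_scheme \<Rightarrow> ('h, 'h) tens"
  where "twist_gamma K H = tsum4 (H \<boxtimes>\<^bsub>K\<^esub> H)
    (\<lambda>a1 a2 a3 a4. etens K H H
      (antipode H a2 \<otimes>\<^bsub>H\<^esub> alpha H \<otimes>\<^bsub>H\<^esub> a3) (antipode H a1 \<otimes>\<^bsub>H\<^esub> alpha H \<otimes>\<^bsub>H\<^esub> a4))
    (twist_A K H)"

definition drinfeld_twist ::
  "('k, 'm) ring_scheme \<Rightarrow> ('k, 'h, 'z) quasi_hopf_scheme \<Rightarrow> ('h, 'h) tens"
  where "drinfeld_twist K H = tsum3 (H \<boxtimes>\<^bsub>K\<^esub> H)
    (\<lambda>x1 x2 x3.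
      tsum2 (H \<boxtimes>\<^bsub>K\<^esub> H) (\<lambda>h1 h2. etens K H H (antipode H h2) (antipode H h1)) (comult H x1)
      \<otimes>\<^bsub>H \<boxtimes>\<^bsub>K\<^esub> H\<^esub> twist_gamma K H
      \<otimes>\<^bsub>H \<boxtimes>\<^bsub>K\<^esub> H\<^esub> comult H (x2 \<otimes>\<^bsub>H\<^esub> beta H \<otimes>\<^bsub>H\<^esub> antipode H x3))
    (inv\<^bsub>H \<boxtimes>\<^bsub>K\<^esub> H \<boxtimes>\<^bsub>K\<^esub> H\<^esub> (reassoc H))"


section \<open>Bimodule algebras\<close>

record ('k, 'a, 'h) bimodule_algebra = "('k, 'a) module" +
  lact :: "'h \<Rightarrow> 'a \<Rightarrow> 'a"
  ract :: "'a \<Rightarrow> 'h \<Rightarrow> 'a"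

text \<open>The multiplication of \<open>A\<close> is associative only up to the reassociator of \<open>H\<close>.\<close>

locale bimodule_algebra = quasi_bialgebra K H + A: module K A
  for K (structure) and H (structure) and A (structure) +
  assumes lact_closed: "\<lbrakk> h \<in> carrier H; a \<in> carrier A \<rbrakk> \<Longrightarrow> lact A h a \<in> carrier A"
    and lact_add_left: "\<lbrakk> h \<in> carrier H; h' \<in> carrier H; a \<in> carrier A \<rbrakk> \<Longrightarrow>
      lact A (h \<oplus>\<^bsub>H\<^esub> h') a = lact A h a \<oplus>\<^bsub>A\<^esub> lact A h' a"
    and lact_add_right: "\<lbrakk> h \<in> carrier H; a \<in> carrier A; a' \<in> carrier A \<rbrakk> \<Longrightarrow>
      lact A h (a \<oplus>\<^bsub>A\<^esub> a') = lact A h a \<oplus>\<^bsub>A\<^esub> lact A h a'"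
    and lact_smult_left: "\<lbrakk> c \<in> carrier K; h \<in> carrier H; a \<in> carrier A \<rbrakk> \<Longrightarrow>
      lact A (c \<odot>\<^bsub>H\<^esub> h) a = c \<odot>\<^bsub>A\<^esub> lact A h a"
    and lact_smult_right: "\<lbrakk> c \<in> carrier K; h \<in> carrier H; a \<in> carrier A \<rbrakk> \<Longrightarrow>
      lact A h (c \<odot>\<^bsub>A\<^esub> a) = c \<odot>\<^bsub>A\<^esub> lact A h a"
    and lact_mult: "\<lbrakk> h \<in> carrier H; h' \<in> carrier H; a \<in> carrier A \<rbrakk> \<Longrightarrow>
      lact A (h \<otimes>\<^bsub>H\<^esub> h') a = lact A h (lact A h' a)"
    and lact_one: "a \<in> carrier A \<Longrightarrow> lact A \<one>\<^bsub>H\<^esub> a = a"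
    and ract_closed: "\<lbrakk> h \<in> carrier H; a \<in> carrier A \<rbrakk> \<Longrightarrow> ract A a h \<in> carrier A"
    and ract_add_left: "\<lbrakk> h \<in> carrier H; a \<in> carrier A; a' \<in> carrier A \<rbrakk> \<Longrightarrow>
      ract A (a \<oplus>\<^bsub>A\<^esub> a') h = ract A a h \<oplus>\<^bsub>A\<^esub> ract A a' h"
    and ract_add_right: "\<lbrakk> h \<in> carrier H; h' \<in> carrier H; a \<in> carrier A \<rbrakk> \<Longrightarrow>
      ract A a (h \<oplus>\<^bsub>H\<^esub> h') = ract A a h \<oplus>\<^bsub>A\<^esub> ract A a h'"
    and ract_smult_left: "\<lbrakk> c \<in> carrier K; h \<in> carrier H; a \<in> carrier A \<rbrakk> \<Longrightarrow>
      ract A (c \<odot>\<^bsub>A\<^esub> a) h = c \<odot>\<^bsub>A\<^esub> ract A a h"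
    and ract_smult_right: "\<lbrakk> c \<in> carrier K; h \<in> carrier H; a \<in> carrier A \<rbrakk> \<Longrightarrow>
      ract A a (c \<odot>\<^bsub>H\<^esub> h) = c \<odot>\<^bsub>A\<^esub> ract A a h"
    and ract_mult: "\<lbrakk> h \<in> carrier H; h' \<in> carrier H; a \<in> carrier A \<rbrakk> \<Longrightarrow>
      ract A a (h \<otimes>\<^bsub>H\<^esub> h') = ract A (ract A a h) h'"
    and ract_one: "a \<in> carrier A \<Longrightarrow> ract A a \<one>\<^bsub>H\<^esub> = a"
    and lact_ract: "\<lbrakk> h \<in> carrier H; h' \<in> carrier H; a \<in> carrier A \<rbrakk> \<Longrightarrow>
      ract A (lact A h a) h' = lact A h (ract A a h')"
    and mult_closed: "\<lbrakk> a \<in> carrier A; b \<in> carrier A \<rbrakk> \<Longrightarrow> a \<otimes>\<^bsub>A\<^esub> b \<in> carrier A"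
    and mult_add_left: "\<lbrakk> a \<in> carrier A; a' \<in> carrier A; b \<in> carrier A \<rbrakk> \<Longrightarrow>
      (a \<oplus>\<^bsub>A\<^esub> a') \<otimes>\<^bsub>A\<^esub> b = a \<otimes>\<^bsub>A\<^esub> b \<oplus>\<^bsub>A\<^esub> a' \<otimes>\<^bsub>A\<^esub> b"
    and mult_add_right: "\<lbrakk> a \<in> carrier A; b \<in> carrier A; b' \<in> carrier A \<rbrakk> \<Longrightarrow>
      a \<otimes>\<^bsub>A\<^esub> (b \<oplus>\<^bsub>A\<^esub> b') = a \<otimes>\<^bsub>A\<^esub> b \<oplus>\<^bsub>A\<^esub> a \<otimes>\<^bsub>A\<^esub> b'"
    and mult_smult_left: "\<lbrakk> c \<in> carrier K; a \<in> carrier A; b \<in> carrier A \<rbrakk> \<Longrightarrow>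
      (c \<odot>\<^bsub>A\<^esub> a) \<otimes>\<^bsub>A\<^esub> b = c \<odot>\<^bsub>A\<^esub> (a \<otimes>\<^bsub>A\<^esub> b)"
    and mult_smult_right: "\<lbrakk> c \<in> carrier K; a \<in> carrier A; b \<in> carrier A \<rbrakk> \<Longrightarrow>
      a \<otimes>\<^bsub>A\<^esub> (c \<odot>\<^bsub>A\<^esub> b) = c \<odot>\<^bsub>A\<^esub> (a \<otimes>\<^bsub>A\<^esub> b)"
    and unit_closed: "\<one>\<^bsub>A\<^esub> \<in> carrier A"
    and unit_left: "a \<in> carrier A \<Longrightarrow> \<one>\<^bsub>A\<^esub> \<otimes>\<^bsub>A\<^esub> a = a"
    and unit_right: "a \<in> carrier A \<Longrightarrow> a \<otimes>\<^bsub>A\<^esub> \<one>\<^bsub>A\<^esub> = a"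
    and quasi_assoc: "\<lbrakk> a \<in> carrier A; b \<in> carrier A; d \<in> carrier A \<rbrakk> \<Longrightarrow>
      (a \<otimes>\<^bsub>A\<^esub> b) \<otimes>\<^bsub>A\<^esub> d =
      tsum3 A (\<lambda>p1 p2 p3. tsum3 A (\<lambda>q1 q2 q3.
          ract A (lact A p1 a) q1 \<otimes>\<^bsub>A\<^esub> (ract A (lact A p2 b) q2 \<otimes>\<^bsub>A\<^esub> ract A (lact A p3 d) q3))
        (inv\<^bsub>H \<boxtimes>\<^bsub>K\<^esub> H \<boxtimes>\<^bsub>K\<^esub> H\<^esub> (reassoc H))) (reassoc H)"
    and lact_distrib: "\<lbrakk> h \<in> carrier H; a \<in> carrier A; b \<in> carrier A \<rbrakk> \<Longrightarrow>
      lact A h (a \<otimes>\<^bsub>A\<^esub> b) = tsum2 A (\<lambda>h1 h2. lact A h1 a \<otimes>\<^bsub>A\<^esub> lact A h2 b) (comult H h)"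
    and ract_distrib: "\<lbrakk> h \<in> carrier H; a \<in> carrier A; b \<in> carrier A \<rbrakk> \<Longrightarrow>
      ract A (a \<otimes>\<^bsub>A\<^esub> b) h = tsum2 A (\<lambda>h1 h2. ract A a h1 \<otimes>\<^bsub>A\<^esub> ract A b h2) (comult H h)"
    and lact_unit: "h \<in> carrier H \<Longrightarrow> lact A h \<one>\<^bsub>A\<^esub> = counit H h \<odot>\<^bsub>A\<^esub> \<one>\<^bsub>A\<^esub>"
    and ract_unit: "h \<in> carrier H \<Longrightarrow> ract A \<one>\<^bsub>A\<^esub> h = counit H h \<odot>\<^bsub>A\<^esub> \<one>\<^bsub>A\<^esub>"


section \<open>Comodule and bicomodule algebras\<close>

locale right_comodule_algebra = quasi_bialgebra K H + B: assoc_algebra K B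
  for K (structure) and H (structure) and B (structure) and rho and Phi_rho +
  assumes rho_hom: "rho \<in> alg_hom K B (B \<boxtimes>\<^bsub>K\<^esub> H)"
    and Phi_rho_unit: "Phi_rho \<in> Units (B \<boxtimes>\<^bsub>K\<^esub> H \<boxtimes>\<^bsub>K\<^esub> H)"
    and rho_quasi_coassoc: "u \<in> carrier B \<Longrightarrow>
      Phi_rho \<otimes>\<^bsub>B \<boxtimes>\<^bsub>K\<^esub> H \<boxtimes>\<^bsub>K\<^esub> H\<^esub> ltens K B H H rho (rho u) =
      rtens K B (H \<boxtimes>\<^bsub>K\<^esub> H) (comult H) (rho u) \<otimes>\<^bsub>B \<boxtimes>\<^bsub>K\<^esub> H \<boxtimes>\<^bsub>K\<^esub> H\<^esub> Phi_rho"
    and rho_pentagon: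
      "etens K B (H \<boxtimes>\<^bsub>K\<^esub> H \<boxtimes>\<^bsub>K\<^esub> H) \<one>\<^bsub>B\<^esub> (reassoc H)
        \<otimes>\<^bsub>B \<boxtimes>\<^bsub>K\<^esub> H \<boxtimes>\<^bsub>K\<^esub> H \<boxtimes>\<^bsub>K\<^esub> H\<^esub> rtens K B (H \<boxtimes>\<^bsub>K\<^esub> H \<boxtimes>\<^bsub>K\<^esub> H) (ltens K H H H (comult H)) Phi_rho
        \<otimes>\<^bsub>B \<boxtimes>\<^bsub>K\<^esub> H \<boxtimes>\<^bsub>K\<^esub> H \<boxtimes>\<^bsub>K\<^esub> H\<^esub> tens_one K B H H H Phi_rho
       = rtens K B (H \<boxtimes>\<^bsub>K\<^esub> H \<boxtimes>\<^bsub>K\<^esub> H) (rtens K H (H \<boxtimes>\<^bsub>K\<^esub> H) (comult H)) Phi_rho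
        \<otimes>\<^bsub>B \<boxtimes>\<^bsub>K\<^esub> H \<boxtimes>\<^bsub>K\<^esub> H \<boxtimes>\<^bsub>K\<^esub> H\<^esub> ltens K B H (H \<boxtimes>\<^bsub>K\<^esub> H) rho Phi_rho"
    and rho_counit: "u \<in> carrier B \<Longrightarrow> tsum2 B (\<lambda>u0 u1. counit H u1 \<odot>\<^bsub>B\<^esub> u0) (rho u) = u"
    and Phi_rho_counit_mid:
      "tsum3 (B \<boxtimes>\<^bsub>K\<^esub> H) (\<lambda>x1 x2 x3. etens K B H (counit H x2 \<odot>\<^bsub>B\<^esub> x1) x3) Phi_rho = \<one>\<^bsub>B \<boxtimes>\<^bsub>K\<^esub> H\<^esub>"
    and Phi_rho_counit_right:
      "tsum3 (B \<boxtimes>\<^bsub>K\<^esub> H) (\<lambda>x1 x2 x3. etens K B H (counit H x3 \<odot>\<^bsub>B\<^esub> x1) x2) Phi_rho = \<one>\<^bsub>B \<boxtimes>\<^bsub>K\<^esub> H\<^esub>"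

locale left_comodule_algebra = quasi_bialgebra K H + B: assoc_algebra K B
  for K (structure) and H (structure) and B (structure) and lam and Phi_lam +
  assumes lam_hom: "lam \<in> alg_hom K B (H \<boxtimes>\<^bsub>K\<^esub> B)"
    and Phi_lam_unit: "Phi_lam \<in> Units (H \<boxtimes>\<^bsub>K\<^esub> H \<boxtimes>\<^bsub>K\<^esub> B)"
    and lam_quasi_coassoc: "u \<in> carrier B \<Longrightarrow>
      rtens K H (H \<boxtimes>\<^bsub>K\<^esub> B) lam (lam u) \<otimes>\<^bsub>H \<boxtimes>\<^bsub>K\<^esub> H \<boxtimes>\<^bsub>K\<^esub> B\<^esub> Phi_lam =
      Phi_lam \<otimes>\<^bsub>H \<boxtimes>\<^bsub>K\<^esub> H \<boxtimes>\<^bsub>K\<^esub> B\<^esub> ltens K H H B (comult H) (lam u)"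
    and lam_pentagon:
      "etens K H (H \<boxtimes>\<^bsub>K\<^esub> H \<boxtimes>\<^bsub>K\<^esub> B) \<one>\<^bsub>H\<^esub> Phi_lam
        \<otimes>\<^bsub>H \<boxtimes>\<^bsub>K\<^esub> H \<boxtimes>\<^bsub>K\<^esub> H \<boxtimes>\<^bsub>K\<^esub> B\<^esub> rtens K H (H \<boxtimes>\<^bsub>K\<^esub> H \<boxtimes>\<^bsub>K\<^esub> B) (ltens K H H B (comult H)) Phi_lam
        \<otimes>\<^bsub>H \<boxtimes>\<^bsub>K\<^esub> H \<boxtimes>\<^bsub>K\<^esub> H \<boxtimes>\<^bsub>K\<^esub> B\<^esub> tens_one K H H H B (reassoc H)
       = rtens K H (H \<boxtimes>\<^bsub>K\<^esub> H \<boxtimes>\<^bsub>K\<^esub> B) (rtens K H (H \<boxtimes>\<^bsub>K\<^esub> B) lam) Phi_lam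
        \<otimes>\<^bsub>H \<boxtimes>\<^bsub>K\<^esub> H \<boxtimes>\<^bsub>K\<^esub> H \<boxtimes>\<^bsub>K\<^esub> B\<^esub> ltens K H H (H \<boxtimes>\<^bsub>K\<^esub> B) (comult H) Phi_lam"
    and lam_counit: "u \<in> carrier B \<Longrightarrow> tsum2 B (\<lambda>u1 u0. counit H u1 \<odot>\<^bsub>B\<^esub> u0) (lam u) = u"
    and Phi_lam_counit_mid:
      "tsum3 (H \<boxtimes>\<^bsub>K\<^esub> B) (\<lambda>x1 x2 x3. etens K H B (counit H x2 \<odot>\<^bsub>H\<^esub> x1) x3) Phi_lam = \<one>\<^bsub>H \<boxtimes>\<^bsub>K\<^esub> B\<^esub>"
    and Phi_lam_counit_left:
      "tsum3 (H \<boxtimes>\<^bsub>K\<^esub> B) (\<lambda>x1 x2 x3. etens K H B (counit H x1 \<odot>\<^bsub>H\<^esub> x2) x3) Phi_lam = \<one>\<^bsub>H \<boxtimes>\<^bsub>K\<^esub> B\<^esub>"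

record ('k, 'b, 'h) bicomodule_algebra = "('k, 'b) module" +
  lcoact :: "'b \<Rightarrow> ('h, 'b) tens"
  rcoact :: "'b \<Rightarrow> ('b, 'h) tens"
  lreassoc :: "('h, ('h, 'b) tens) tens"
  rreassoc :: "('b, ('h, 'h) tens) tens"
  lrreassoc :: "('h, ('b, 'h) tens) tens"

locale bicomodule_algebra =
  left_comodule_algebra K H B "lcoact B" "lreassoc B" +
  right_comodule_algebra K H B "rcoact B" "rreassoc B"
  for K (structure) and H (structure) and B (structure) +
  assumes lrreassoc_unit: "lrreassoc B \<in> Units (H \<boxtimes>\<^bsub>K\<^esub> B \<boxtimes>\<^bsub>K\<^esub> H)"
    and lr_commute: "u \<in> carrier B \<Longrightarrow>
      lrreassoc B \<otimes>\<^bsub>H \<boxtimes>\<^bsub>K\<^esub> B \<boxtimes>\<^bsub>K\<^esub> H\<^esub> ltens K H B H (lcoact B) (rcoact B u) =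
      rtens K H (B \<boxtimes>\<^bsub>K\<^esub> H) (rcoact B) (lcoact B u) \<otimes>\<^bsub>H \<boxtimes>\<^bsub>K\<^esub> B \<boxtimes>\<^bsub>K\<^esub> H\<^esub> lrreassoc B"
    and lr_pentagon_left:
      "etens K H (H \<boxtimes>\<^bsub>K\<^esub> B \<boxtimes>\<^bsub>K\<^esub> H) \<one>\<^bsub>H\<^esub> (lrreassoc B)
        \<otimes>\<^bsub>H \<boxtimes>\<^bsub>K\<^esub> H \<boxtimes>\<^bsub>K\<^esub> B \<boxtimes>\<^bsub>K\<^esub> H\<^esub> rtens K H (H \<boxtimes>\<^bsub>K\<^esub> B \<boxtimes>\<^bsub>K\<^esub> H) (ltens K H B H (lcoact B)) (lrreassoc B)
        \<otimes>\<^bsub>H \<boxtimes>\<^bsub>K\<^esub> H \<boxtimes>\<^bsub>K\<^esub> B \<boxtimes>\<^bsub>K\<^esub> H\<^esub> tens_one K H H B H (lreassoc B)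
       = rtens K H (H \<boxtimes>\<^bsub>K\<^esub> B \<boxtimes>\<^bsub>K\<^esub> H) (rtens K H (B \<boxtimes>\<^bsub>K\<^esub> H) (rcoact B)) (lreassoc B)
        \<otimes>\<^bsub>H \<boxtimes>\<^bsub>K\<^esub> H \<boxtimes>\<^bsub>K\<^esub> B \<boxtimes>\<^bsub>K\<^esub> H\<^esub> ltens K H H (B \<boxtimes>\<^bsub>K\<^esub> H) (comult H) (lrreassoc B)"
    and lr_pentagon_right:
      "etens K H (B \<boxtimes>\<^bsub>K\<^esub> H \<boxtimes>\<^bsub>K\<^esub> H) \<one>\<^bsub>H\<^esub> (rreassoc B)
        \<otimes>\<^bsub>H \<boxtimes>\<^bsub>K\<^esub> B \<boxtimes>\<^bsub>K\<^esub> H \<boxtimes>\<^bsub>K\<^esub> H\<^esub> rtens K H (B \<boxtimes>\<^bsub>K\<^esub> H \<boxtimes>\<^bsub>K\<^esub> H) (ltens K B H H (rcoact B)) (lrreassoc B)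
        \<otimes>\<^bsub>H \<boxtimes>\<^bsub>K\<^esub> B \<boxtimes>\<^bsub>K\<^esub> H \<boxtimes>\<^bsub>K\<^esub> H\<^esub> tens_one K H B H H (lrreassoc B)
       = rtens K H (B \<boxtimes>\<^bsub>K\<^esub> H \<boxtimes>\<^bsub>K\<^esub> H) (rtens K B (H \<boxtimes>\<^bsub>K\<^esub> H) (comult H)) (lrreassoc B)
        \<otimes>\<^bsub>H \<boxtimes>\<^bsub>K\<^esub> B \<boxtimes>\<^bsub>K\<^esub> H \<boxtimes>\<^bsub>K\<^esub> H\<^esub> ltens K H B (H \<boxtimes>\<^bsub>K\<^esub> H) (lcoact B) (rreassoc B)"


section \<open>Generalized diagonal crossed products\<close>

type_synonym ('b, 'h) tens3 = "('h, ('b, 'h) tens) tens"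
type_synonym ('b, 'h) tens5 = "('h, ('h, ('b, ('h, 'h) tens) tens) tens) tens"

text \<open>The two-sided coactions \<open>(\<delta>\<^sub>l, \<Psi>\<^sub>l)\<close> and \<open>(\<delta>\<^sub>r, \<Psi>\<^sub>r)\<close>.\<close>

definition delta_l ::
  "('k, 'm) ring_scheme \<Rightarrow> ('k, 'h, 'z) quasi_hopf_scheme \<Rightarrow>
   ('k, 'b, 'h, 'y) bicomodule_algebra_scheme \<Rightarrow> 'b \<Rightarrow> ('b, 'h) tens3"
  where "delta_l K H B u = ltens K H B H (lcoact B) (rcoact B u)"

definition Psi_l ::
  "('k, 'm) ring_scheme \<Rightarrow> ('k, 'h, 'z) quasi_hopf_scheme \<Rightarrow>
   ('k, 'b, 'h, 'y) bicomodule_algebra_scheme \<Rightarrow> ('b, 'h) tens5"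
  where "Psi_l K H B =
    rtens K H (H \<boxtimes>\<^bsub>K\<^esub> B \<boxtimes>\<^bsub>K\<^esub> H \<boxtimes>\<^bsub>K\<^esub> H) (ltens K H B (H \<boxtimes>\<^bsub>K\<^esub> H) (lcoact B))
      (tens_one K H B H H (lrreassoc B)
        \<otimes>\<^bsub>H \<boxtimes>\<^bsub>K\<^esub> B \<boxtimes>\<^bsub>K\<^esub> H \<boxtimes>\<^bsub>K\<^esub> H\<^esub>
       ltens K H B (H \<boxtimes>\<^bsub>K\<^esub> H) (lcoact B) (inv\<^bsub>B \<boxtimes>\<^bsub>K\<^esub> H \<boxtimes>\<^bsub>K\<^esub> H\<^esub> (rreassoc B)))
    \<otimes>\<^bsub>H \<boxtimes>\<^bsub>K\<^esub> H \<boxtimes>\<^bsub>K\<^esub> B \<boxtimes>\<^bsub>K\<^esub> H \<boxtimes>\<^bsub>K\<^esub> H\<^esub>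
    tens_one K H H B (H \<boxtimes>\<^bsub>K\<^esub> H) (lreassoc B)"

definition delta_r ::
  "('k, 'm) ring_scheme \<Rightarrow> ('k, 'h, 'z) quasi_hopf_scheme \<Rightarrow>
   ('k, 'b, 'h, 'y) bicomodule_algebra_scheme \<Rightarrow> 'b \<Rightarrow> ('b, 'h) tens3"
  where "delta_r K H B u = rtens K H (B \<boxtimes>\<^bsub>K\<^esub> H) (rcoact B) (lcoact B u)"

definition Psi_r ::
  "('k, 'm) ring_scheme \<Rightarrow> ('k, 'h, 'z) quasi_hopf_scheme \<Rightarrow>
   ('k, 'b, 'h, 'y) bicomodule_algebra_scheme \<Rightarrow> ('b, 'h) tens5"
  where "Psi_r K H B =
    rtens K H (H \<boxtimes>\<^bsub>K\<^esub> B \<boxtimes>\<^bsub>K\<^esub> H \<boxtimes>\<^bsub>K\<^esub> H) (rtens K H (B \<boxtimes>\<^bsub>K\<^esub> H \<boxtimes>\<^bsub>K\<^esub> H) (ltens K B H H (rcoact B)))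
      (etens K H (H \<boxtimes>\<^bsub>K\<^esub> B \<boxtimes>\<^bsub>K\<^esub> H) \<one>\<^bsub>H\<^esub> (inv\<^bsub>H \<boxtimes>\<^bsub>K\<^esub> B \<boxtimes>\<^bsub>K\<^esub> H\<^esub> (lrreassoc B))
        \<otimes>\<^bsub>H \<boxtimes>\<^bsub>K\<^esub> H \<boxtimes>\<^bsub>K\<^esub> B \<boxtimes>\<^bsub>K\<^esub> H\<^esub>
       rtens K H (H \<boxtimes>\<^bsub>K\<^esub> B \<boxtimes>\<^bsub>K\<^esub> H) (rtens K H (B \<boxtimes>\<^bsub>K\<^esub> H) (rcoact B)) (lreassoc B))
    \<otimes>\<^bsub>H \<boxtimes>\<^bsub>K\<^esub> H \<boxtimes>\<^bsub>K\<^esub> B \<boxtimes>\<^bsub>K\<^esub> H \<boxtimes>\<^bsub>K\<^esub> H\<^esub>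
    etens K H (H \<boxtimes>\<^bsub>K\<^esub> B \<boxtimes>\<^bsub>K\<^esub> H \<boxtimes>\<^bsub>K\<^esub> H) \<one>\<^bsub>H\<^esub>
      (etens K H (B \<boxtimes>\<^bsub>K\<^esub> H \<boxtimes>\<^bsub>K\<^esub> H) \<one>\<^bsub>H\<^esub> (inv\<^bsub>B \<boxtimes>\<^bsub>K\<^esub> H \<boxtimes>\<^bsub>K\<^esub> H\<^esub> (rreassoc B)))"

definition etens5 ::
  "('k, 'm) ring_scheme \<Rightarrow> ('k, 'h, 'z) quasi_hopf_scheme \<Rightarrow>
   ('k, 'b, 'h, 'y) bicomodule_algebra_scheme \<Rightarrow> 'h \<Rightarrow> 'h \<Rightarrow> 'b \<Rightarrow> 'h \<Rightarrow> 'h \<Rightarrow> ('b, 'h) tens5"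
  where "etens5 K H B p1 p2 p3 p4 p5 =
    etens K H (H \<boxtimes>\<^bsub>K\<^esub> B \<boxtimes>\<^bsub>K\<^esub> H \<boxtimes>\<^bsub>K\<^esub> H) p1
      (etens K H (B \<boxtimes>\<^bsub>K\<^esub> H \<boxtimes>\<^bsub>K\<^esub> H) p2 (etens K B (H \<boxtimes>\<^bsub>K\<^esub> H) p3 (etens K H H p4 p5)))"

definition Omega_left ::
  "('k, 'm) ring_scheme \<Rightarrow> ('k, 'h, 'z) quasi_hopf_scheme \<Rightarrow>
   ('k, 'b, 'h, 'y) bicomodule_algebra_scheme \<Rightarrow> ('b, 'h) tens5 \<Rightarrow> ('b, 'h) tens5"
  where "Omega_left K H B Psi =
    tsum5 (H \<boxtimes>\<^bsub>K\<^esub> H \<boxtimes>\<^bsub>K\<^esub> B \<boxtimes>\<^bsub>K\<^esub> H \<boxtimes>\<^bsub>K\<^esub> H) (\<lambda>p1 p2 p3 p4 p5.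
      tsum2 (H \<boxtimes>\<^bsub>K\<^esub> H \<boxtimes>\<^bsub>K\<^esub> B \<boxtimes>\<^bsub>K\<^esub> H \<boxtimes>\<^bsub>K\<^esub> H) (\<lambda>f1 f2.
        etens5 K H B p1 p2 p3 (antipode_inv H (f1 \<otimes>\<^bsub>H\<^esub> p4)) (antipode_inv H (f2 \<otimes>\<^bsub>H\<^esub> p5)))
      (drinfeld_twist K H))
    (inv\<^bsub>H \<boxtimes>\<^bsub>K\<^esub> H \<boxtimes>\<^bsub>K\<^esub> B \<boxtimes>\<^bsub>K\<^esub> H \<boxtimes>\<^bsub>K\<^esub> H\<^esub> Psi)"

definition Omega_right ::
  "('k, 'm) ring_scheme \<Rightarrow> ('k, 'h, 'z) quasi_hopf_scheme \<Rightarrow>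
   ('k, 'b, 'h, 'y) bicomodule_algebra_scheme \<Rightarrow> ('b, 'h) tens5 \<Rightarrow> ('b, 'h) tens5"
  where "Omega_right K H B Psi =
    tsum5 (H \<boxtimes>\<^bsub>K\<^esub> H \<boxtimes>\<^bsub>K\<^esub> B \<boxtimes>\<^bsub>K\<^esub> H \<boxtimes>\<^bsub>K\<^esub> H) (\<lambda>p1 p2 p3 p4 p5.
      tsum2 (H \<boxtimes>\<^bsub>K\<^esub> H \<boxtimes>\<^bsub>K\<^esub> B \<boxtimes>\<^bsub>K\<^esub> H \<boxtimes>\<^bsub>K\<^esub> H) (\<lambda>g1 g2.
        etens5 K H B (antipode_inv H (p1 \<otimes>\<^bsub>H\<^esub> g1)) (antipode_inv H (p2 \<otimes>\<^bsub>H\<^esub> g2)) p3 p4 p5)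
      (inv\<^bsub>H \<boxtimes>\<^bsub>K\<^esub> H\<^esub> (drinfeld_twist K H)))
    Psi"

text \<open>
  The crossed products for a two-sided coaction \<open>(\<delta>, \<Psi>)\<close> have the space and the unit of the
  tensor product; only its multiplication is replaced.  The bound variables \<open>um\<close>, \<open>u0\<close>, \<open>up\<close>
  are \<open>u\<^bsub>(-1)\<^esub>\<close>, \<open>u\<^bsub>(0)\<^esub>\<close>, \<open>u\<^bsub>(1)\<^esub>\<close>.
\<close>

definition left_crossed_product ::
  "('k, 'm) ring_scheme \<Rightarrow> ('k, 'h, 'z) quasi_hopf_scheme \<Rightarrow>
   ('k, 'a, 'h, 'x) bimodule_algebra_scheme \<Rightarrow> ('k, 'b, 'h, 'y) bicomodule_algebra_scheme \<Rightarrow>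
   ('b \<Rightarrow> ('b, 'h) tens3) \<Rightarrow> ('b, 'h) tens5 \<Rightarrow> ('k, ('a, 'b) tens) module"
  where "left_crossed_product K H A B delta Psi = (A \<boxtimes>\<^bsub>K\<^esub> B)\<lparr> mult := (\<lambda>s t.
    tsum2 (A \<boxtimes>\<^bsub>K\<^esub> B) (\<lambda>a u.
     tsum2 (A \<boxtimes>\<^bsub>K\<^esub> B) (\<lambda>a' u'.
      tsum5 (A \<boxtimes>\<^bsub>K\<^esub> B) (\<lambda>w1 w2 w3 w4 w5.
       tsum3 (A \<boxtimes>\<^bsub>K\<^esub> B) (\<lambda>um u0 up.
         etens K A B
           (ract A (lact A w1 a) w5 \<otimes>\<^bsub>A\<^esub>
            ract A (lact A (w2 \<otimes>\<^bsub>H\<^esub> um) a') (antipode_inv H up \<otimes>\<^bsub>H\<^esub> w4))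
           (w3 \<otimes>\<^bsub>B\<^esub> u0 \<otimes>\<^bsub>B\<^esub> u'))
       (delta u))
      (Omega_left K H B Psi))
     t)
    s) \<rparr>"

definition right_crossed_product ::
  "('k, 'm) ring_scheme \<Rightarrow> ('k, 'h, 'z) quasi_hopf_scheme \<Rightarrow>
   ('k, 'a, 'h, 'x) bimodule_algebra_scheme \<Rightarrow> ('k, 'b, 'h, 'y) bicomodule_algebra_scheme \<Rightarrow>
   ('b \<Rightarrow> ('b, 'h) tens3) \<Rightarrow> ('b, 'h) tens5 \<Rightarrow> ('k, ('b, 'a) tens) module"
  where "right_crossed_product K H A B delta Psi = (B \<boxtimes>\<^bsub>K\<^esub> A)\<lparr> mult := (\<lambda>s t.
    tsum2 (B \<boxtimes>\<^bsub>K\<^esub> A) (\<lambda>u a.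
     tsum2 (B \<boxtimes>\<^bsub>K\<^esub> A) (\<lambda>u' a'.
      tsum5 (B \<boxtimes>\<^bsub>K\<^esub> A) (\<lambda>w1 w2 w3 w4 w5.
       tsum3 (B \<boxtimes>\<^bsub>K\<^esub> A) (\<lambda>um u0 up.
         etens K B A
           (u \<otimes>\<^bsub>B\<^esub> u0 \<otimes>\<^bsub>B\<^esub> w3)
           (ract A (lact A (w2 \<otimes>\<^bsub>H\<^esub> antipode_inv H um) a) (up \<otimes>\<^bsub>H\<^esub> w4) \<otimes>\<^bsub>A\<^esub>
            ract A (lact A w1 a') w5))
       (delta u'))
      (Omega_right K H B Psi))
     t)
    s) \<rparr>"

end

theory Submission
  imports Defs
begin

text \<open>
  Write \<open>U = \<Phi>\<^sub>\<lambda>\<^sub>\<rho>\<close>.  It twists \<open>\<delta>\<^sub>l\<close> into \<open>\<delta>\<^sub>r\<close>, that is \<open>U \<delta>\<^sub>l(u) = \<delta>\<^sub>r(u) U\<close>, and the two mixed pentagons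
  give \<open>\<Psi>\<^sub>r (\<Delta> \<otimes> id \<otimes> \<Delta>)(U) = (1 \<otimes> U \<otimes> 1) (id \<otimes> \<delta>\<^sub>l \<otimes> id)(U) \<Psi>\<^sub>l\<close>.  Hence
  \<open>\<phi> \<bowtie> u \<mapsto> U\<^sup>1 \<cdot> \<phi> \<cdot> S\<^sup>-\<^sup>1(U\<^sup>3) \<bowtie> U\<^sup>2 u\<close> is multiplicative, provided that \<open>f\<close> can be moved past coproducts,
  \<open>f \<Delta>(S h) = (S \<otimes> S)(\<Delta>\<^sup>c\<^sup>o\<^sup>p h) f\<close>; on the right one uses \<open>U\<^sup>-\<^sup>1\<close>.  The map fixes the copy of the bicomodule
  algebra because \<open>(\<epsilon> \<otimes> id \<otimes> id)(U) = 1\<close>.  Invertibility of \<open>f\<close> and its commutation rule follow Drinfeld: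
  \<open>(\<Delta> \<circ> S, \<Delta> \<alpha>, \<Delta> \<beta>)\<close> and \<open>((S \<otimes> S) \<circ> \<Delta>\<^sup>c\<^sup>o\<^sup>p, \<gamma>, \<delta>)\<close> both satisfy the antipode axioms
  relative to \<open>\<Delta>\<close>, and \<open>f\<close> is the comparison map in the uniqueness theorem for antipodes.
\<close>

section \<open>Linear maps and tensor products\<close>

text \<open>\<open>\<Phi>\<close>, f and U are not pure tensors. Every identity about them is
  therefore stated for a variable tensor, so that both sides are linear and pure tensors decide;
  only then is the variable set to \<open>\<Phi>\<close>, \<Delta> h or U. This is why so many
  auxiliary linear maps have names. The product of two transported factors dictates the form of the
  twist identity. It contains \<delta>_r(U^2 u) times the second copy of U; the intertwining rule
  makes this U \<delta>_l(U^2) \<delta>_l(u), and together with the outer legs of the first U one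
  gets (1 \<otimes> U \<otimes> 1)(id \<otimes> \<delta>_l \<otimes> id)(U). If instead the product
  is transported, U acts on a product of the bimodule algebra, hence through coproducts; S^-1
  reverses the one on the right, and crossing f restores it, which leaves (\<Delta> \<otimes> id
  \<otimes> \<Delta>)(U). The hard point is f: the antipode axioms of the second triple are not
  formal but need the pentagon in four legs. There a functional that turns coproducts in certain
  neighbouring legs into counits erases, by normalization, the unwanted factors of the
  pentagon.\<close>

definition klin ::
  "('k, 'm) ring_scheme \<Rightarrow> ('k, 'v, 'x) module_scheme \<Rightarrow> ('k, 'w, 'y) module_scheme \<Rightarrow>
   ('v \<Rightarrow> 'w) \<Rightarrow> bool"
  where "klin K V W F \<longleftrightarrow> (\<forall>v \<in> carrier V. F v \<in> carrier W) \<and>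
    (\<forall>v \<in> carrier V. \<forall>v' \<in> carrier V. F (v \<oplus>\<^bsub>V\<^esub> v') = F v \<oplus>\<^bsub>W\<^esub> F v') \<and>
    (\<forall>c \<in> carrier K. \<forall>v \<in> carrier V. F (c \<odot>\<^bsub>V\<^esub> v) = c \<odot>\<^bsub>W\<^esub> F v)"

lemma klinI:
  assumes "\<And>v. v \<in> carrier V \<Longrightarrow> F v \<in> carrier W"
    and "\<And>v v'. \<lbrakk> v \<in> carrier V; v' \<in> carrier V \<rbrakk> \<Longrightarrow> F (v \<oplus>\<^bsub>V\<^esub> v') = F v \<oplus>\<^bsub>W\<^esub> F v'"
    and "\<And>c v. \<lbrakk> c \<in> carrier K; v \<in> carrier V \<rbrakk> \<Longrightarrow> F (c \<odot>\<^bsub>V\<^esub> v) = c \<odot>\<^bsub>W\<^esub> F v"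
  shows "klin K V W F"
  using assms by (simp add: klin_def)

lemma klin_closed: "\<lbrakk> klin K V W F; v \<in> carrier V \<rbrakk> \<Longrightarrow> F v \<in> carrier W"
  and klin_add: "\<lbrakk> klin K V W F; v \<in> carrier V; v' \<in> carrier V \<rbrakk> \<Longrightarrow>
    F (v \<oplus>\<^bsub>V\<^esub> v') = F v \<oplus>\<^bsub>W\<^esub> F v'"
  and klin_smult: "\<lbrakk> klin K V W F; c \<in> carrier K; v \<in> carrier V \<rbrakk> \<Longrightarrow>
    F (c \<odot>\<^bsub>V\<^esub> v) = c \<odot>\<^bsub>W\<^esub> F v"
  by (simp_all add: klin_def)

lemma klin_zero:
  assumes "module K V" "module K W" "klin K V W F"
  shows "F \<zero>\<^bsub>V\<^esub> = \<zero>\<^bsub>W\<^esub>"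
proof -
  interpret V: module K V by fact
  interpret W: module K W by fact
  show ?thesis
    using klin_smult[OF assms(3), of "\<zero>\<^bsub>K\<^esub>" "\<zero>\<^bsub>V\<^esub>"] klin_closed[OF assms(3), of "\<zero>\<^bsub>V\<^esub>"]
    by (simp add: V.smult_l_null W.smult_l_null)
qed

lemma klin_comp: "\<lbrakk> klin K V W G; klin K U V F \<rbrakk> \<Longrightarrow> klin K U W (\<lambda>x. G (F x))"
  by (simp add: klin_def)

lemma klin_ident: "klin K V V (\<lambda>x. x)"
  by (simp add: klin_def)

lemma klin_cong:
  assumes "klin K V W F" "\<And>v. v \<in> carrier V \<Longrightarrow> F v = G v" "module K V"
  shows "klin K V W G"
proof -
  interpret V: module K V by fact
  show ?thesis
    by (rule klinI; use assms(1) in \<open>simp add: assms(2)[symmetric] klin_closed klin_add klin_smult\<close>)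
qed

section \<open>Tensor products of modules and Sweedler sums\<close>

locale tensor_calculus = cring K for K (structure)
begin

lemma tens_rep_closed:
  assumes V: "module K V" and W: "module K W" and t: "t \<in> carrier (V \<boxtimes> W)"
  shows "set (tens_rep t) \<subseteq> carrier V \<times> carrier W" (is ?g1) and "tens_class K V W (tens_rep t) = t" (is ?g2)
proof -
  have t': "t \<in> {xs. set xs \<subseteq> carrier V \<times> carrier W} // tens_rel K V W"
    using t by (simp add: tensor_def)
  then obtain xs where xs: "set xs \<subseteq> carrier V \<times> carrier W" "t = tens_rel K V W `` {xs}"
    by (auto elim: quotientE)
  have "xs \<in> t" using xs tens_rel.refl by blast
  then have r: "tens_rep t \<in> t" unfolding tens_rep_def by (metis someI)
  then have rel: "(xs, tens_rep t) \<in> tens_rel K V W" using xs by simp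
  then show ?g1 using tens_rel_carrier[OF V W] by blast
  show ?g2
    unfolding tens_class_def xs(2)
    using equiv_class_eq[OF equiv_tens_rel[OF V W] rel] xs(2) by simp
qed

lemma tens_class_eqI:
  assumes "module K V" "module K W" "(xs, ys) \<in> tens_rel K V W"
  shows "tens_class K V W xs = tens_class K V W ys"
  unfolding tens_class_def using equiv_class_eq[OF equiv_tens_rel[OF assms(1,2)] assms(3)] .

lemma tens_class_closed:
  "set xs \<subseteq> carrier V \<times> carrier W \<Longrightarrow> tens_class K V W xs \<in> carrier (V \<boxtimes> W)"
  unfolding tens_class_def tensor_def by (simp add: quotientI)

lemma tens_rep_class:
  assumes "module K V" "module K W" "set xs \<subseteq> carrier V \<times> carrier W"
  shows "(tens_rep (tens_class K V W xs), xs) \<in> tens_rel K V W"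
proof -
  have "xs \<in> tens_class K V W xs" using assms(3) tens_rel.refl by (fastforce simp: tens_class_def)
  then have "tens_rep (tens_class K V W xs) \<in> tens_class K V W xs"
    unfolding tens_rep_def by (metis someI)
  then show ?thesis by (simp add: tens_class_def tens_rel.sym)
qed

lemma tens_add_class:
  assumes "module K V" "module K W"
    and "set xs \<subseteq> carrier V \<times> carrier W" "set ys \<subseteq> carrier V \<times> carrier W"
  shows "tens_class K V W xs \<oplus>\<^bsub>V \<boxtimes> W\<^esub> tens_class K V W ys = tens_class K V W (xs @ ys)"
  using tens_rep_class[OF assms(1-3)] tens_rep_class[OF assms(1,2,4)]
  by (simp add: tensor_def tens_class_eqI[OF assms(1,2)] tens_rel.append)

lemma tens_rel_smult:
  assumes V: "module K V" and "module K W" and c: "c \<in> carrier K"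
  shows "(xs, ys) \<in> tens_rel K V W \<Longrightarrow>
    (map (\<lambda>(v, w). (c \<odot>\<^bsub>V\<^esub> v, w)) xs, map (\<lambda>(v, w). (c \<odot>\<^bsub>V\<^esub> v, w)) ys) \<in> tens_rel K V W"
proof (induction rule: tens_rel.induct)
  case (refl xs)
  interpret V: module K V by fact
  show ?case by (rule tens_rel.refl) (use refl c in auto)
next
  case (sym xs ys) then show ?case by (rule_tac tens_rel.sym)
next
  case (trans xs ys zs) then show ?case by (rule_tac tens_rel.trans)
next
  case (append xs xs' ys ys') then show ?case by (simp add: tens_rel.append)
next
  case (comm xs ys)
  interpret V: module K V by fact
  show ?case unfolding map_append by (rule tens_rel.comm) (use comm c in auto)
next
  case (add_left v v' w)
  interpret V: module K V by fact
  show ?case using add_left c by (simp add: V.smult_r_distr tens_rel.add_left)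
next
  case (add_right v w w')
  interpret V: module K V by fact
  show ?case using add_right c by (simp add: tens_rel.add_right)
next
  case (balanced d v w)
  interpret V: module K V by fact
  have "c \<odot>\<^bsub>V\<^esub> (d \<odot>\<^bsub>V\<^esub> v) = d \<odot>\<^bsub>V\<^esub> (c \<odot>\<^bsub>V\<^esub> v)"
    using balanced c by (simp add: V.smult_assoc1[symmetric] m_comm)
  then show ?case using balanced c by (simp add: tens_rel.balanced)
next
  case (zero w)
  interpret V: module K V by fact
  show ?case using zero c by (simp add: V.smult_r_null tens_rel.zero)
qed

lemma tens_smult_class:
  assumes "module K V" "module K W" "c \<in> carrier K" "set xs \<subseteq> carrier V \<times> carrier W"
  shows "c \<odot>\<^bsub>V \<boxtimes> W\<^esub> tens_class K V W xs = tens_class K V W (map (\<lambda>(v, w). (c \<odot>\<^bsub>V\<^esub> v, w)) xs)"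
  using tens_class_eqI[OF assms(1,2) tens_rel_smult[OF assms(1-3) tens_rep_class[OF assms(1,2,4)]]]
  by (simp add: tensor_def)

lemma tens_zero_class: "\<zero>\<^bsub>V \<boxtimes> W\<^esub> = tens_class K V W []"
  by (simp add: tensor_def)

lemma etens_closed [simp, intro]:
  "\<lbrakk> v \<in> carrier V; w \<in> carrier W \<rbrakk> \<Longrightarrow> etens K V W v w \<in> carrier (V \<boxtimes> W)"
  unfolding etens_def by (rule tens_class_closed) auto

lemma tens_class_Cons:
  assumes "module K V" "module K W" "v \<in> carrier V" "w \<in> carrier W"
    and "set xs \<subseteq> carrier V \<times> carrier W"
  shows "tens_class K V W ((v, w) # xs) = etens K V W v w \<oplus>\<^bsub>V \<boxtimes> W\<^esub> tens_class K V W xs"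
  using tens_add_class[OF assms(1,2), of "[(v, w)]" xs] assms by (simp add: etens_def)

lemma tens_cases:
  assumes "module K V" "module K W" "t \<in> carrier (V \<boxtimes> W)"
  obtains xs where "set xs \<subseteq> carrier V \<times> carrier W" "t = tens_class K V W xs"
  using tens_rep_closed[OF assms] by metis

text \<open>Follows the representing list. The handier \<open>tens_induct\<close> presupposes the
  module structure, which is itself built with this rule.\<close>

lemma tens_induct_aux [consumes 3, case_names zero add]:
  assumes "module K V" "module K W" "t \<in> carrier (V \<boxtimes> W)"
    and "P \<zero>\<^bsub>V \<boxtimes> W\<^esub>"
    and "\<And>v w t. \<lbrakk> v \<in> carrier V; w \<in> carrier W; t \<in> carrier (V \<boxtimes> W); P t \<rbrakk> \<Longrightarrow>
      P (etens K V W v w \<oplus>\<^bsub>V \<boxtimes> W\<^esub> t)"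
  shows "P t"
proof -
  have "set xs \<subseteq> carrier V \<times> carrier W \<Longrightarrow> P (tens_class K V W xs)" for xs
  proof (induction xs)
    case Nil then show ?case using assms(4) by (simp add: tens_zero_class)
  next
    case (Cons x xs)
    then obtain v w where x: "x = (v, w)" "v \<in> carrier V" "w \<in> carrier W" by auto
    with Cons show ?case
      using tens_class_Cons[OF assms(1,2) x(2,3), of xs]
        assms(5)[OF x(2,3) tens_class_closed, of xs] by auto
  qed
  then show ?thesis using tens_cases[OF assms(1-3)] by metis
qed

lemma etens_add_left:
  assumes "module K V" "module K W" "v \<in> carrier V" "v' \<in> carrier V" "w \<in> carrier W"
  shows "etens K V W (v \<oplus>\<^bsub>V\<^esub> v') w = etens K V W v w \<oplus>\<^bsub>V \<boxtimes> W\<^esub> etens K V W v' w"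
  using tens_class_eqI[OF assms(1,2) tens_rel.add_left[OF assms(3-5)]]
    tens_add_class[OF assms(1,2), of "[(v, w)]" "[(v', w)]"] assms by (simp add: etens_def)

lemma etens_add_right:
  assumes "module K V" "module K W" "v \<in> carrier V" "w \<in> carrier W" "w' \<in> carrier W"
  shows "etens K V W v (w \<oplus>\<^bsub>W\<^esub> w') = etens K V W v w \<oplus>\<^bsub>V \<boxtimes> W\<^esub> etens K V W v w'"
  using tens_class_eqI[OF assms(1,2) tens_rel.add_right[OF assms(3-5)]]
    tens_add_class[OF assms(1,2), of "[(v, w)]" "[(v, w')]"] assms by (simp add: etens_def)

lemma etens_smult_left:
  assumes "module K V" "module K W" "c \<in> carrier K" "v \<in> carrier V" "w \<in> carrier W"
  shows "etens K V W (c \<odot>\<^bsub>V\<^esub> v) w = c \<odot>\<^bsub>V \<boxtimes> W\<^esub> etens K V W v w"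
  using tens_smult_class[OF assms(1-3), of "[(v, w)]"] assms by (simp add: etens_def)

lemma etens_smult_right:
  assumes "module K V" "module K W" "c \<in> carrier K" "v \<in> carrier V" "w \<in> carrier W"
  shows "etens K V W v (c \<odot>\<^bsub>W\<^esub> w) = c \<odot>\<^bsub>V \<boxtimes> W\<^esub> etens K V W v w"
  using tens_class_eqI[OF assms(1,2) tens_rel.balanced[OF assms(3-5)]] etens_smult_left[OF assms]
  by (simp add: etens_def)

lemma tensor_zero_closed: "\<zero>\<^bsub>V \<boxtimes> W\<^esub> \<in> carrier (V \<boxtimes> W)"
  by (simp add: tens_zero_class tens_class_closed)

lemma module_tensor [simp, intro]:
  assumes V: "module K V" and W: "module K W"
  shows "module K (V \<boxtimes> W)"
proof -
  interpret V: module K V by fact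
  interpret W: module K W by fact
  let ?T = "V \<boxtimes> W"
  note cases = tens_cases[OF V W]
  note add_cls = tens_add_class[OF V W]
  have addc: "x \<oplus>\<^bsub>?T\<^esub> y \<in> carrier ?T" if x: "x \<in> carrier ?T" and y: "y \<in> carrier ?T" for x y
    by (rule cases[OF x], rule cases[OF y]) (simp add: add_cls tens_class_closed)
  have smc: "c \<odot>\<^bsub>?T\<^esub> x \<in> carrier ?T" if "c \<in> carrier K" "x \<in> carrier ?T" for c x
  proof -
    obtain xs where xs: "set xs \<subseteq> carrier V \<times> carrier W" "x = tens_class K V W xs"
      using cases[OF \<open>x \<in> carrier ?T\<close>] .
    have "set (map (\<lambda>(v, w). (c \<odot>\<^bsub>V\<^esub> v, w)) xs) \<subseteq> carrier V \<times> carrier W"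
      using xs(1) \<open>c \<in> carrier K\<close> by auto
    then show ?thesis
      unfolding xs(2) tens_smult_class[OF V W \<open>c \<in> carrier K\<close> xs(1)] by (rule tens_class_closed)
  qed
  have assoc: "(x \<oplus>\<^bsub>?T\<^esub> y) \<oplus>\<^bsub>?T\<^esub> z = x \<oplus>\<^bsub>?T\<^esub> (y \<oplus>\<^bsub>?T\<^esub> z)"
    if x: "x \<in> carrier ?T" and y: "y \<in> carrier ?T" and z: "z \<in> carrier ?T" for x y z
    by (rule cases[OF x], rule cases[OF y], rule cases[OF z]) (simp add: add_cls)
  have comm: "x \<oplus>\<^bsub>?T\<^esub> y = y \<oplus>\<^bsub>?T\<^esub> x" if x: "x \<in> carrier ?T" and y: "y \<in> carrier ?T" for x y
    by (rule cases[OF x], rule cases[OF y])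
      (simp add: add_cls, rule tens_class_eqI[OF V W tens_rel.comm])
  have zero_l: "\<zero>\<^bsub>?T\<^esub> \<oplus>\<^bsub>?T\<^esub> x = x" if x: "x \<in> carrier ?T" for x
    by (rule cases[OF x]) (simp add: add_cls tens_zero_class)
  have ac: "(a \<oplus>\<^bsub>?T\<^esub> b) \<oplus>\<^bsub>?T\<^esub> (c \<oplus>\<^bsub>?T\<^esub> d) = (a \<oplus>\<^bsub>?T\<^esub> c) \<oplus>\<^bsub>?T\<^esub> (b \<oplus>\<^bsub>?T\<^esub> d)"
    if a: "a \<in> carrier ?T" and b: "b \<in> carrier ?T" and c: "c \<in> carrier ?T" and d: "d \<in> carrier ?T" for a b c d
    by (metis a b c d assoc comm addc)
  have sm_add: "c \<odot>\<^bsub>?T\<^esub> (x \<oplus>\<^bsub>?T\<^esub> y) = c \<odot>\<^bsub>?T\<^esub> x \<oplus>\<^bsub>?T\<^esub> c \<odot>\<^bsub>?T\<^esub> y"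
    if c: "c \<in> carrier K" and x: "x \<in> carrier ?T" and y: "y \<in> carrier ?T" for c x y
  proof -
    obtain xs where xs: "set xs \<subseteq> carrier V \<times> carrier W" "x = tens_class K V W xs" using cases[OF x] .
    obtain ys where ys: "set ys \<subseteq> carrier V \<times> carrier W" "y = tens_class K V W ys" using cases[OF y] .
    have "set (map (\<lambda>(v, w). (c \<odot>\<^bsub>V\<^esub> v, w)) zs) \<subseteq> carrier V \<times> carrier W"
      if "set zs \<subseteq> carrier V \<times> carrier W" for zs using that c by auto
    then show ?thesis using xs ys c by (simp add: add_cls tens_smult_class[OF V W])
  qed
  have sm_zero: "c \<odot>\<^bsub>?T\<^esub> \<zero>\<^bsub>?T\<^esub> = \<zero>\<^bsub>?T\<^esub>" if "c \<in> carrier K" for c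
    using tens_smult_class[OF V W that, of "[]"] by (simp add: tens_zero_class)
  have sm_et: "c \<odot>\<^bsub>?T\<^esub> etens K V W v w = etens K V W (c \<odot>\<^bsub>V\<^esub> v) w"
    if "c \<in> carrier K" "v \<in> carrier V" "w \<in> carrier W" for c v w
    using etens_smult_left[OF V W that] by simp
  have sm_distr: "(c \<oplus> d) \<odot>\<^bsub>?T\<^esub> x = c \<odot>\<^bsub>?T\<^esub> x \<oplus>\<^bsub>?T\<^esub> d \<odot>\<^bsub>?T\<^esub> x"
    if c: "c \<in> carrier K" and d: "d \<in> carrier K" and x: "x \<in> carrier ?T" for c d x
    using V W x
  proof (induction x rule: tens_induct_aux)
    case zero show ?case using c d zero_l[OF tensor_zero_closed] by (simp add: sm_zero)
  next
    case (add v w t)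
    have "(c \<oplus> d) \<odot>\<^bsub>?T\<^esub> etens K V W v w
        = c \<odot>\<^bsub>?T\<^esub> etens K V W v w \<oplus>\<^bsub>?T\<^esub> d \<odot>\<^bsub>?T\<^esub> etens K V W v w"
      using add c d by (simp add: sm_et V.smult_l_distr etens_add_left V W)
    then show ?case using add c d by (simp add: sm_add etens_closed smc ac)
  qed
  have sm_assoc: "(c \<otimes> d) \<odot>\<^bsub>?T\<^esub> x = c \<odot>\<^bsub>?T\<^esub> (d \<odot>\<^bsub>?T\<^esub> x)"
    if c: "c \<in> carrier K" and d: "d \<in> carrier K" and x: "x \<in> carrier ?T" for c d x
    using V W x
    by (induction x rule: tens_induct_aux)
      (use c d in \<open>simp_all add: sm_zero sm_add smc sm_et V.smult_assoc1\<close>)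
  have sm_one: "\<one> \<odot>\<^bsub>?T\<^esub> x = x" if x: "x \<in> carrier ?T" for x
    using V W x by (induction x rule: tens_induct_aux) (simp_all add: sm_zero sm_add sm_et)
  \<comment> \<open>Lists form only a monoid, so negatives must come from scalars: -1 times x is a
    negative of x once 0 times x vanishes, and that is what the relation \<open>zero\<close>
    provides.\<close>
  have inv: "\<exists>y \<in> carrier ?T. y \<oplus>\<^bsub>?T\<^esub> x = \<zero>\<^bsub>?T\<^esub>" if x: "x \<in> carrier ?T" for x
  proof
    have null: "\<zero> \<odot>\<^bsub>?T\<^esub> x = \<zero>\<^bsub>?T\<^esub>" using V W x
    proof (induction x rule: tens_induct_aux)
      case zero show ?case by (simp add: sm_zero)
    next
      case (add v w t)
      have "etens K V W \<zero>\<^bsub>V\<^esub> w = \<zero>\<^bsub>?T\<^esub>"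
        using tens_class_eqI[OF V W tens_rel.zero[OF add(2)]] by (simp add: etens_def tens_zero_class)
      then show ?case using add by (simp add: sm_add sm_et V.smult_l_null zero_l[OF tensor_zero_closed])
    qed
    have "(\<ominus> \<one>) \<odot>\<^bsub>?T\<^esub> x \<oplus>\<^bsub>?T\<^esub> \<one> \<odot>\<^bsub>?T\<^esub> x = \<zero>\<^bsub>?T\<^esub>"
      using sm_distr[of "\<ominus> \<one>" \<one> x] x null by (simp add: l_neg)
    then show "(\<ominus> \<one>) \<odot>\<^bsub>?T\<^esub> x \<oplus>\<^bsub>?T\<^esub> x = \<zero>\<^bsub>?T\<^esub>" using x by (simp add: sm_one)
    show "(\<ominus> \<one>) \<odot>\<^bsub>?T\<^esub> x \<in> carrier ?T" using x by (simp add: smc)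
  qed
  have "abelian_group ?T"
    by (rule abelian_groupI) (use addc assoc comm zero_l inv tensor_zero_closed in auto)
  then show ?thesis
    by (rule moduleI[OF is_cring]) (use smc sm_distr sm_add sm_assoc sm_one in auto)
qed

text \<open>No case for zero is left because the zero tensor is pure, namely zero tensor
  zero.\<close>

lemma tens_induct [consumes 3, case_names pure add]:
  assumes V: "module K V" and W: "module K W" and t: "t \<in> carrier (V \<boxtimes> W)"
    and pure: "\<And>v w. \<lbrakk> v \<in> carrier V; w \<in> carrier W \<rbrakk> \<Longrightarrow> P (etens K V W v w)"
    and add: "\<And>s t. \<lbrakk> s \<in> carrier (V \<boxtimes> W); t \<in> carrier (V \<boxtimes> W); P s; P t \<rbrakk> \<Longrightarrow>
      P (s \<oplus>\<^bsub>V \<boxtimes> W\<^esub> t)"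
  shows "P t"
proof (rule tens_induct_aux[OF V W t])
  interpret V: module K V by fact
  interpret W: module K W by fact
  interpret T: module K "V \<boxtimes> W" using V W by simp
  have "etens K V W \<zero>\<^bsub>V\<^esub> \<zero>\<^bsub>W\<^esub> = \<zero>\<^bsub>V \<boxtimes> W\<^esub>"
    using etens_smult_left[OF V W zero_closed, of "\<zero>\<^bsub>V\<^esub>" "\<zero>\<^bsub>W\<^esub>"]
    by (simp add: V.smult_l_null T.smult_l_null)
  then show "P \<zero>\<^bsub>V \<boxtimes> W\<^esub>" using pure[of "\<zero>\<^bsub>V\<^esub>" "\<zero>\<^bsub>W\<^esub>"] by simp
next
  fix v w t assume "v \<in> carrier V" "w \<in> carrier W" "t \<in> carrier (V \<boxtimes> W)" "P t"
  then show "P (etens K V W v w \<oplus>\<^bsub>V \<boxtimes> W\<^esub> t)"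
    using pure[of v w] add[of "etens K V W v w" t] by simp
qed

text \<open>The main proof device: linear identities are decided on pure tensors. Chained by
  \<open>;\<close> with an optional second or third \<open>rule\<close>, it handles identities
  linear in several tensors at once; the simplifier then faces linearity goals, which the
  \<open>klin\<close> rules solve, and one goal about pure tensors.\<close>

lemma tens_eqI:
  assumes t: "t \<in> carrier (V \<boxtimes> W)" and V: "module K V" and W: "module K W"
    and F: "klin K (V \<boxtimes> W) X F" and G: "klin K (V \<boxtimes> W) X G"
    and eq: "\<And>v w. \<lbrakk> v \<in> carrier V; w \<in> carrier W \<rbrakk> \<Longrightarrow> F (etens K V W v w) = G (etens K V W v w)"
  shows "F t = G t"
  using V W t
  by (induction t rule: tens_induct) (simp_all add: eq klin_add[OF F] klin_add[OF G])

lemma lsum_closed: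
  assumes "module K X" "\<And>v w. (v, w) \<in> set xs \<Longrightarrow> f v w \<in> carrier X"
  shows "lsum X f xs \<in> carrier X"
proof -
  interpret X: module K X by fact
  show ?thesis using assms(2) by (induction xs) (auto simp: lsum_def)
qed

lemma tsum2_closed [simp, intro]:
  assumes "module K V" "module K W" "module K X" "t \<in> carrier (V \<boxtimes> W)"
    and "\<And>v w. \<lbrakk> v \<in> carrier V; w \<in> carrier W \<rbrakk> \<Longrightarrow> f v w \<in> carrier X"
  shows "tsum2 X f t \<in> carrier X"
  unfolding tsum2_def by (rule lsum_closed) (use tens_rep_closed[OF assms(1,2,4)] assms in auto)

lemma tsum2_cong:
  assumes "module K V" "module K W" "t \<in> carrier (V \<boxtimes> W)"
    and eq: "\<And>v w. \<lbrakk> v \<in> carrier V; w \<in> carrier W \<rbrakk> \<Longrightarrow> f v w = g v w"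
  shows "tsum2 X f t = tsum2 X g t"
proof -
  have "lsum X f xs = lsum X g xs" if "set xs \<subseteq> carrier V \<times> carrier W" for xs
    using that by (induction xs) (auto simp: lsum_def eq)
  then show ?thesis unfolding tsum2_def using tens_rep_closed[OF assms(1-3)] by simp
qed

lemma klin_tsum2_out:
  assumes "module K V" "module K W" "module K X" "module K Y" "t \<in> carrier (V \<boxtimes> W)"
    and F: "klin K X Y F"
    and f: "\<And>v w. \<lbrakk> v \<in> carrier V; w \<in> carrier W \<rbrakk> \<Longrightarrow> f v w \<in> carrier X"
  shows "F (tsum2 X f t) = tsum2 Y (\<lambda>v w. F (f v w)) t"
proof -
  interpret X: module K X by fact
  have "F (lsum X f xs) = lsum Y (\<lambda>v w. F (f v w)) xs"
    if "set xs \<subseteq> carrier V \<times> carrier W" for xs using that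
  proof (induction xs)
    case Nil then show ?case by (simp add: lsum_def klin_zero[OF assms(3,4) F])
  next
    case (Cons x xs)
    then obtain v w where x: "x = (v, w)" "v \<in> carrier V" "w \<in> carrier W" by auto
    have "lsum X f xs \<in> carrier X" by (rule lsum_closed[OF assms(3)]) (use Cons f in auto)
    then show ?case using Cons x f klin_add[OF F] by (simp add: lsum_def)
  qed
  then show ?thesis unfolding tsum2_def using tens_rep_closed[OF assms(1,2,5)] by simp
qed

lemma klin_add_fun:
  assumes "module K W" "klin K V W F" "klin K V W G"
  shows "klin K V W (\<lambda>x. F x \<oplus>\<^bsub>W\<^esub> G x)"
proof -
  interpret W: module K W by fact
  note [simp] = klin_closed[OF assms(2)] klin_closed[OF assms(3)]
  show ?thesis
    by (rule klinI) (simp_all add: klin_add[OF assms(2)] klin_add[OF assms(3)] klin_smult[OF assms(2)]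
        klin_smult[OF assms(3)] W.smult_r_distr W.a_ac)
qed

lemma klin_zero_fun: "module K W \<Longrightarrow> klin K V W (\<lambda>x. \<zero>\<^bsub>W\<^esub>)"
proof -
  assume "module K W"
  then interpret W: module K W .
  show ?thesis by (rule klinI) (simp_all add: W.smult_r_null)
qed

text \<open>Linearity in a parameter of the summand while the tensor is fixed, as opposed to
  \<open>klin_tsum2\<close>, which is linearity in the tensor. Nested sums use the two
  alternately.\<close>

lemma klin_tsum2_param:
  assumes "module K V" "module K W" "module K X" "t \<in> carrier (V \<boxtimes> W)"
    and f: "\<And>v w. \<lbrakk> v \<in> carrier V; w \<in> carrier W \<rbrakk> \<Longrightarrow> klin K U X (\<lambda>x. f x v w)"
  shows "klin K U X (\<lambda>x. tsum2 X (f x) t)"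
proof -
  have "klin K U X (\<lambda>x. lsum X (f x) xs)" if "set xs \<subseteq> carrier V \<times> carrier W" for xs
    using that by (induction xs) (auto simp: lsum_def intro!: klin_add_fun klin_zero_fun assms)
  then show ?thesis unfolding tsum2_def using tens_rep_closed[OF assms(1,2,4)] by simp
qed

lemma tsum2_etens:
  assumes "module K V" "module K W" "module K X"
    and r: "\<And>v. v \<in> carrier V \<Longrightarrow> klin K W X (f v)"
    and l: "\<And>w. w \<in> carrier W \<Longrightarrow> klin K V X (\<lambda>v. f v w)"
    and v: "v \<in> carrier V" and w: "w \<in> carrier W"
  shows "tsum2 X f (etens K V W v w) = f v w"
proof -
  interpret X: module K X by fact
  have "tsum2 X f (tens_class K V W [(v, w)]) = lsum X f [(v, w)]"
    by (rule tsum2_tens_class[OF assms(1-3)])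
      (use v w in \<open>simp_all add: klin_closed[OF r] klin_add[OF r] klin_add[OF l] klin_smult[OF r] klin_smult[OF l]\<close>)
  then show ?thesis using klin_closed[OF r[OF v] w] by (simp add: etens_def lsum_def)
qed

lemma klin_tsum2:
  assumes V: "module K V" and W: "module K W" and X: "module K X"
    and r: "\<And>v. v \<in> carrier V \<Longrightarrow> klin K W X (f v)"
    and l: "\<And>w. w \<in> carrier W \<Longrightarrow> klin K V X (\<lambda>v. f v w)"
  shows "klin K (V \<boxtimes> W) X (tsum2 X f)"
proof -
  interpret X: module K X by fact
  interpret V: module K V by fact
  have cl: "f v w \<in> carrier X" if "v \<in> carrier V" "w \<in> carrier W" for v w
    using klin_closed[OF r] that by blast
  have tc: "tsum2 X f (tens_class K V W xs) = lsum X f xs" if "set xs \<subseteq> carrier V \<times> carrier W" for xs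
    by (rule tsum2_tens_class[OF V W X _ _ _ _ _ that])
      (simp_all add: cl klin_add[OF r] klin_add[OF l] klin_smult[OF r] klin_smult[OF l])
  have lc: "lsum X f xs \<in> carrier X" if "set xs \<subseteq> carrier V \<times> carrier W" for xs
    by (rule lsum_closed[OF X]) (use that cl in auto)
  have la: "lsum X f (xs @ ys) = lsum X f xs \<oplus>\<^bsub>X\<^esub> lsum X f ys"
    if "set xs \<subseteq> carrier V \<times> carrier W" "set ys \<subseteq> carrier V \<times> carrier W" for xs ys
    using that(1)
  proof (induction xs)
    case Nil then show ?case using lc[OF that(2)] by (simp add: lsum_def)
  next
    case (Cons x xs)
    then obtain v w where x: "x = (v, w)" "v \<in> carrier V" "w \<in> carrier W" by auto
    have "lsum X f (zs @ ys) = f v w \<oplus>\<^bsub>X\<^esub> lsum X f (xs @ ys)" if "zs = x # xs" for zs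
      using that x by (simp add: lsum_def)
    moreover have "lsum X f (x # xs) = f v w \<oplus>\<^bsub>X\<^esub> lsum X f xs" using x by (simp add: lsum_def)
    ultimately show ?case using Cons x lc[OF that(2)] lc[of xs] cl by (simp add: X.a_assoc)
  qed
  have ls: "lsum X f (map (\<lambda>(v, w). (c \<odot>\<^bsub>V\<^esub> v, w)) xs) = c \<odot>\<^bsub>X\<^esub> lsum X f xs"
    if "c \<in> carrier K" "set xs \<subseteq> carrier V \<times> carrier W" for c xs
    using that(2)
  proof (induction xs)
    case Nil then show ?case using that by (simp add: lsum_def X.smult_r_null)
  next
    case (Cons x xs)
    then obtain v w where x: "x = (v, w)" "v \<in> carrier V" "w \<in> carrier W" by auto
    have "lsum X f xs \<in> carrier X" using Cons by (simp add: lc)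
    then show ?case using Cons x that by (simp add: lsum_def cl klin_smult[OF l] X.smult_r_distr)
  qed
  show ?thesis
  proof (rule klinI)
    fix s assume s: "s \<in> carrier (V \<boxtimes> W)"
    obtain xs where xs: "set xs \<subseteq> carrier V \<times> carrier W" "s = tens_class K V W xs" using tens_cases[OF V W s] .
    then show "tsum2 X f s \<in> carrier X" by (simp add: tc lc)
    {
      fix t assume t: "t \<in> carrier (V \<boxtimes> W)"
      obtain ys where ys: "set ys \<subseteq> carrier V \<times> carrier W" "t = tens_class K V W ys" using tens_cases[OF V W t] .
      show "tsum2 X f (s \<oplus>\<^bsub>V \<boxtimes> W\<^esub> t) = tsum2 X f s \<oplus>\<^bsub>X\<^esub> tsum2 X f t"
        using xs ys by (simp add: tens_add_class[OF V W] tc la)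
    }
    fix c assume c: "c \<in> carrier K"
    have "set (map (\<lambda>(v, w). (c \<odot>\<^bsub>V\<^esub> v, w)) xs) \<subseteq> carrier V \<times> carrier W" using xs c by auto
    then show "tsum2 X f (c \<odot>\<^bsub>V \<boxtimes> W\<^esub> s) = c \<odot>\<^bsub>X\<^esub> tsum2 X f s"
      using xs c by (simp add: tens_smult_class[OF V W] tc ls)
  qed
qed

section \<open>Tensor products of algebras\<close>

lemma alg_mod [simp]: "assoc_algebra K V \<Longrightarrow> module K V"
  by (simp add: assoc_algebra_def)

lemma alg_ring: "assoc_algebra K V \<Longrightarrow> ring V"
  by (simp add: assoc_algebra_def)

lemma alg_closed [simp, intro]:
  assumes "assoc_algebra K V"
  shows "\<lbrakk> x \<in> carrier V; y \<in> carrier V \<rbrakk> \<Longrightarrow> x \<otimes>\<^bsub>V\<^esub> y \<in> carrier V" (is "PROP ?g1")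
    and "\<one>\<^bsub>V\<^esub> \<in> carrier V" (is ?g2)
proof -
  interpret V: ring V using alg_ring assms .
  show "PROP ?g1" ?g2
    by simp_all
qed

lemma alg_one [simp]:
  assumes "assoc_algebra K V" "x \<in> carrier V"
  shows "\<one>\<^bsub>V\<^esub> \<otimes>\<^bsub>V\<^esub> x = x" (is ?g1) and "x \<otimes>\<^bsub>V\<^esub> \<one>\<^bsub>V\<^esub> = x" (is ?g2)
proof -
  interpret V: ring V using alg_ring assms(1) .
  show ?g1 ?g2 using assms(2) by simp_all
qed

lemma alg_assoc:
  assumes "assoc_algebra K V" "x \<in> carrier V" "y \<in> carrier V" "z \<in> carrier V"
  shows "(x \<otimes>\<^bsub>V\<^esub> y) \<otimes>\<^bsub>V\<^esub> z = x \<otimes>\<^bsub>V\<^esub> (y \<otimes>\<^bsub>V\<^esub> z)"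
proof -
  interpret V: ring V using alg_ring assms(1) .
  show ?thesis using assms by (simp add: V.m_assoc)
qed

lemma smult_closed' [simp, intro]:
  assumes "module K V" "c \<in> carrier K" "x \<in> carrier V"
  shows "c \<odot>\<^bsub>V\<^esub> x \<in> carrier V"
proof -
  interpret V: module K V by fact
  show ?thesis using assms by simp
qed

lemma smult_one' [simp]:
  assumes "module K V" "x \<in> carrier V"
  shows "\<one> \<odot>\<^bsub>V\<^esub> x = x"
proof -
  interpret V: module K V by fact
  show ?thesis using assms by simp
qed

lemma alg_smult_left [simp]:
  assumes "assoc_algebra K V" "c \<in> carrier K" "x \<in> carrier V" "y \<in> carrier V"
  shows "(c \<odot>\<^bsub>V\<^esub> x) \<otimes>\<^bsub>V\<^esub> y = c \<odot>\<^bsub>V\<^esub> (x \<otimes>\<^bsub>V\<^esub> y)"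
proof -
  interpret V: assoc_algebra K V by fact
  show ?thesis using assms by (simp add: V.smult_mult_left)
qed

lemma alg_smult_right [simp]:
  assumes "assoc_algebra K V" "c \<in> carrier K" "x \<in> carrier V" "y \<in> carrier V"
  shows "x \<otimes>\<^bsub>V\<^esub> (c \<odot>\<^bsub>V\<^esub> y) = c \<odot>\<^bsub>V\<^esub> (x \<otimes>\<^bsub>V\<^esub> y)"
proof -
  interpret V: assoc_algebra K V by fact
  show ?thesis using assms by (simp add: V.smult_mult_right)
qed

declare klin_ident [simp]

text \<open>This rule and the next ones speak of \<open>F x\<close> instead of \<open>x\<close>, so
  that the simplifier can descend through a nested expression and derive its linearity in one
  variable.\<close>

lemma klin_mult_left [simp]:
  assumes "assoc_algebra K V" "klin K U V F" "c \<in> carrier V"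
  shows "klin K U V (\<lambda>x. F x \<otimes>\<^bsub>V\<^esub> c)"
proof -
  interpret V: assoc_algebra K V by fact
  show ?thesis
    by (rule klinI) (use assms(2,3) in \<open>simp_all add: klin_closed klin_add klin_smult V.l_distr V.smult_mult_left\<close>)
qed

lemma klin_mult_right [simp]:
  assumes "assoc_algebra K V" "klin K U V F" "c \<in> carrier V"
  shows "klin K U V (\<lambda>x. c \<otimes>\<^bsub>V\<^esub> F x)"
proof -
  interpret V: assoc_algebra K V by fact
  show ?thesis
    by (rule klinI) (use assms(2,3) in \<open>simp_all add: klin_closed klin_add klin_smult V.r_distr V.smult_mult_right\<close>)
qed

lemma klin_etens_left [simp]:
  assumes "module K V" "module K W" "klin K U V F" "w \<in> carrier W"
  shows "klin K U (V \<boxtimes> W) (\<lambda>x. etens K V W (F x) w)"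
  by (rule klinI)
    (use assms in \<open>simp_all add: klin_closed klin_add klin_smult etens_add_left etens_smult_left\<close>)

lemma klin_etens_right [simp]:
  assumes "module K V" "module K W" "klin K U W F" "v \<in> carrier V"
  shows "klin K U (V \<boxtimes> W) (\<lambda>x. etens K V W v (F x))"
  by (rule klinI)
    (use assms in \<open>simp_all add: klin_closed klin_add klin_smult etens_add_right etens_smult_right\<close>)

lemma klin_smult_right [simp]:
  assumes "module K V" "klin K U V F" "c \<in> carrier K"
  shows "klin K U V (\<lambda>x. c \<odot>\<^bsub>V\<^esub> F x)"
proof -
  interpret V: module K V by fact
  show ?thesis
    by (rule klinI) (use assms(2,3) in \<open>simp_all add: klin_closed klin_add klin_smult V.smult_r_distr
      V.smult_assoc1[symmetric] m_comm\<close>)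
qed

lemma klin_tsum2_arg:
  assumes "module K V" "module K W" "module K X"
    and "\<And>v. v \<in> carrier V \<Longrightarrow> klin K W X (f v)"
    and "\<And>w. w \<in> carrier W \<Longrightarrow> klin K V X (\<lambda>v. f v w)"
    and "klin K U (V \<boxtimes> W) F"
  shows "klin K U X (\<lambda>x. tsum2 X f (F x))"
  by (rule klin_comp[OF klin_tsum2]) (use assms in auto)

lemmas etens_smult = etens_smult_left etens_smult_right

lemma lsum_tens_class:
  assumes "module K V" "module K W"
    and "\<And>a b. (a, b) \<in> set xs \<Longrightarrow> g a b \<in> carrier V \<and> h a b \<in> carrier W"
  shows "lsum (V \<boxtimes> W) (\<lambda>a b. etens K V W (g a b) (h a b)) xs =
    tens_class K V W (map (\<lambda>(a, b). (g a b, h a b)) xs)"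
  using assms(3)
proof (induction xs)
  case Nil then show ?case by (simp add: lsum_def tens_zero_class)
next
  case (Cons x xs)
  obtain a b where x: "x = (a, b)" by fastforce
  have c: "set (map (\<lambda>(a, b). (g a b, h a b)) xs) \<subseteq> carrier V \<times> carrier W"
    using Cons.prems by auto
  have "lsum (V \<boxtimes> W) (\<lambda>a b. etens K V W (g a b) (h a b)) xs =
    tens_class K V W (map (\<lambda>(a, b). (g a b, h a b)) xs)" using Cons by simp
  then show ?case using tens_class_Cons[OF assms(1,2) _ _ c, of "g a b" "h a b"] Cons.prems x
    by (simp add: lsum_def)
qed

text \<open>Brings the multiplication into the reach of the linearity rules. \<open>tsum2\<close>
  runs over the same chosen representatives as the definition, and the concatenated list is the sum
  of its blocks.\<close>

lemma tens_mult_tsum2: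
  assumes V: "assoc_algebra K V" and W: "assoc_algebra K W"
    and s: "s \<in> carrier (V \<boxtimes> W)" and t: "t \<in> carrier (V \<boxtimes> W)"
  shows "s \<otimes>\<^bsub>V \<boxtimes> W\<^esub> t = tsum2 (V \<boxtimes> W) (\<lambda>v w. tsum2 (V \<boxtimes> W)
    (\<lambda>v' w'. etens K V W (v \<otimes>\<^bsub>V\<^esub> v') (w \<otimes>\<^bsub>W\<^esub> w')) t) s"
proof -
  note VM = alg_mod[OF V] and WM = alg_mod[OF W]
  have rs: "set (tens_rep s) \<subseteq> carrier V \<times> carrier W" and rt: "set (tens_rep t) \<subseteq> carrier V \<times> carrier W"
    using tens_rep_closed[OF VM WM] s t by auto
  define m where "m v w = map (\<lambda>(v', w'). (v \<otimes>\<^bsub>V\<^esub> v', w \<otimes>\<^bsub>W\<^esub> w')) (tens_rep t)" for v w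
  have in_t: "v \<in> carrier V \<and> w \<in> carrier W" if "(v, w) \<in> set (tens_rep t)" for v w
    using rt that by auto
  have mc: "set (m v w) \<subseteq> carrier V \<times> carrier W" if "v \<in> carrier V" "w \<in> carrier W" for v w
    using that in_t V W by (auto simp: m_def)
  have inner: "tsum2 (V \<boxtimes> W) (\<lambda>v' w'. etens K V W (v \<otimes>\<^bsub>V\<^esub> v') (w \<otimes>\<^bsub>W\<^esub> w')) t = tens_class K V W (m v w)"
    if "v \<in> carrier V" "w \<in> carrier W" for v w
    unfolding tsum2_def m_def
    by (rule lsum_tens_class[OF VM WM]) (use that in_t V W in auto)
  have mcc: "set (concat (map (\<lambda>(v, w). m v w) xs)) \<subseteq> carrier V \<times> carrier W"
    if "set xs \<subseteq> carrier V \<times> carrier W" for xs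
  proof
    fix x assume "x \<in> set (concat (map (\<lambda>(v, w). m v w) xs))"
    then obtain v w where "(v, w) \<in> set xs" "x \<in> set (m v w)" by auto
    then show "x \<in> carrier V \<times> carrier W" using mc[of v w] that by auto
  qed
  have "lsum (V \<boxtimes> W) (\<lambda>v w. tsum2 (V \<boxtimes> W)
    (\<lambda>v' w'. etens K V W (v \<otimes>\<^bsub>V\<^esub> v') (w \<otimes>\<^bsub>W\<^esub> w')) t) xs = tens_class K V W (concat (map (\<lambda>(v, w). m v w) xs))"
    if "set xs \<subseteq> carrier V \<times> carrier W" for xs
    using that
  proof (induction xs)
    case Nil then show ?case by (simp add: lsum_def tens_zero_class)
  next
    case (Cons x xs)
    then obtain v w where x: "x = (v, w)" "v \<in> carrier V" "w \<in> carrier W" by auto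
    have xs: "set xs \<subseteq> carrier V \<times> carrier W" using Cons by auto
    show ?case
      using Cons.IH[OF xs] tens_add_class[OF VM WM mc[OF x(2,3)] mcc[OF xs]] x inner[OF x(2,3)]
      by (simp add: lsum_def)
  qed
  from this[OF rs] show ?thesis
    unfolding tsum2_def[of _ _ s] by (simp add: tensor_def m_def)
qed

lemma etens_mult [simp]:
  assumes V: "assoc_algebra K V" and W: "assoc_algebra K W"
    and "v \<in> carrier V" "v' \<in> carrier V" "w \<in> carrier W" "w' \<in> carrier W"
  shows "etens K V W v w \<otimes>\<^bsub>V \<boxtimes> W\<^esub> etens K V W v' w' = etens K V W (v \<otimes>\<^bsub>V\<^esub> v') (w \<otimes>\<^bsub>W\<^esub> w')"
  using assms by (simp add: tens_mult_tsum2 tsum2_etens klin_tsum2_param[of V W])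

lemma tens_one_def': "\<one>\<^bsub>V \<boxtimes> W\<^esub> = etens K V W \<one>\<^bsub>V\<^esub> \<one>\<^bsub>W\<^esub>"
  by (simp add: tensor_def etens_def)

lemma klin_tens_mult:
  assumes V: "assoc_algebra K V" and W: "assoc_algebra K W" and t: "t \<in> carrier (V \<boxtimes> W)"
  shows "klin K (V \<boxtimes> W) (V \<boxtimes> W) (\<lambda>s. s \<otimes>\<^bsub>V \<boxtimes> W\<^esub> t)" (is ?g1)
    and "klin K (V \<boxtimes> W) (V \<boxtimes> W) (\<lambda>s. t \<otimes>\<^bsub>V \<boxtimes> W\<^esub> s)" (is ?g2)
proof -
  have M: "module K V" "module K W" "module K (V \<boxtimes> W)" using V W by auto
  show ?g1
    by (rule klin_cong[where F = "tsum2 (V \<boxtimes> W) (\<lambda>v w. tsum2 (V \<boxtimes> W)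
      (\<lambda>v' w'. etens K V W (v \<otimes>\<^bsub>V\<^esub> v') (w \<otimes>\<^bsub>W\<^esub> w')) t)"])
      (auto simp: tens_mult_tsum2 V W M t intro!: klin_tsum2 klin_tsum2_param[OF M t])
  show ?g2
    by (rule klin_cong[where F = "\<lambda>s. tsum2 (V \<boxtimes> W) (\<lambda>v w. tsum2 (V \<boxtimes> W)
      (\<lambda>v' w'. etens K V W (v \<otimes>\<^bsub>V\<^esub> v') (w \<otimes>\<^bsub>W\<^esub> w')) s) t"])
      (auto simp: tens_mult_tsum2 V W M t intro!: klin_tsum2 klin_tsum2_param[OF M t])
qed

lemma assoc_algebra_tensor [simp, intro]:
  assumes V: "assoc_algebra K V" and W: "assoc_algebra K W"
  shows "assoc_algebra K (V \<boxtimes> W)"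
proof -
  interpret V: assoc_algebra K V by fact
  let ?T = "V \<boxtimes> W"
  note klL = klin_tens_mult(1)[OF V W] and klR = klin_tens_mult(2)[OF V W]
  have M: "module K V" "module K W" "module K ?T" using V W by auto
  interpret T: module K ?T by (rule M)
  have cl: "s \<otimes>\<^bsub>?T\<^esub> t \<in> carrier ?T" if "s \<in> carrier ?T" "t \<in> carrier ?T" for s t
    using klin_closed[OF klL] that by blast
  have one: "\<one>\<^bsub>?T\<^esub> \<in> carrier ?T" using V W by (simp add: tens_one_def')
  have l1: "\<one>\<^bsub>?T\<^esub> \<otimes>\<^bsub>?T\<^esub> s = s" if s: "s \<in> carrier ?T" for s
    by (rule tens_eqI[OF s M(1,2) klR[OF one] klin_ident]) (use V W in \<open>simp add: tens_one_def'\<close>)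
  have r1: "s \<otimes>\<^bsub>?T\<^esub> \<one>\<^bsub>?T\<^esub> = s" if s: "s \<in> carrier ?T" for s
    by (rule tens_eqI[OF s M(1,2) klL[OF one] klin_ident]) (use V W in \<open>simp add: tens_one_def'\<close>)
  have a1: "(s \<otimes>\<^bsub>?T\<^esub> t) \<otimes>\<^bsub>?T\<^esub> u = s \<otimes>\<^bsub>?T\<^esub> (t \<otimes>\<^bsub>?T\<^esub> u)"
    if s: "s \<in> carrier ?T" and t: "t \<in> carrier ?T" and u: "u \<in> carrier ?T" for s t u
  proof (rule tens_eqI[OF s M(1,2) klin_comp[OF klL[OF u] klL[OF t]] klL[OF cl[OF t u]]])
    fix v w assume vw: "v \<in> carrier V" "w \<in> carrier W"
    show "(etens K V W v w \<otimes>\<^bsub>?T\<^esub> t) \<otimes>\<^bsub>?T\<^esub> u = etens K V W v w \<otimes>\<^bsub>?T\<^esub> (t \<otimes>\<^bsub>?T\<^esub> u)"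
    proof (rule tens_eqI[OF t M(1,2) klin_comp[OF klL[OF u] klR] klin_comp[OF klR klL[OF u]]])
      fix v' w' assume vw': "v' \<in> carrier V" "w' \<in> carrier W"
      show "(etens K V W v w \<otimes>\<^bsub>?T\<^esub> etens K V W v' w') \<otimes>\<^bsub>?T\<^esub> u
        = etens K V W v w \<otimes>\<^bsub>?T\<^esub> (etens K V W v' w' \<otimes>\<^bsub>?T\<^esub> u)"
        by (rule tens_eqI[OF u M(1,2) klR klin_comp[OF klR klR]]) (use vw vw' V W in \<open>auto simp: alg_assoc\<close>)
    qed (use vw in auto)
  qed
  have R: "ring ?T"
  proof (rule ringI)
    show "abelian_group ?T" by (rule T.abelian_group_axioms)
    show "monoid ?T" by (rule monoidI) (use cl one l1 r1 a1 in auto)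
  qed (use klin_add[OF klL] klin_add[OF klR] in auto)
  show ?thesis
    unfolding assoc_algebra_def assoc_algebra_axioms_def
    using R M klin_smult[OF klL] klin_smult[OF klR] V.field_axioms by auto
qed

section \<open>Sweedler sums over three to five legs\<close>

abbreviation "et3 U V W a b c \<equiv> etens K U (V \<boxtimes> W) a (etens K V W b c)"
abbreviation "et4 T U V W a b c d \<equiv> etens K T (U \<boxtimes> V \<boxtimes> W) a (et3 U V W b c d)"
abbreviation "et5 S T U V W a b c d e \<equiv> etens K S (T \<boxtimes> U \<boxtimes> V \<boxtimes> W) a (et4 T U V W b c d e)"

lemma tsum3_etens:
  assumes [simp]: "module K U" "module K V" "module K W" "module K X"
    and [simp]: "\<And>a b. \<lbrakk> a \<in> carrier U; b \<in> carrier V \<rbrakk> \<Longrightarrow> klin K W X (\<lambda>c. f a b c)"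
      "\<And>a c. \<lbrakk> a \<in> carrier U; c \<in> carrier W \<rbrakk> \<Longrightarrow> klin K V X (\<lambda>b. f a b c)"
      "\<And>b c. \<lbrakk> b \<in> carrier V; c \<in> carrier W \<rbrakk> \<Longrightarrow> klin K U X (\<lambda>a. f a b c)"
  shows "\<lbrakk> a \<in> carrier U; b \<in> carrier V; c \<in> carrier W \<rbrakk> \<Longrightarrow>
      tsum3 X f (et3 U V W a b c) = f a b c" (is "_ \<Longrightarrow> _ \<Longrightarrow> _ \<Longrightarrow> ?A a b c")
    and "klin K (U \<boxtimes> V \<boxtimes> W) X (tsum3 X f)" (is ?g2)
proof -
  have 1: "klin K (V \<boxtimes> W) X (\<lambda>s. tsum2 X (f a) s)" if "a \<in> carrier U" for a
    by (rule klin_tsum2) (use that in auto)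
  have 2: "klin K U X (\<lambda>a. tsum2 X (f a) s)" if "s \<in> carrier (V \<boxtimes> W)" for s
    by (rule klin_tsum2_param[OF _ _ _ that]) auto
  show "?A a b c" if "a \<in> carrier U" "b \<in> carrier V" "c \<in> carrier W" for a b c
    using that unfolding tsum3_def by (simp add: tsum2_etens 1 2)
  show ?g2
    unfolding tsum3_def by (rule klin_tsum2) (simp_all add: 1 2)
qed

lemma klin_tsum3_param:
  assumes [simp]: "module K U" "module K V" "module K W" "module K X"
    and t: "t \<in> carrier (U \<boxtimes> V \<boxtimes> W)"
    and f: "\<And>a b c. \<lbrakk> a \<in> carrier U; b \<in> carrier V; c \<in> carrier W \<rbrakk> \<Longrightarrow> klin K Y X (\<lambda>x. f x a b c)"
  shows "klin K Y X (\<lambda>x. tsum3 X (f x) t)"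
  unfolding tsum3_def
  by (rule klin_tsum2_param[OF _ _ _ t]) (auto intro!: klin_tsum2_param f)

lemma tsum4_etens:
  assumes [simp]: "module K T" "module K U" "module K V" "module K W" "module K X"
    and [simp]: "\<And>a b c. \<lbrakk> a \<in> carrier T; b \<in> carrier U; c \<in> carrier V \<rbrakk> \<Longrightarrow> klin K W X (\<lambda>d. f a b c d)"
      "\<And>a b d. \<lbrakk> a \<in> carrier T; b \<in> carrier U; d \<in> carrier W \<rbrakk> \<Longrightarrow> klin K V X (\<lambda>c. f a b c d)"
      "\<And>a c d. \<lbrakk> a \<in> carrier T; c \<in> carrier V; d \<in> carrier W \<rbrakk> \<Longrightarrow> klin K U X (\<lambda>b. f a b c d)"
      "\<And>b c d. \<lbrakk> b \<in> carrier U; c \<in> carrier V; d \<in> carrier W \<rbrakk> \<Longrightarrow> klin K T X (\<lambda>a. f a b c d)"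
  shows "\<lbrakk> a \<in> carrier T; b \<in> carrier U; c \<in> carrier V; d \<in> carrier W \<rbrakk> \<Longrightarrow>
      tsum4 X f (et4 T U V W a b c d) = f a b c d"
      (is "_ \<Longrightarrow> _ \<Longrightarrow> _ \<Longrightarrow> _ \<Longrightarrow> ?A a b c d")
    and "klin K (T \<boxtimes> U \<boxtimes> V \<boxtimes> W) X (tsum4 X f)" (is ?g3)
proof -
  have 1: "klin K (U \<boxtimes> V \<boxtimes> W) X (\<lambda>s. tsum3 X (f a) s)" if "a \<in> carrier T" for a
    by (rule tsum3_etens(2)) (use that in auto)
  have 2: "klin K T X (\<lambda>a. tsum3 X (f a) s)" if "s \<in> carrier (U \<boxtimes> V \<boxtimes> W)" for s
    by (rule klin_tsum3_param[OF _ _ _ _ that]) auto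
  show "?A a b c d" if "a \<in> carrier T" "b \<in> carrier U" "c \<in> carrier V" "d \<in> carrier W" for a b c d
    using that unfolding tsum4_def by (simp add: tsum2_etens tsum3_etens 1 2)
  show ?g3
    unfolding tsum4_def by (rule klin_tsum2) (simp_all add: 1 2)
qed

lemma klin_tsum4_param:
  assumes [simp]: "module K T" "module K U" "module K V" "module K W" "module K X"
    and t: "t \<in> carrier (T \<boxtimes> U \<boxtimes> V \<boxtimes> W)"
    and f: "\<And>a b c d. \<lbrakk> a \<in> carrier T; b \<in> carrier U; c \<in> carrier V; d \<in> carrier W \<rbrakk> \<Longrightarrow>
      klin K Y X (\<lambda>x. f x a b c d)"
  shows "klin K Y X (\<lambda>x. tsum4 X (f x) t)"
  unfolding tsum4_def
  by (rule klin_tsum2_param[OF _ _ _ t]) (auto intro!: klin_tsum3_param f)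

lemma tsum5_etens:
  assumes [simp]: "module K S" "module K T" "module K U" "module K V" "module K W" "module K X"
    and [simp]: "\<And>a b c d. \<lbrakk> a \<in> carrier S; b \<in> carrier T; c \<in> carrier U; d \<in> carrier V \<rbrakk> \<Longrightarrow>
        klin K W X (\<lambda>e. f a b c d e)"
      "\<And>a b c e. \<lbrakk> a \<in> carrier S; b \<in> carrier T; c \<in> carrier U; e \<in> carrier W \<rbrakk> \<Longrightarrow>
        klin K V X (\<lambda>d. f a b c d e)"
      "\<And>a b d e. \<lbrakk> a \<in> carrier S; b \<in> carrier T; d \<in> carrier V; e \<in> carrier W \<rbrakk> \<Longrightarrow>
        klin K U X (\<lambda>c. f a b c d e)"
      "\<And>a c d e. \<lbrakk> a \<in> carrier S; c \<in> carrier U; d \<in> carrier V; e \<in> carrier W \<rbrakk> \<Longrightarrow>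
        klin K T X (\<lambda>b. f a b c d e)"
      "\<And>b c d e. \<lbrakk> b \<in> carrier T; c \<in> carrier U; d \<in> carrier V; e \<in> carrier W \<rbrakk> \<Longrightarrow>
        klin K S X (\<lambda>a. f a b c d e)"
  shows "\<lbrakk> a \<in> carrier S; b \<in> carrier T; c \<in> carrier U; d \<in> carrier V; e \<in> carrier W \<rbrakk> \<Longrightarrow>
      tsum5 X f (et5 S T U V W a b c d e) = f a b c d e"
      (is "_ \<Longrightarrow> _ \<Longrightarrow> _ \<Longrightarrow> _ \<Longrightarrow> _ \<Longrightarrow> ?A a b c d e")
    and "klin K (S \<boxtimes> T \<boxtimes> U \<boxtimes> V \<boxtimes> W) X (tsum5 X f)" (is ?g3)
proof -
  have 1: "klin K (T \<boxtimes> U \<boxtimes> V \<boxtimes> W) X (\<lambda>s. tsum4 X (f a) s)" if "a \<in> carrier S" for a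
    by (rule tsum4_etens(2)) (use that in auto)
  have 2: "klin K S X (\<lambda>a. tsum4 X (f a) s)" if "s \<in> carrier (T \<boxtimes> U \<boxtimes> V \<boxtimes> W)" for s
    by (rule klin_tsum4_param[OF _ _ _ _ _ that]) auto
  show "?A a b c d e" if "a \<in> carrier S" "b \<in> carrier T" "c \<in> carrier U" "d \<in> carrier V" "e \<in> carrier W"
    for a b c d e
    using that unfolding tsum5_def by (simp add: tsum2_etens tsum4_etens 1 2)
  show ?g3
    unfolding tsum5_def by (rule klin_tsum2) (simp_all add: 1 2)
qed

lemma klin_tsum5_param:
  assumes [simp]: "module K S" "module K T" "module K U" "module K V" "module K W" "module K X"
    and t: "t \<in> carrier (S \<boxtimes> T \<boxtimes> U \<boxtimes> V \<boxtimes> W)"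
    and f: "\<And>a b c d e. \<lbrakk> a \<in> carrier S; b \<in> carrier T; c \<in> carrier U; d \<in> carrier V; e \<in> carrier W \<rbrakk> \<Longrightarrow>
      klin K Y X (\<lambda>x. f x a b c d e)"
  shows "klin K Y X (\<lambda>x. tsum5 X (f x) t)"
  unfolding tsum5_def
  by (rule klin_tsum2_param[OF _ _ _ t]) (auto intro!: klin_tsum4_param f)

lemma tens3_eqI:
  assumes t: "t \<in> carrier (U \<boxtimes> V \<boxtimes> W)" and [simp]: "module K U" "module K V" "module K W"
    and F: "klin K (U \<boxtimes> V \<boxtimes> W) X F" and G: "klin K (U \<boxtimes> V \<boxtimes> W) X G"
    and eq: "\<And>a b c. \<lbrakk> a \<in> carrier U; b \<in> carrier V; c \<in> carrier W \<rbrakk> \<Longrightarrow> F (et3 U V W a b c) = G (et3 U V W a b c)"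
  shows "F t = G t"
proof (rule tens_eqI[OF t _ _ F G])
  fix a s assume a: "a \<in> carrier U" and s: "s \<in> carrier (V \<boxtimes> W)"
  show "F (etens K U (V \<boxtimes> W) a s) = G (etens K U (V \<boxtimes> W) a s)"
    by (rule tens_eqI[OF s _ _ klin_comp[OF F] klin_comp[OF G]]) (use a eq in auto)
qed auto

lemma tens4_eqI:
  assumes t: "t \<in> carrier (T \<boxtimes> U \<boxtimes> V \<boxtimes> W)" and [simp]: "module K T" "module K U" "module K V" "module K W"
    and F: "klin K (T \<boxtimes> U \<boxtimes> V \<boxtimes> W) X F" and G: "klin K (T \<boxtimes> U \<boxtimes> V \<boxtimes> W) X G"
    and eq: "\<And>a b c d. \<lbrakk> a \<in> carrier T; b \<in> carrier U; c \<in> carrier V; d \<in> carrier W \<rbrakk> \<Longrightarrow>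
      F (et4 T U V W a b c d) = G (et4 T U V W a b c d)"
  shows "F t = G t"
proof (rule tens_eqI[OF t _ _ F G])
  fix a s assume a: "a \<in> carrier T" and s: "s \<in> carrier (U \<boxtimes> V \<boxtimes> W)"
  show "F (etens K T (U \<boxtimes> V \<boxtimes> W) a s) = G (etens K T (U \<boxtimes> V \<boxtimes> W) a s)"
    by (rule tens3_eqI[OF s _ _ _ klin_comp[OF F] klin_comp[OF G]]) (use a eq in auto)
qed auto

lemma tens5_eqI:
  assumes t: "t \<in> carrier (S \<boxtimes> T \<boxtimes> U \<boxtimes> V \<boxtimes> W)"
    and [simp]: "module K S" "module K T" "module K U" "module K V" "module K W"
    and F: "klin K (S \<boxtimes> T \<boxtimes> U \<boxtimes> V \<boxtimes> W) X F" and G: "klin K (S \<boxtimes> T \<boxtimes> U \<boxtimes> V \<boxtimes> W) X G"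
    and eq: "\<And>a b c d e. \<lbrakk> a \<in> carrier S; b \<in> carrier T; c \<in> carrier U; d \<in> carrier V; e \<in> carrier W \<rbrakk> \<Longrightarrow>
      F (et5 S T U V W a b c d e) = G (et5 S T U V W a b c d e)"
  shows "F t = G t"
proof (rule tens_eqI[OF t _ _ F G])
  fix a s assume a: "a \<in> carrier S" and s: "s \<in> carrier (T \<boxtimes> U \<boxtimes> V \<boxtimes> W)"
  show "F (etens K S (T \<boxtimes> U \<boxtimes> V \<boxtimes> W) a s) = G (etens K S (T \<boxtimes> U \<boxtimes> V \<boxtimes> W) a s)"
    by (rule tens4_eqI[OF s _ _ _ _ klin_comp[OF F] klin_comp[OF G]]) (use a eq in auto)
qed auto

end

section \<open>Algebra homomorphisms between iterated tensor products\<close>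

lemma alg_homI:
  assumes "klin K V W F" "F \<one>\<^bsub>V\<^esub> = \<one>\<^bsub>W\<^esub>"
    and "\<And>x y. \<lbrakk> x \<in> carrier V; y \<in> carrier V \<rbrakk> \<Longrightarrow> F (x \<otimes>\<^bsub>V\<^esub> y) = F x \<otimes>\<^bsub>W\<^esub> F y"
  shows "F \<in> alg_hom K V W"
  using assms by (auto simp: alg_hom_def klin_def intro!: ring_hom_memI)

lemma alg_hom_klin: "F \<in> alg_hom K V W \<Longrightarrow> klin K V W F"
  by (auto simp: alg_hom_def ring_hom_def klin_def)

lemma alg_hom_mult:
  "\<lbrakk> F \<in> alg_hom K V W; x \<in> carrier V; y \<in> carrier V \<rbrakk> \<Longrightarrow> F (x \<otimes>\<^bsub>V\<^esub> y) = F x \<otimes>\<^bsub>W\<^esub> F y"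
  and alg_hom_one: "F \<in> alg_hom K V W \<Longrightarrow> F \<one>\<^bsub>V\<^esub> = \<one>\<^bsub>W\<^esub>"
  and alg_hom_closed: "\<lbrakk> F \<in> alg_hom K V W; x \<in> carrier V \<rbrakk> \<Longrightarrow> F x \<in> carrier W"
  by (auto simp: alg_hom_def ring_hom_def)

lemma alg_hom_comp:
  "\<lbrakk> G \<in> alg_hom K V W; F \<in> alg_hom K U V \<rbrakk> \<Longrightarrow> (\<lambda>x. G (F x)) \<in> alg_hom K U W"
  by (rule alg_homI) (simp_all add: klin_comp[OF alg_hom_klin alg_hom_klin] alg_hom_mult alg_hom_one alg_hom_closed)

text \<open>The inner sum of \<open>ltens\<close>. With a name of its own, a value
  \<open>f a\<close> such as a coproduct can stay unsplit while computations go on in the other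
  legs.\<close>

definition lassoc ::
  "('k, 'm) ring_scheme \<Rightarrow> ('k, 'u, 'x) module_scheme \<Rightarrow> ('k, 'v, 'y) module_scheme \<Rightarrow>
   ('k, 'w, 'z) module_scheme \<Rightarrow> ('u, 'v) tens \<Rightarrow> 'w \<Rightarrow> ('u, ('v, 'w) tens) tens"
  where "lassoc K U V W d w =
    tsum2 (U \<boxtimes>\<^bsub>K\<^esub> V \<boxtimes>\<^bsub>K\<^esub> W) (\<lambda>u v. etens K U (V \<boxtimes>\<^bsub>K\<^esub> W) u (etens K V W v w)) d"

context tensor_calculus
begin

lemma alg_monoid: "assoc_algebra K V \<Longrightarrow> monoid V"
  by (drule alg_ring) (simp add: ring_def)

lemma alg_hom_Units:
  assumes V: "assoc_algebra K V" and W: "assoc_algebra K W" and F: "F \<in> alg_hom K V W" and x: "x \<in> Units V"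
  shows "F x \<in> Units W" and "F (inv\<^bsub>V\<^esub> x) = inv\<^bsub>W\<^esub> (F x)" (is ?g2)
proof -
  interpret V: monoid V using alg_monoid V .
  interpret W: monoid W using alg_monoid W .
  have 1: "F x \<otimes>\<^bsub>W\<^esub> F (inv\<^bsub>V\<^esub> x) = \<one>\<^bsub>W\<^esub>" "F (inv\<^bsub>V\<^esub> x) \<otimes>\<^bsub>W\<^esub> F x = \<one>\<^bsub>W\<^esub>"
    unfolding alg_hom_mult[OF F V.Units_closed[OF x] V.Units_inv_closed[OF x], symmetric]
      alg_hom_mult[OF F V.Units_inv_closed[OF x] V.Units_closed[OF x], symmetric]
    using x by (simp_all add: alg_hom_one[OF F])
  have c: "F x \<in> carrier W" "F (inv\<^bsub>V\<^esub> x) \<in> carrier W" using x alg_hom_closed[OF F] by auto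
  show "F x \<in> Units W" using 1 c by (auto simp: Units_def)
  show ?g2 using 1 c W.inv_char by auto
qed

lemma alg_Units:
  assumes "assoc_algebra K V" "x \<in> Units V"
  shows "x \<in> carrier V" "inv\<^bsub>V\<^esub> x \<in> carrier V" (is ?g2) "x \<otimes>\<^bsub>V\<^esub> inv\<^bsub>V\<^esub> x = \<one>\<^bsub>V\<^esub>" (is ?g3) "inv\<^bsub>V\<^esub> x \<otimes>\<^bsub>V\<^esub> x = \<one>\<^bsub>V\<^esub>" (is ?g4)
    "inv\<^bsub>V\<^esub> x \<in> Units V" (is ?g5)
proof -
  interpret V: monoid V using alg_monoid assms(1) .
  show "x \<in> carrier V" ?g2 ?g3 ?g4 ?g5
    using assms(2) by auto
qed

lemma alg_cancel:
  assumes "assoc_algebra K V" "x \<in> Units V" "y \<in> carrier V"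
  shows "x \<otimes>\<^bsub>V\<^esub> (inv\<^bsub>V\<^esub> x \<otimes>\<^bsub>V\<^esub> y) = y" "inv\<^bsub>V\<^esub> x \<otimes>\<^bsub>V\<^esub> (x \<otimes>\<^bsub>V\<^esub> y) = y"
  using assms by (simp_all add: alg_assoc[symmetric] alg_Units)

lemma alg_hom_tensI:
  assumes V: "assoc_algebra K V" and W: "assoc_algebra K W" and X: "assoc_algebra K X"
    and F: "klin K (V \<boxtimes> W) X F" and one: "F (etens K V W \<one>\<^bsub>V\<^esub> \<one>\<^bsub>W\<^esub>) = \<one>\<^bsub>X\<^esub>"
    and pure: "\<And>v w v' w'. \<lbrakk> v \<in> carrier V; w \<in> carrier W; v' \<in> carrier V; w' \<in> carrier W \<rbrakk> \<Longrightarrow>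
      F (etens K V W (v \<otimes>\<^bsub>V\<^esub> v') (w \<otimes>\<^bsub>W\<^esub> w')) = F (etens K V W v w) \<otimes>\<^bsub>X\<^esub> F (etens K V W v' w')"
  shows "F \<in> alg_hom K (V \<boxtimes> W) X"
proof (rule alg_homI[OF F])
  let ?T = "V \<boxtimes> W"
  note [simp] = V W X klin_closed[OF F]
  fix s t assume s: "s \<in> carrier ?T" and t: "t \<in> carrier ?T"
  show "F (s \<otimes>\<^bsub>?T\<^esub> t) = F s \<otimes>\<^bsub>X\<^esub> F t"
    by (rule tens_eqI[OF s, where X = X]; (rule tens_eqI[OF t, where X = X])?; simp add: t pure klin_comp[OF F] F)
qed (simp add: tens_one_def' one)

lemma rtens_etens:
  assumes "module K U" "module K V" "module K W" "klin K W V f"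
  shows "\<lbrakk> u \<in> carrier U; w \<in> carrier W \<rbrakk> \<Longrightarrow> rtens K U V f (etens K U W u w) = etens K U V u (f w)"
    and "klin K (U \<boxtimes> W) (U \<boxtimes> V) (rtens K U V f)"
  unfolding rtens_def using assms
  by (simp_all add: tsum2_etens klin_tsum2 klin_closed)

lemma rtens_alg_hom:
  assumes "assoc_algebra K U" "assoc_algebra K V" "assoc_algebra K W" and f: "f \<in> alg_hom K W V"
  shows "rtens K U V f \<in> alg_hom K (U \<boxtimes> W) (U \<boxtimes> V)"
proof -
  note [simp] = assms(1-3) alg_hom_klin[OF f] alg_hom_mult[OF f] alg_hom_one[OF f] alg_hom_closed[OF f]
    rtens_etens[where W = W and f = f]
  show ?thesis by (rule alg_hom_tensI) (simp_all add: tens_one_def')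
qed

lemma lassoc_etens [simp]:
  assumes "module K U" "module K V" "module K W" "u \<in> carrier U" "v \<in> carrier V" "w \<in> carrier W"
  shows "lassoc K U V W (etens K U V u v) w = etens K U (V \<boxtimes> W) u (etens K V W v w)"
  using assms by (simp add: lassoc_def tsum2_etens)

lemma klin_lassoc1 [simp]:
  assumes "module K U" "module K V" "module K W" "w \<in> carrier W" "klin K X (U \<boxtimes> V) F"
  shows "klin K X (U \<boxtimes> V \<boxtimes> W) (\<lambda>x. lassoc K U V W (F x) w)"
  unfolding lassoc_def by (rule klin_tsum2_arg[of U V]) (use assms in simp_all)

lemma klin_lassoc2 [simp]:
  assumes "module K U" "module K V" "module K W" "d \<in> carrier (U \<boxtimes> V)" "klin K X W F"
  shows "klin K X (U \<boxtimes> V \<boxtimes> W) (\<lambda>x. lassoc K U V W d (F x))"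
  unfolding lassoc_def by (rule klin_tsum2_param[of U V]) (use assms in simp_all)

lemma lassoc_closed [simp, intro]:
  assumes "module K U" "module K V" "module K W" "d \<in> carrier (U \<boxtimes> V)" "w \<in> carrier W"
  shows "lassoc K U V W d w \<in> carrier (U \<boxtimes> V \<boxtimes> W)"
  using klin_closed[OF klin_lassoc1[OF assms(1-3,5) klin_ident] assms(4)] .

lemma lassoc_smult:
  assumes "module K U" "module K V" "module K W" "d \<in> carrier (U \<boxtimes> V)" "w \<in> carrier W" "c \<in> carrier K"
  shows "lassoc K U V W (c \<odot>\<^bsub>U \<boxtimes> V\<^esub> d) w = c \<odot>\<^bsub>U \<boxtimes> V \<boxtimes> W\<^esub> lassoc K U V W d w"
  using klin_smult[OF klin_lassoc1[OF assms(1-3,5) klin_ident] assms(6,4)] .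

lemma lassoc_mult:
  assumes [simp]: "assoc_algebra K U" "assoc_algebra K V" "assoc_algebra K W"
    and d: "d \<in> carrier (U \<boxtimes> V)" "d' \<in> carrier (U \<boxtimes> V)" and w: "w \<in> carrier W" "w' \<in> carrier W"
  shows "lassoc K U V W d w \<otimes>\<^bsub>U \<boxtimes> V \<boxtimes> W\<^esub> lassoc K U V W d' w' =
    lassoc K U V W (d \<otimes>\<^bsub>U \<boxtimes> V\<^esub> d') (w \<otimes>\<^bsub>W\<^esub> w')"
  by (rule tens_eqI[OF d(1), where X = "U \<boxtimes> V \<boxtimes> W"];
      (rule tens_eqI[OF d(2), where X = "U \<boxtimes> V \<boxtimes> W"])?; simp add: d w)

lemma ltens_etens:
  assumes "module K A" "module K U" "module K V" "module K W" "klin K A (U \<boxtimes> V) f"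
  shows "\<lbrakk> a \<in> carrier A; w \<in> carrier W \<rbrakk> \<Longrightarrow> ltens K U V W f (etens K A W a w) = lassoc K U V W (f a) w"
    and "klin K (A \<boxtimes> W) (U \<boxtimes> V \<boxtimes> W) (ltens K U V W f)"
  unfolding ltens_def lassoc_def[symmetric] using assms
  by (simp_all add: tsum2_etens klin_tsum2 klin_closed)

lemma ltens_alg_hom:
  assumes "assoc_algebra K A" "assoc_algebra K U" "assoc_algebra K V" "assoc_algebra K W"
    and f: "f \<in> alg_hom K A (U \<boxtimes> V)"
  shows "ltens K U V W f \<in> alg_hom K (A \<boxtimes> W) (U \<boxtimes> V \<boxtimes> W)"
proof -
  note [simp] = assms(1-4) alg_hom_klin[OF f] alg_hom_mult[OF f] alg_hom_one[OF f] alg_hom_closed[OF f]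
    ltens_etens[where A = A and f = f]
  show ?thesis by (rule alg_hom_tensI) (simp_all add: tens_one_def' lassoc_mult)
qed

lemma tens_one_etens:
  assumes "module K U" "module K V" "module K W" "assoc_algebra K X"
  shows "\<lbrakk> u \<in> carrier U; v \<in> carrier V; w \<in> carrier W \<rbrakk> \<Longrightarrow>
      tens_one K U V W X (etens K U (V \<boxtimes> W) u (etens K V W v w)) =
      etens K U (V \<boxtimes> W \<boxtimes> X) u (etens K V (W \<boxtimes> X) v (etens K W X w \<one>\<^bsub>X\<^esub>))"
    and "klin K (U \<boxtimes> V \<boxtimes> W) (U \<boxtimes> V \<boxtimes> W \<boxtimes> X) (tens_one K U V W X)"
  unfolding tens_one_def using assms
  by (simp_all add: tsum3_etens)

lemma tens_one_alg_hom:
  assumes [simp]: "assoc_algebra K U" "assoc_algebra K V" "assoc_algebra K W" "assoc_algebra K X"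
  shows "tens_one K U V W X \<in> alg_hom K (U \<boxtimes> V \<boxtimes> W) (U \<boxtimes> V \<boxtimes> W \<boxtimes> X)"
proof (rule alg_homI)
  note [simp] = tens_one_etens klin_comp[OF tens_one_etens(2)] klin_closed[OF tens_one_etens(2)]
  show "tens_one K U V W X (s \<otimes>\<^bsub>U \<boxtimes> V \<boxtimes> W\<^esub> t) = tens_one K U V W X s \<otimes>\<^bsub>U \<boxtimes> V \<boxtimes> W \<boxtimes> X\<^esub> tens_one K U V W X t"
    if s: "s \<in> carrier (U \<boxtimes> V \<boxtimes> W)" and t: "t \<in> carrier (U \<boxtimes> V \<boxtimes> W)" for s t
    by (rule tens3_eqI[OF s, where X = "U \<boxtimes> V \<boxtimes> W \<boxtimes> X"];
        (rule tens3_eqI[OF t, where X = "U \<boxtimes> V \<boxtimes> W \<boxtimes> X"])?; simp add: t)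
qed (simp_all add: tens_one_etens tens_one_def')

lemma etens_one_alg_hom:
  assumes [simp]: "assoc_algebra K U" "assoc_algebra K V"
  shows "etens K U V \<one>\<^bsub>U\<^esub> \<in> alg_hom K V (U \<boxtimes> V)"
  by (rule alg_homI) (simp_all add: tens_one_def')

end

section \<open>Contractions with the counit\<close>

sublocale assoc_algebra \<subseteq> tensor_calculus K
  by unfold_locales

definition lcontr :: "('h \<Rightarrow> 'k) \<Rightarrow> ('k, 'x, 'z) module_scheme \<Rightarrow> ('h, 'x) tens \<Rightarrow> 'x"
  where "lcontr e X = tsum2 X (\<lambda>h x. e h \<odot>\<^bsub>X\<^esub> x)"

definition rcontr :: "('h \<Rightarrow> 'k) \<Rightarrow> ('k, 'x, 'z) module_scheme \<Rightarrow> ('x, 'h) tens \<Rightarrow> 'x"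
  where "rcontr e X = tsum2 X (\<lambda>x h. e h \<odot>\<^bsub>X\<^esub> x)"

context quasi_bialgebra
begin

abbreviation "H2 \<equiv> H \<boxtimes> H"
abbreviation "H3 \<equiv> H \<boxtimes> H2"
abbreviation "H4 \<equiv> H \<boxtimes> H3"

abbreviation mul1 (infixl \<open>\<cdot>\<close> 70) where "x \<cdot> y \<equiv> x \<otimes>\<^bsub>H\<^esub> y"
abbreviation mul2 (infixl \<open>\<cdot>\<^sub>2\<close> 70) where "x \<cdot>\<^sub>2 y \<equiv> x \<otimes>\<^bsub>H2\<^esub> y"
abbreviation mul3 (infixl \<open>\<cdot>\<^sub>3\<close> 70) where "x \<cdot>\<^sub>3 y \<equiv> x \<otimes>\<^bsub>H3\<^esub> y"
abbreviation mul4 (infixl \<open>\<cdot>\<^sub>4\<close> 70) where "x \<cdot>\<^sub>4 y \<equiv> x \<otimes>\<^bsub>H4\<^esub> y"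

abbreviation "e2 \<equiv> etens K H H"
abbreviation "e3 a b c \<equiv> etens K H H2 a (e2 b c)"
abbreviation "e4 a b c d \<equiv> etens K H H3 a (e3 b c d)"

abbreviation unitH (\<open>\<one>\<^sub>H\<close>) where "\<one>\<^sub>H \<equiv> \<one>\<^bsub>H\<^esub>"
abbreviation "\<Delta> \<equiv> comult H"
abbreviation "\<epsilon> \<equiv> counit H"
abbreviation "\<Phi> \<equiv> reassoc H"
abbreviation "\<Phi>i \<equiv> inv\<^bsub>H3\<^esub> (reassoc H)"

lemma assoc_algebra_H [simp]: "assoc_algebra K H"
  by (rule assoc_algebra_axioms)

lemma module_H [simp]: "module K H"
  by simp

lemma comult_simps [simp]:
  "h \<in> carrier H \<Longrightarrow> \<Delta> h \<in> carrier H2"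
  "\<Delta> \<one>\<^sub>H = e2 \<one>\<^sub>H \<one>\<^sub>H"
  "klin K H H2 \<Delta>"
  using alg_hom_closed[OF comult_hom] alg_hom_one[OF comult_hom] alg_hom_klin[OF comult_hom]
  by (simp_all add: tens_one_def')

lemma comult_mult: "\<lbrakk> g \<in> carrier H; h \<in> carrier H \<rbrakk> \<Longrightarrow> \<Delta> (g \<cdot> h) = \<Delta> g \<cdot>\<^sub>2 \<Delta> h"
  using alg_hom_mult[OF comult_hom] .

lemma klin_comult [simp]: "klin K U H F \<Longrightarrow> klin K U H2 (\<lambda>x. \<Delta> (F x))"
  by (rule klin_comp) simp_all

lemma counit_simps [simp]:
  "h \<in> carrier H \<Longrightarrow> \<epsilon> h \<in> carrier K"
  "\<epsilon> \<one>\<^sub>H = \<one>"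
  "\<lbrakk> g \<in> carrier H; h \<in> carrier H \<rbrakk> \<Longrightarrow> \<epsilon> (g \<cdot> h) = \<epsilon> g \<otimes> \<epsilon> h"
  using counit_hom by (auto simp: ring_hom_def)

lemma klin_counit [simp]:
  assumes X: "module K X" and F: "klin K U H F" and x: "x \<in> carrier X"
  shows "klin K U X (\<lambda>u. \<epsilon> (F u) \<odot>\<^bsub>X\<^esub> x)"
proof -
  interpret X: module K X by fact
  show ?thesis
    by (rule klinI) (use F x counit_hom in \<open>simp_all add: klin_closed klin_add klin_smult counit_smult
      ring_hom_add X.smult_l_distr X.smult_assoc1\<close>)
qed

lemma smult_mult_swap:
  assumes "module K X" "c \<in> carrier K" "d \<in> carrier K" "x \<in> carrier X"
  shows "c \<odot>\<^bsub>X\<^esub> (d \<odot>\<^bsub>X\<^esub> x) = (c \<otimes> d) \<odot>\<^bsub>X\<^esub> x"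
proof -
  interpret X: module K X by fact
  show ?thesis using assms by (simp add: X.smult_assoc1)
qed

lemma lcontr_simps [simp]:
  assumes "module K X"
  shows "\<lbrakk> h \<in> carrier H; x \<in> carrier X \<rbrakk> \<Longrightarrow> lcontr \<epsilon> X (etens K H X h x) = \<epsilon> h \<odot>\<^bsub>X\<^esub> x"
    and "klin K U (H \<boxtimes> X) F \<Longrightarrow> klin K U X (\<lambda>u. lcontr \<epsilon> X (F u))" (is "PROP ?g2")
    and "t \<in> carrier (H \<boxtimes> X) \<Longrightarrow> lcontr \<epsilon> X t \<in> carrier X" (is "PROP ?g3")
proof -
  have k: "klin K (H \<boxtimes> X) X (lcontr \<epsilon> X)"
    unfolding lcontr_def by (rule klin_tsum2) (use assms in simp_all)
  show "PROP ?g2" by (rule klin_comp[OF k])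
  show "PROP ?g3" by (rule klin_closed[OF k])
qed (simp add: lcontr_def tsum2_etens assms)

lemma rcontr_simps [simp]:
  assumes "module K X"
  shows "\<lbrakk> h \<in> carrier H; x \<in> carrier X \<rbrakk> \<Longrightarrow> rcontr \<epsilon> X (etens K X H x h) = \<epsilon> h \<odot>\<^bsub>X\<^esub> x"
    and "klin K U (X \<boxtimes> H) F \<Longrightarrow> klin K U X (\<lambda>u. rcontr \<epsilon> X (F u))" (is "PROP ?g2")
    and "t \<in> carrier (X \<boxtimes> H) \<Longrightarrow> rcontr \<epsilon> X t \<in> carrier X" (is "PROP ?g3")
proof -
  have k: "klin K (X \<boxtimes> H) X (rcontr \<epsilon> X)"
    unfolding rcontr_def by (rule klin_tsum2) (use assms in simp_all)
  show "PROP ?g2" by (rule klin_comp[OF k])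
  show "PROP ?g3" by (rule klin_closed[OF k])
qed (simp add: rcontr_def tsum2_etens assms)

lemma klin_rcontr [simp]: "module K X \<Longrightarrow> klin K (X \<boxtimes> H) X (rcontr \<epsilon> X)"
  using rcontr_simps(2)[OF _ klin_ident] .

lemma lcontr_alg_hom: "assoc_algebra K X \<Longrightarrow> lcontr \<epsilon> X \<in> alg_hom K (H \<boxtimes> X) X"
  by (rule alg_hom_tensI) (simp_all add: smult_mult_swap m_comm)

lemma rcontr_alg_hom: "assoc_algebra K X \<Longrightarrow> rcontr \<epsilon> X \<in> alg_hom K (X \<boxtimes> H) X"
  by (rule alg_hom_tensI) (simp_all add: smult_mult_swap m_comm)

lemma comult_contr [simp]:
  assumes "h \<in> carrier H"
  shows "lcontr \<epsilon> H (\<Delta> h) = h" "rcontr \<epsilon> H (\<Delta> h) = h"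
  using counit_left counit_right assms by (simp_all add: lcontr_def rcontr_def)

lemma lcontr_lassoc [simp]:
  assumes [simp]: "module K V" "module K W" "d \<in> carrier (H \<boxtimes> V)" "w \<in> carrier W"
  shows "lcontr \<epsilon> (V \<boxtimes> W) (lassoc K H V W d w) = etens K V W (lcontr \<epsilon> V d) w"
  by (rule tens_eqI[OF assms(3), where X = "V \<boxtimes> W"]) (simp_all add: etens_smult)

lemma rtens_lcontr_lassoc [simp]:
  assumes [simp]: "module K V" "module K W" "d \<in> carrier (V \<boxtimes> H)" "w \<in> carrier W"
  shows "rtens K V W (lcontr \<epsilon> W) (lassoc K V H W d w) = etens K V W (rcontr \<epsilon> V d) w"
proof -
  note [simp] = rtens_etens[where W = "H \<boxtimes> W" and f = "lcontr \<epsilon> W"]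
  show ?thesis
    by (rule tens_eqI[OF assms(3), where X = "V \<boxtimes> W"])
      (simp_all add: etens_smult klin_comp[OF rtens_etens(2)[where W = "H \<boxtimes> W"]])
qed

text \<open>Contract the second leg of the mixed pentagon; for \<open>lam = rho = \<Delta>\<close> this is
  the normalization \<open>(\<epsilon> \<otimes> id \<otimes> id)(\<Phi>) = 1 \<otimes> 1\<close>.\<close>

lemma counit_left_from_pentagon:
  assumes B [simp]: "assoc_algebra K B"
    and lam: "lam \<in> alg_hom K B (H \<boxtimes> B)" and rho: "rho \<in> alg_hom K B (B \<boxtimes> H)"
    and lam_eps: "\<And>u. u \<in> carrier B \<Longrightarrow> lcontr \<epsilon> B (lam u) = u"
    and P: "P \<in> carrier (H \<boxtimes> H \<boxtimes> B)" "rtens K H B (lcontr \<epsilon> B) P = \<one>\<^bsub>H \<boxtimes> B\<^esub>"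
    and U: "U \<in> Units (H \<boxtimes> B \<boxtimes> H)"
    and pent: "etens K H (H \<boxtimes> B \<boxtimes> H) \<one>\<^sub>H U
        \<otimes>\<^bsub>H \<boxtimes> H \<boxtimes> B \<boxtimes> H\<^esub> rtens K H (H \<boxtimes> B \<boxtimes> H) (ltens K H B H lam) U
        \<otimes>\<^bsub>H \<boxtimes> H \<boxtimes> B \<boxtimes> H\<^esub> tens_one K H H B H P
       = rtens K H (H \<boxtimes> B \<boxtimes> H) (rtens K H (B \<boxtimes> H) rho) P
        \<otimes>\<^bsub>H \<boxtimes> H \<boxtimes> B \<boxtimes> H\<^esub> ltens K H H (B \<boxtimes> H) (comult H) U"
  shows "lcontr \<epsilon> (B \<boxtimes> H) U = \<one>\<^bsub>B \<boxtimes> H\<^esub>"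
proof -
  let ?BH = "B \<boxtimes> H" and ?HBH = "H \<boxtimes> B \<boxtimes> H" and ?R = "H \<boxtimes> H \<boxtimes> B \<boxtimes> H"
  let ?E = "rtens K H ?BH (lcontr \<epsilon> ?BH)"
  note [simp] = alg_hom_klin[OF lam] alg_hom_klin[OF rho] alg_hom_closed[OF lam] alg_hom_closed[OF rho]
  note [simp] = P(1)
  have Uc [simp]: "U \<in> carrier ?HBH" by (rule alg_Units(1)[OF _ U]) simp
  \<comment> \<open>\<open>?E\<close> is id \<otimes> \<epsilon> \<otimes> id \<otimes> id. The
    coaction and the coproduct that reach into the second leg collapse to the identity, both factors
    containing \<open>P\<close> become 1 by its normalization, and the pentagon shrinks to (1
    \<otimes> (\<epsilon> \<otimes> id \<otimes> id)(U)) U = U.\<close>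
  have E: "?E \<in> alg_hom K ?R ?HBH"
    by (intro rtens_alg_hom lcontr_alg_hom) simp_all
  note [simp] = rtens_etens[where U = H and V = ?BH and W = "H \<boxtimes> ?BH" and f = "lcontr \<epsilon> ?BH"]
    klin_comp[OF rtens_etens(2)[where U = H and V = ?BH and W = "H \<boxtimes> ?BH" and f = "lcontr \<epsilon> ?BH"]]
  have h1: "rtens K H ?HBH (ltens K H B H lam) \<in> alg_hom K ?HBH ?R"
    by (intro rtens_alg_hom ltens_alg_hom lam) simp_all
  have h2: "tens_one K H H B H \<in> alg_hom K (H \<boxtimes> H \<boxtimes> B) ?R"
    by (intro tens_one_alg_hom) simp_all
  have h3: "rtens K H ?HBH (rtens K H ?BH rho) \<in> alg_hom K (H \<boxtimes> H \<boxtimes> B) ?R"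
    by (intro rtens_alg_hom rho) simp_all
  have h4: "ltens K H H ?BH \<Delta> \<in> alg_hom K ?HBH ?R"
    by (intro ltens_alg_hom comult_hom) simp_all
  note [simp] = rtens_etens[OF _ _ _ alg_hom_klin[OF ltens_alg_hom[OF _ _ _ _ lam]]]
    rtens_etens[OF _ _ _ alg_hom_klin[OF rtens_alg_hom[OF _ _ _ rho]]]
    ltens_etens[OF _ _ _ _ alg_hom_klin[OF lam]] rtens_etens[OF _ _ _ alg_hom_klin[OF rho]]
    ltens_etens[OF _ _ _ _ alg_hom_klin[OF comult_hom]]
    rtens_etens[where W = "H \<boxtimes> B" and f = "lcontr \<epsilon> B"]
    tens_one_etens
  note klinE = klin_comp[OF alg_hom_klin[OF E]]
  have c1: "?E (rtens K H ?HBH (ltens K H B H lam) t) = t" if "t \<in> carrier ?HBH" for t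
    by (rule tens3_eqI[OF that, where X = ?HBH]) (simp_all add: klinE[OF alg_hom_klin[OF h1]] lam_eps)
  have c2: "?E (tens_one K H H B H t) = lassoc K H B H (rtens K H B (lcontr \<epsilon> B) t) \<one>\<^sub>H"
    if "t \<in> carrier (H \<boxtimes> H \<boxtimes> B)" for t
    by (rule tens3_eqI[OF that, where X = ?HBH]) (simp_all add: klinE[OF alg_hom_klin[OF h2]] etens_smult lassoc_smult)
  have c3: "?E (rtens K H ?HBH (rtens K H ?BH rho) t) = rtens K H ?BH rho (rtens K H B (lcontr \<epsilon> B) t)"
    if "t \<in> carrier (H \<boxtimes> H \<boxtimes> B)" for t
    by (rule tens3_eqI[OF that, where X = ?HBH])
      (simp_all add: klinE[OF alg_hom_klin[OF h3]] etens_smult klin_smult[OF rtens_etens(2)[OF _ _ _ alg_hom_klin[OF rho]]]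
        klin_comp[OF rtens_etens(2)[OF _ _ _ alg_hom_klin[OF rho]]])
  have c4: "?E (ltens K H H ?BH \<Delta> t) = t" if "t \<in> carrier ?HBH" for t
    by (rule tens_eqI[OF that, where X = ?HBH]) (simp_all add: klinE[OF alg_hom_klin[OF h4]])
  note cl = alg_hom_closed[OF h1] alg_hom_closed[OF h2] alg_hom_closed[OF h3] alg_hom_closed[OF h4]
  have one: "lassoc K H B H \<one>\<^bsub>H \<boxtimes> B\<^esub> \<one>\<^sub>H = \<one>\<^bsub>?HBH\<^esub>" "rtens K H ?BH rho \<one>\<^bsub>H \<boxtimes> B\<^esub> = \<one>\<^bsub>?HBH\<^esub>"
    using alg_hom_one[OF rho] by (simp_all add: tens_one_def')
  have "?E (etens K H ?HBH \<one>\<^sub>H U \<otimes>\<^bsub>?R\<^esub> rtens K H ?HBH (ltens K H B H lam) U \<otimes>\<^bsub>?R\<^esub> tens_one K H H B H P)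
    = etens K H ?BH \<one>\<^sub>H (lcontr \<epsilon> ?BH U) \<otimes>\<^bsub>?HBH\<^esub> U"
    using cl c1 c2 P by (simp add: alg_hom_mult[OF E] one)
  moreover have "?E (rtens K H ?HBH (rtens K H ?BH rho) P \<otimes>\<^bsub>?R\<^esub> ltens K H H ?BH \<Delta> U) = U"
    using cl c3 c4 P by (simp add: alg_hom_mult[OF E] one)
  ultimately have "etens K H ?BH \<one>\<^sub>H (lcontr \<epsilon> ?BH U) \<otimes>\<^bsub>?HBH\<^esub> U = U" using pent by simp
  then have "(etens K H ?BH \<one>\<^sub>H (lcontr \<epsilon> ?BH U) \<otimes>\<^bsub>?HBH\<^esub> U) \<otimes>\<^bsub>?HBH\<^esub> inv\<^bsub>?HBH\<^esub> U = \<one>\<^bsub>?HBH\<^esub>"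
    using alg_Units(3)[OF _ U] by simp
  then have "etens K H ?BH \<one>\<^sub>H (lcontr \<epsilon> ?BH U) = \<one>\<^bsub>?HBH\<^esub>"
    using alg_Units[OF _ U] by (simp add: alg_assoc)
  then have "etens K H ?BH \<one>\<^sub>H (lcontr \<epsilon> ?BH U) = etens K H ?BH \<one>\<^sub>H \<one>\<^bsub>?BH\<^esub>"
    by (simp only: tens_one_def'[of H ?BH])
  then have "lcontr \<epsilon> ?BH (etens K H ?BH \<one>\<^sub>H (lcontr \<epsilon> ?BH U)) = lcontr \<epsilon> ?BH (etens K H ?BH \<one>\<^sub>H \<one>\<^bsub>?BH\<^esub>)"
    by simp
  then show ?thesis by (simp del: lcontr_lassoc)
qed

end

section \<open>The pentagon and the normalization of the reassociator\<close>

context tensor_calculus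
begin

lemma alg_inv_one: "assoc_algebra K V \<Longrightarrow> inv\<^bsub>V\<^esub> \<one>\<^bsub>V\<^esub> = \<one>\<^bsub>V\<^esub>"
  using monoid.inv_one[OF alg_monoid] .

lemma unit_cancel_left:
  assumes V: "assoc_algebra K V" and x: "x \<in> Units V" and y: "y \<in> carrier V" and e: "x \<otimes>\<^bsub>V\<^esub> y = x"
  shows "y = \<one>\<^bsub>V\<^esub>"
  using alg_cancel(2)[OF V x y] e alg_Units(4)[OF V x] by simp

text \<open>The first five forms place at the outer ends of the right side those factors that a
  suitable functional will swallow, with a single \<open>p1\<close>, \<open>p4\<close> or a product
  of two factors surviving. The sixth is the inverse of the whole pentagon.\<close>

lemma pentagon_forms:
  assumes V: "assoc_algebra K V"
    and U: "p4 \<in> Units V" "pm \<in> Units V" "p1 \<in> Units V" "pr \<in> Units V" "pl \<in> Units V"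
    and p: "p4 \<otimes>\<^bsub>V\<^esub> pm \<otimes>\<^bsub>V\<^esub> p1 = pr \<otimes>\<^bsub>V\<^esub> pl"
  shows "pl \<otimes>\<^bsub>V\<^esub> inv\<^bsub>V\<^esub> p1 = inv\<^bsub>V\<^esub> pr \<otimes>\<^bsub>V\<^esub> (p4 \<otimes>\<^bsub>V\<^esub> pm)" (is ?t1)
    and "inv\<^bsub>V\<^esub> p4 \<otimes>\<^bsub>V\<^esub> pr = pm \<otimes>\<^bsub>V\<^esub> (p1 \<otimes>\<^bsub>V\<^esub> inv\<^bsub>V\<^esub> pl)" (is ?t2)
    and "p1 \<otimes>\<^bsub>V\<^esub> inv\<^bsub>V\<^esub> pl = inv\<^bsub>V\<^esub> pm \<otimes>\<^bsub>V\<^esub> (inv\<^bsub>V\<^esub> p4 \<otimes>\<^bsub>V\<^esub> pr)" (is ?t3)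
    and "inv\<^bsub>V\<^esub> pr \<otimes>\<^bsub>V\<^esub> p4 = pl \<otimes>\<^bsub>V\<^esub> (inv\<^bsub>V\<^esub> p1 \<otimes>\<^bsub>V\<^esub> inv\<^bsub>V\<^esub> pm)" (is ?t4)
    and "inv\<^bsub>V\<^esub> p1 = inv\<^bsub>V\<^esub> pl \<otimes>\<^bsub>V\<^esub> (inv\<^bsub>V\<^esub> pr \<otimes>\<^bsub>V\<^esub> (p4 \<otimes>\<^bsub>V\<^esub> pm))" (is ?t5)
    and "inv\<^bsub>V\<^esub> p1 \<otimes>\<^bsub>V\<^esub> (inv\<^bsub>V\<^esub> pm \<otimes>\<^bsub>V\<^esub> inv\<^bsub>V\<^esub> p4) = inv\<^bsub>V\<^esub> pl \<otimes>\<^bsub>V\<^esub> inv\<^bsub>V\<^esub> pr" (is ?t6)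
proof -
  note u4 = alg_Units[OF V U(1)] and um = alg_Units[OF V U(2)] and u1 = alg_Units[OF V U(3)]
    and ur = alg_Units[OF V U(4)] and ul = alg_Units[OF V U(5)]
  note [simp] = V u4 um u1 ur ul alg_cancel[OF V U(1)] alg_cancel[OF V U(2)] alg_cancel[OF V U(3)]
    alg_cancel[OF V U(4)] alg_cancel[OF V U(5)]
  have q: "p4 \<otimes>\<^bsub>V\<^esub> (pm \<otimes>\<^bsub>V\<^esub> p1) = pr \<otimes>\<^bsub>V\<^esub> pl" using p by (simp add: alg_assoc)
  have pl: "pl = inv\<^bsub>V\<^esub> pr \<otimes>\<^bsub>V\<^esub> (p4 \<otimes>\<^bsub>V\<^esub> (pm \<otimes>\<^bsub>V\<^esub> p1))" by (simp add: q)
  show t1: ?t1 by (subst pl) (simp add: alg_assoc)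
  have pr: "pr = p4 \<otimes>\<^bsub>V\<^esub> (pm \<otimes>\<^bsub>V\<^esub> (p1 \<otimes>\<^bsub>V\<^esub> inv\<^bsub>V\<^esub> pl))"
    using arg_cong[OF q, of "\<lambda>x. x \<otimes>\<^bsub>V\<^esub> inv\<^bsub>V\<^esub> pl"] by (simp add: alg_assoc)
  show t2: ?t2 by (subst pr) (simp add: alg_assoc)
  show t3: ?t3 by (simp add: t2)
  have p4: "inv\<^bsub>V\<^esub> pr \<otimes>\<^bsub>V\<^esub> (p4 \<otimes>\<^bsub>V\<^esub> pm) \<otimes>\<^bsub>V\<^esub> inv\<^bsub>V\<^esub> pm = pl \<otimes>\<^bsub>V\<^esub> inv\<^bsub>V\<^esub> p1 \<otimes>\<^bsub>V\<^esub> inv\<^bsub>V\<^esub> pm"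
    by (simp only: t1)
  then show t4: ?t4 by (simp add: alg_assoc)
  show t5: ?t5 by (subst t1[symmetric]) simp
  have "inv\<^bsub>V\<^esub> pl \<otimes>\<^bsub>V\<^esub> (inv\<^bsub>V\<^esub> pr \<otimes>\<^bsub>V\<^esub> p4) = inv\<^bsub>V\<^esub> p1 \<otimes>\<^bsub>V\<^esub> inv\<^bsub>V\<^esub> pm" by (simp add: t4)
  from arg_cong[OF this, of "\<lambda>x. x \<otimes>\<^bsub>V\<^esub> inv\<^bsub>V\<^esub> p4"] show ?t6 by (simp add: alg_assoc)
qed

end

context quasi_bialgebra
begin

lemma reassoc_closed [simp]: "\<Phi> \<in> carrier H3" "\<Phi>i \<in> carrier H3" "\<Phi> \<cdot>\<^sub>3 \<Phi>i = \<one>\<^bsub>H3\<^esub>" "\<Phi>i \<cdot>\<^sub>3 \<Phi> = \<one>\<^bsub>H3\<^esub>"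
  by (rule alg_Units[OF _ reassoc_unit]; simp)+

lemma coassoc_left:
  "h \<in> carrier H \<Longrightarrow> rtens K H H2 \<Delta> (\<Delta> h) \<cdot>\<^sub>3 \<Phi> = \<Phi> \<cdot>\<^sub>3 ltens K H H H \<Delta> (\<Delta> h)"
  and coassoc_right:
  "h \<in> carrier H \<Longrightarrow> \<Phi>i \<cdot>\<^sub>3 rtens K H H2 \<Delta> (\<Delta> h) = ltens K H H H \<Delta> (\<Delta> h) \<cdot>\<^sub>3 \<Phi>i"
proof -
  assume h: "h \<in> carrier H"
  have c: "ltens K H H H \<Delta> (\<Delta> h) \<in> carrier H3"
    by (rule klin_closed[OF ltens_etens(2)[of H]]) (use h in simp_all)
  then show "rtens K H H2 \<Delta> (\<Delta> h) \<cdot>\<^sub>3 \<Phi> = \<Phi> \<cdot>\<^sub>3 ltens K H H H \<Delta> (\<Delta> h)"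
    by (simp add: quasi_coassoc[OF h] alg_assoc)
  show "\<Phi>i \<cdot>\<^sub>3 rtens K H H2 \<Delta> (\<Delta> h) = ltens K H H H \<Delta> (\<Delta> h) \<cdot>\<^sub>3 \<Phi>i"
    using c by (simp add: quasi_coassoc[OF h] alg_assoc[symmetric])
qed

text \<open>Kept as maps on all three-leg tensors instead of five elements, since identities are
  proved for a variable tensor and then read at \<open>\<Phi>\<close> or its inverse. M, R, L tell
  which leg is comultiplied; 1 and 4 tell which end leg the tensor occupies.\<close>

abbreviation "P1 \<equiv> tens_one K H H H H"
abbreviation "P4 \<equiv> etens K H H3 \<one>\<^sub>H"
abbreviation "PM \<equiv> rtens K H H3 (ltens K H H H \<Delta>)"
abbreviation "PR \<equiv> rtens K H H3 (rtens K H H2 \<Delta>)"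
abbreviation "PL \<equiv> ltens K H H H2 \<Delta>"

lemma P_hom:
  "P1 \<in> alg_hom K H3 H4" "P4 \<in> alg_hom K H3 H4" "PM \<in> alg_hom K H3 H4"
  "PR \<in> alg_hom K H3 H4" "PL \<in> alg_hom K H3 H4"
  by (intro tens_one_alg_hom etens_one_alg_hom rtens_alg_hom ltens_alg_hom comult_hom assoc_algebra_tensor
      assoc_algebra_H)+

lemmas P_closed [simp] = P_hom[THEN alg_hom_closed]
lemmas P_klin [simp] = P_hom[THEN alg_hom_klin]

lemma P_pure [simp]:
  assumes "a \<in> carrier H" "b \<in> carrier H" "c \<in> carrier H"
  shows "P1 (e3 a b c) = e4 a b c \<one>\<^sub>H"
    "PM (e3 a b c) = etens K H H3 a (lassoc K H H H (\<Delta> b) c)"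
    "PR (e3 a b c) = etens K H H3 a (etens K H H2 b (\<Delta> c))"
    "t \<in> carrier H2 \<Longrightarrow> PL (etens K H H2 a t) = lassoc K H H H2 (\<Delta> a) t"
  using assms by (simp_all add: tens_one_etens ltens_etens[of H] rtens_etens(1)[of H H2 H]
    rtens_etens(1)[of H H3 H2] rtens_etens(2) ltens_etens(2))

lemma pentagon_form:
  "PL \<Phi> \<cdot>\<^sub>4 P1 \<Phi>i = PR \<Phi>i \<cdot>\<^sub>4 (P4 \<Phi> \<cdot>\<^sub>4 PM \<Phi>)" (is ?g1)
  "P4 \<Phi>i \<cdot>\<^sub>4 PR \<Phi> = PM \<Phi> \<cdot>\<^sub>4 (P1 \<Phi> \<cdot>\<^sub>4 PL \<Phi>i)" (is ?g2)
  "P1 \<Phi> \<cdot>\<^sub>4 PL \<Phi>i = PM \<Phi>i \<cdot>\<^sub>4 (P4 \<Phi>i \<cdot>\<^sub>4 PR \<Phi>)" (is ?g3)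
  "PR \<Phi>i \<cdot>\<^sub>4 P4 \<Phi> = PL \<Phi> \<cdot>\<^sub>4 (P1 \<Phi>i \<cdot>\<^sub>4 PM \<Phi>i)" (is ?g4)
  "P1 \<Phi>i = PL \<Phi>i \<cdot>\<^sub>4 (PR \<Phi>i \<cdot>\<^sub>4 (P4 \<Phi> \<cdot>\<^sub>4 PM \<Phi>))" (is ?g5)
  "P1 \<Phi>i \<cdot>\<^sub>4 (PM \<Phi>i \<cdot>\<^sub>4 P4 \<Phi>i) = PL \<Phi>i \<cdot>\<^sub>4 PR \<Phi>i" (is ?g6)
proof -
  have H34: "assoc_algebra K H3" "assoc_algebra K H4" by simp_all
  note U = P_hom[THEN alg_hom_Units(1)[OF H34 _ reassoc_unit]]
  note I = P_hom[THEN alg_hom_Units(2)[OF H34 _ reassoc_unit]]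
  note F = pentagon_forms[OF H34(2) U(2) U(3) U(1) U(4) U(5) pentagon]
  show ?g1 ?g2 ?g3 ?g4 ?g5 ?g6
    unfolding I by (rule F)+
qed

lemma rtens_lcontr [simp]:
  "\<lbrakk> module K X; a \<in> carrier H; b \<in> carrier H; x \<in> carrier X \<rbrakk> \<Longrightarrow>
    rtens K H X (lcontr \<epsilon> X) (etens K H (H \<boxtimes> X) a (etens K H X b x)) = \<epsilon> b \<odot>\<^bsub>H \<boxtimes> X\<^esub> etens K H X a x"
  "module K X \<Longrightarrow> klin K (H \<boxtimes> H \<boxtimes> X) (H \<boxtimes> X) (rtens K H X (lcontr \<epsilon> X))"
  by (simp_all add: rtens_etens[of H X "H \<boxtimes> X"] etens_smult)

lemma rtens_rcontr [simp]:
  "\<lbrakk> module K X; a \<in> carrier H; b \<in> carrier H; x \<in> carrier X \<rbrakk> \<Longrightarrow>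
    rtens K H X (rcontr \<epsilon> X) (etens K H (X \<boxtimes> H) a (etens K X H x b)) = \<epsilon> b \<odot>\<^bsub>H \<boxtimes> X\<^esub> etens K H X a x"
  "module K X \<Longrightarrow> klin K (H \<boxtimes> X \<boxtimes> H) (H \<boxtimes> X) (rtens K H X (rcontr \<epsilon> X))"
  by (simp_all add: rtens_etens[of H X "X \<boxtimes> H"] etens_smult)

lemmas klin_rtens_contr [simp] = klin_comp[OF rtens_lcontr(2)] klin_comp[OF rtens_rcontr(2)]

lemma unit_tens_mult [simp]:
  "t \<in> carrier H2 \<Longrightarrow> e2 \<one>\<^sub>H \<one>\<^sub>H \<cdot>\<^sub>2 t = t" "t \<in> carrier H2 \<Longrightarrow> t \<cdot>\<^sub>2 e2 \<one>\<^sub>H \<one>\<^sub>H = t"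
  "u \<in> carrier H3 \<Longrightarrow> e3 \<one>\<^sub>H \<one>\<^sub>H \<one>\<^sub>H \<cdot>\<^sub>3 u = u" "u \<in> carrier H3 \<Longrightarrow> u \<cdot>\<^sub>3 e3 \<one>\<^sub>H \<one>\<^sub>H \<one>\<^sub>H = u"
  "v \<in> carrier H4 \<Longrightarrow> e4 \<one>\<^sub>H \<one>\<^sub>H \<one>\<^sub>H \<one>\<^sub>H \<cdot>\<^sub>4 v = v" "v \<in> carrier H4 \<Longrightarrow> v \<cdot>\<^sub>4 e4 \<one>\<^sub>H \<one>\<^sub>H \<one>\<^sub>H \<one>\<^sub>H = v"
  by (simp_all flip: tens_one_def')

lemma reassoc_mid: "rtens K H H (lcontr \<epsilon> H) \<Phi> = \<one>\<^bsub>H2\<^esub>"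
proof -
  have "rtens K H H (lcontr \<epsilon> H) t = tsum3 H2 (\<lambda>x1 x2 x3. e2 (\<epsilon> x2 \<odot>\<^bsub>H\<^esub> x1) x3) t" if "t \<in> carrier H3" for t
    by (rule tens3_eqI[OF that, where X = H2]) (simp_all add: tsum3_etens etens_smult)
  then show ?thesis using counit_reassoc by simp
qed

lemma reassoc_left: "lcontr \<epsilon> H2 \<Phi> = \<one>\<^bsub>H2\<^esub>"
  by (rule counit_left_from_pentagon[OF _ comult_hom comult_hom _ _ reassoc_mid reassoc_unit pentagon]) simp_all

text \<open>Contracting the third leg of the pentagon. The factors \<open>P4 \<Phi>\<close> and
  \<open>PL \<Phi>\<close> become 1 by \<open>reassoc_mid\<close>, \<open>PM \<Phi>\<close> and
  \<open>PR \<Phi>\<close> both become \<open>\<Phi>\<close>, and \<open>P1 \<Phi>\<close> becomes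
  the contraction in question tensored with 1; cancelling \<open>\<Phi>\<close> finishes.\<close>

lemma reassoc_right: "rtens K H H (rcontr \<epsilon> H) \<Phi> = \<one>\<^bsub>H2\<^esub>"
proof -
  let ?C = "rtens K H H (lcontr \<epsilon> H)" and ?E = "rtens K H H2 (rtens K H H (lcontr \<epsilon> H))"
  let ?N = "rtens K H H (rcontr \<epsilon> H)"
  have E: "?E \<in> alg_hom K H4 H3"
    by (intro rtens_alg_hom lcontr_alg_hom) simp_all
  have Ce: "a \<in> carrier H \<Longrightarrow> s \<in> carrier H2 \<Longrightarrow> ?C (etens K H H2 a s) = e2 a (lcontr \<epsilon> H s)" for a s
    by (simp add: rtens_etens[of H H H2])
  have Ee: "a \<in> carrier H \<Longrightarrow> s \<in> carrier H3 \<Longrightarrow> ?E (etens K H H3 a s) = etens K H H2 a (?C s)" for a s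
    by (simp add: rtens_etens[of H H2 H3])
  note kE = alg_hom_klin[OF E] klin_comp[OF alg_hom_klin[OF E]]
  have cC: "s \<in> carrier H3 \<Longrightarrow> ?C s \<in> carrier H2" "s \<in> carrier H3 \<Longrightarrow> ?N s \<in> carrier H2" for s
    by (rule klin_closed[of K H3]; simp)+
  have c1: "?E (PM t) = t" if "t \<in> carrier H3" for t
    by (rule tens3_eqI[OF that, where X = H3]) (simp_all add: kE Ee)
  have c2: "?E (P1 t) = lassoc K H H H (?N t) \<one>\<^sub>H" if "t \<in> carrier H3" for t
    by (rule tens3_eqI[OF that, where X = H3]) (simp_all add: kE Ee etens_smult lassoc_smult)
  have c3: "?E (PR t) = t" if "t \<in> carrier H3" for t
    by (rule tens3_eqI[OF that, where X = H3]) (simp_all add: kE Ee Ce)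
  have E_lassoc: "?E (lassoc K H H H2 d (e2 b c)) = lassoc K H H H d (\<epsilon> b \<odot>\<^bsub>H\<^esub> c)"
    if "d \<in> carrier H2" "b \<in> carrier H" "c \<in> carrier H" for d b c
    by (rule tens_eqI[OF that(1), where X = H3]) (use that in \<open>simp_all add: kE Ee etens_smult\<close>)
  have c4: "?E (PL t) = ltens K H H H \<Delta> (?C t)" if "t \<in> carrier H3" for t
    by (rule tens3_eqI[OF that, where X = H3])
      (simp_all add: kE klin_comp[OF ltens_etens(2)[of H]] E_lassoc Ce ltens_etens[of H] del: rtens_lcontr(1))
  have l1: "ltens K H H H \<Delta> \<one>\<^bsub>H2\<^esub> = \<one>\<^bsub>H3\<^esub>"
    by (simp add: tens_one_def' ltens_etens[of H])
  have "?E (P4 \<Phi>) = \<one>\<^bsub>H3\<^esub>" by (simp add: Ee reassoc_mid tens_one_def')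
  then have "\<Phi> \<cdot>\<^sub>3 lassoc K H H H (?N \<Phi>) \<one>\<^sub>H = ?E (P4 \<Phi> \<cdot>\<^sub>4 PM \<Phi> \<cdot>\<^sub>4 P1 \<Phi>)"
    using c1 c2 by (simp add: alg_hom_mult[OF E] cC)
  also have "\<dots> = \<Phi>"
    unfolding pentagon using c3 c4 by (simp add: alg_hom_mult[OF E] reassoc_mid l1)
  finally have "lassoc K H H H (?N \<Phi>) \<one>\<^sub>H = \<one>\<^bsub>H3\<^esub>"
    by (intro unit_cancel_left[OF _ reassoc_unit]) (simp_all add: cC)
  moreover have "?N (lassoc K H H H t \<one>\<^sub>H) = t" if "t \<in> carrier H2" for t
    by (rule tens_eqI[OF that, where X = H2]) (simp_all add: klin_comp[OF rtens_rcontr(2)])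
  ultimately have "?N \<Phi> = ?N \<one>\<^bsub>H3\<^esub>" by (metis cC(2) reassoc_closed(1))
  then show ?thesis by (simp add: tens_one_def')
qed

lemma reassoc_inv_normal:
  "rtens K H H (lcontr \<epsilon> H) \<Phi>i = \<one>\<^bsub>H2\<^esub>" (is ?g1) "lcontr \<epsilon> H2 \<Phi>i = \<one>\<^bsub>H2\<^esub>" (is ?g2) "rtens K H H (rcontr \<epsilon> H) \<Phi>i = \<one>\<^bsub>H2\<^esub>" (is ?g3)
proof -
  have h: "rtens K H H (lcontr \<epsilon> H) \<in> alg_hom K H3 H2" "lcontr \<epsilon> H2 \<in> alg_hom K H3 H2"
    "rtens K H H (rcontr \<epsilon> H) \<in> alg_hom K H3 H2"
    by (intro rtens_alg_hom lcontr_alg_hom rcontr_alg_hom; simp)+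
  have a: "assoc_algebra K H3" "assoc_algebra K H2" by simp_all
  show ?g1 ?g2 ?g3
    by (simp_all add: h[THEN alg_hom_Units(2)[OF a _ reassoc_unit]] reassoc_mid reassoc_left reassoc_right alg_inv_one)
qed

lemmas reassoc_normal = reassoc_mid reassoc_left reassoc_right reassoc_inv_normal

section \<open>Functionals that turn coproducts into counits\<close>

context
  fixes X L
  assumes X [simp]: "module K X" and L: "klin K H4 X L"
begin

lemmas kL [simp] = L klin_comp[OF L] klin_closed[OF L]

text \<open>Under \<open>L\<close> the factor \<open>PL T\<close> is seen only through the
  contraction of \<open>T\<close>. That statement is linear in \<open>T\<close>, hence decided on
  pure tensors; the normalization of \<open>T\<close> enters afterwards and makes the factor 1. The
  five companions below differ in the pair of legs and in the side.\<close>

lemma contract_left_12: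
  assumes inv: "\<And>h a b c d. \<lbrakk> h \<in> carrier H; a \<in> carrier H; b \<in> carrier H; c \<in> carrier H; d \<in> carrier H \<rbrakk> \<Longrightarrow>
      L (lassoc K H H H2 (\<Delta> h \<cdot>\<^sub>2 e2 a b) (e2 c d)) = \<epsilon> h \<odot>\<^bsub>X\<^esub> L (e4 a b c d)"
    and T: "T \<in> carrier H3" "lcontr \<epsilon> H2 T = \<one>\<^bsub>H2\<^esub>" and t: "t \<in> carrier H4"
  shows "L (PL T \<cdot>\<^sub>4 t) = L t"
proof -
  have m: "lassoc K H H H2 (\<Delta> h) (e2 c' d') \<cdot>\<^sub>4 e4 a b c d = lassoc K H H H2 (\<Delta> h \<cdot>\<^sub>2 e2 a b) (e2 (c' \<cdot> c) (d' \<cdot> d))"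
    if "h \<in> carrier H" "a \<in> carrier H" "b \<in> carrier H" "c \<in> carrier H" "d \<in> carrier H" "c' \<in> carrier H" "d' \<in> carrier H" for h a b c d c' d'
    using that lassoc_mult[of H H H2 "\<Delta> h" "e2 a b" "e2 c' d'" "e2 c d"] by simp
  have "L (PL T \<cdot>\<^sub>4 t) = L (P4 (etens K H H2 \<one>\<^sub>H (lcontr \<epsilon> H2 T)) \<cdot>\<^sub>4 t)"
    by (rule tens3_eqI[OF T(1), where X = X]; (rule tens4_eqI[OF t, where X = X])?;
        simp add: t inv m etens_smult klin_smult[OF L] tens_one_def')
  then show ?thesis using T t by (simp add: tens_one_def')
qed

lemma contract_right_12:
  assumes inv: "\<And>h a b c d. \<lbrakk> h \<in> carrier H; a \<in> carrier H; b \<in> carrier H; c \<in> carrier H; d \<in> carrier H \<rbrakk> \<Longrightarrow>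
      L (lassoc K H H H2 (e2 a b \<cdot>\<^sub>2 \<Delta> h) (e2 c d)) = \<epsilon> h \<odot>\<^bsub>X\<^esub> L (e4 a b c d)"
    and T: "T \<in> carrier H3" "lcontr \<epsilon> H2 T = \<one>\<^bsub>H2\<^esub>" and t: "t \<in> carrier H4"
  shows "L (t \<cdot>\<^sub>4 PL T) = L t"
proof -
  have m: "e4 a b c d \<cdot>\<^sub>4 lassoc K H H H2 (\<Delta> h) (e2 c' d') = lassoc K H H H2 (e2 a b \<cdot>\<^sub>2 \<Delta> h) (e2 (c \<cdot> c') (d \<cdot> d'))"
    if "h \<in> carrier H" "a \<in> carrier H" "b \<in> carrier H" "c \<in> carrier H" "d \<in> carrier H" "c' \<in> carrier H" "d' \<in> carrier H" for h a b c d c' d'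
    using that lassoc_mult[of H H H2 "e2 a b" "\<Delta> h" "e2 c d" "e2 c' d'"] by simp
  have "L (t \<cdot>\<^sub>4 PL T) = L (t \<cdot>\<^sub>4 P4 (etens K H H2 \<one>\<^sub>H (lcontr \<epsilon> H2 T)))"
    by (rule tens3_eqI[OF T(1), where X = X]; (rule tens4_eqI[OF t, where X = X])?;
        simp add: t inv m etens_smult klin_smult[OF L] tens_one_def')
  then show ?thesis using T t by (simp add: tens_one_def')
qed

lemma contract_left_34:
  assumes inv: "\<And>h a b c d. \<lbrakk> h \<in> carrier H; a \<in> carrier H; b \<in> carrier H; c \<in> carrier H; d \<in> carrier H \<rbrakk> \<Longrightarrow>
      L (etens K H H3 a (etens K H H2 b (\<Delta> h \<cdot>\<^sub>2 e2 c d))) = \<epsilon> h \<odot>\<^bsub>X\<^esub> L (e4 a b c d)"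
    and T: "T \<in> carrier H3" "rtens K H H (rcontr \<epsilon> H) T = \<one>\<^bsub>H2\<^esub>" and t: "t \<in> carrier H4"
  shows "L (PR T \<cdot>\<^sub>4 t) = L t"
proof -
  have k: "klin K H3 H4 (\<lambda>T. lassoc K H H H2 (rtens K H H (rcontr \<epsilon> H) T) \<one>\<^bsub>H2\<^esub>)"
    using klin_lassoc1[of H H H2, OF _ _ _ _ rtens_rcontr(2)] by simp
  have "L (PR T \<cdot>\<^sub>4 t) = L (lassoc K H H H2 (rtens K H H (rcontr \<epsilon> H) T) \<one>\<^bsub>H2\<^esub> \<cdot>\<^sub>4 t)"
    by (rule tens3_eqI[OF T(1), where X = X]; (rule tens4_eqI[OF t, where X = X])?;
        simp add: t inv k klin_closed[OF k] lassoc_smult etens_smult klin_smult[OF L] tens_one_def')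
  then show ?thesis using T t by (simp add: tens_one_def')
qed

lemma contract_right_34:
  assumes inv: "\<And>h a b c d. \<lbrakk> h \<in> carrier H; a \<in> carrier H; b \<in> carrier H; c \<in> carrier H; d \<in> carrier H \<rbrakk> \<Longrightarrow>
      L (etens K H H3 a (etens K H H2 b (e2 c d \<cdot>\<^sub>2 \<Delta> h))) = \<epsilon> h \<odot>\<^bsub>X\<^esub> L (e4 a b c d)"
    and T: "T \<in> carrier H3" "rtens K H H (rcontr \<epsilon> H) T = \<one>\<^bsub>H2\<^esub>" and t: "t \<in> carrier H4"
  shows "L (t \<cdot>\<^sub>4 PR T) = L t"
proof -
  have k: "klin K H3 H4 (\<lambda>T. lassoc K H H H2 (rtens K H H (rcontr \<epsilon> H) T) \<one>\<^bsub>H2\<^esub>)"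
    using klin_lassoc1[of H H H2, OF _ _ _ _ rtens_rcontr(2)] by simp
  have "L (t \<cdot>\<^sub>4 PR T) = L (t \<cdot>\<^sub>4 lassoc K H H H2 (rtens K H H (rcontr \<epsilon> H) T) \<one>\<^bsub>H2\<^esub>)"
    by (rule tens3_eqI[OF T(1), where X = X]; (rule tens4_eqI[OF t, where X = X])?;
        simp add: t inv k klin_closed[OF k] lassoc_smult etens_smult klin_smult[OF L] tens_one_def')
  then show ?thesis using T t by (simp add: tens_one_def')
qed

lemma contract_left_23:
  assumes inv: "\<And>h a b c d. \<lbrakk> h \<in> carrier H; a \<in> carrier H; b \<in> carrier H; c \<in> carrier H; d \<in> carrier H \<rbrakk> \<Longrightarrow>
      L (etens K H H3 a (lassoc K H H H (\<Delta> h \<cdot>\<^sub>2 e2 b c) d)) = \<epsilon> h \<odot>\<^bsub>X\<^esub> L (e4 a b c d)"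
    and T: "T \<in> carrier H3" "rtens K H H (lcontr \<epsilon> H) T = \<one>\<^bsub>H2\<^esub>" and t: "t \<in> carrier H4"
  shows "L (PM T \<cdot>\<^sub>4 t) = L t"
proof -
  \<comment> \<open>\<open>J\<close> puts 1 \<otimes> 1 back between the two legs that survive the
    contraction, so that the comparison with \<open>PM T\<close> is linear in
    \<open>T\<close>.\<close>
  define J where "J = rtens K H H3 (\<lambda>x. etens K H H2 \<one>\<^sub>H (e2 \<one>\<^sub>H x))"
  have kJ: "klin K H2 H4 J" unfolding J_def by (rule rtens_etens(2)[of H H3 H]) simp_all
  have J: "J (e2 a b) = e4 a \<one>\<^sub>H \<one>\<^sub>H b" if "a \<in> carrier H" "b \<in> carrier H" for a b
    using that by (simp add: J_def rtens_etens[of H H3 H])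
  have m: "lassoc K H H H (\<Delta> h) d' \<cdot>\<^sub>3 e3 b c d = lassoc K H H H (\<Delta> h \<cdot>\<^sub>2 e2 b c) (d' \<cdot> d)"
    if "h \<in> carrier H" "b \<in> carrier H" "c \<in> carrier H" "d \<in> carrier H" "d' \<in> carrier H" for h b c d d'
    using that lassoc_mult[of H H H "\<Delta> h" "e2 b c" "d'" "d"] by simp
  have "L (PM T \<cdot>\<^sub>4 t) = L (J (rtens K H H (lcontr \<epsilon> H) T) \<cdot>\<^sub>4 t)"
    by (rule tens3_eqI[OF T(1), where X = X]; (rule tens4_eqI[OF t, where X = X])?;
        simp add: t inv J kJ klin_comp[OF kJ] klin_closed[OF kJ] klin_smult[OF kJ] m etens_smult klin_smult[OF L] tens_one_def')
  then show ?thesis using T t by (simp add: tens_one_def' J)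
qed

lemma contract_right_23:
  assumes inv: "\<And>h a b c d. \<lbrakk> h \<in> carrier H; a \<in> carrier H; b \<in> carrier H; c \<in> carrier H; d \<in> carrier H \<rbrakk> \<Longrightarrow>
      L (etens K H H3 a (lassoc K H H H (e2 b c \<cdot>\<^sub>2 \<Delta> h) d)) = \<epsilon> h \<odot>\<^bsub>X\<^esub> L (e4 a b c d)"
    and T: "T \<in> carrier H3" "rtens K H H (lcontr \<epsilon> H) T = \<one>\<^bsub>H2\<^esub>" and t: "t \<in> carrier H4"
  shows "L (t \<cdot>\<^sub>4 PM T) = L t"
proof -
  define J where "J = rtens K H H3 (\<lambda>x. etens K H H2 \<one>\<^sub>H (e2 \<one>\<^sub>H x))"
  have kJ: "klin K H2 H4 J" unfolding J_def by (rule rtens_etens(2)[of H H3 H]) simp_all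
  have J: "J (e2 a b) = e4 a \<one>\<^sub>H \<one>\<^sub>H b" if "a \<in> carrier H" "b \<in> carrier H" for a b
    using that by (simp add: J_def rtens_etens[of H H3 H])
  have m: "e3 b c d \<cdot>\<^sub>3 lassoc K H H H (\<Delta> h) d' = lassoc K H H H (e2 b c \<cdot>\<^sub>2 \<Delta> h) (d \<cdot> d')"
    if "h \<in> carrier H" "b \<in> carrier H" "c \<in> carrier H" "d \<in> carrier H" "d' \<in> carrier H" for h b c d d'
    using that lassoc_mult[of H H H "e2 b c" "\<Delta> h" "d" "d'"] by simp
  have "L (t \<cdot>\<^sub>4 PM T) = L (t \<cdot>\<^sub>4 J (rtens K H H (lcontr \<epsilon> H) T))"
    by (rule tens3_eqI[OF T(1), where X = X]; (rule tens4_eqI[OF t, where X = X])?;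
        simp add: t inv J kJ klin_comp[OF kJ] klin_closed[OF kJ] klin_smult[OF kJ] m etens_smult klin_smult[OF L] tens_one_def')
  then show ?thesis using T t by (simp add: tens_one_def' J)
qed

end

end

section \<open>The Drinfeld twist\<close>

context quasi_hopf_algebra
begin

abbreviation "S \<equiv> antipode H"
abbreviation "\<alpha> \<equiv> alpha H"
abbreviation "\<beta> \<equiv> beta H"

lemma antipode_simps [simp]:
  "h \<in> carrier H \<Longrightarrow> S h \<in> carrier H"
  "S \<one>\<^sub>H = \<one>\<^sub>H"
  "klin K H H S"
  "\<lbrakk> g \<in> carrier H; h \<in> carrier H \<rbrakk> \<Longrightarrow> S (g \<cdot> h) = S h \<cdot> S g"
  using antipode_anti_auto by (auto simp: alg_anti_automorphism_def klin_def bij_betw_def)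

lemmas antipode_klin [simp] = klin_comp[OF antipode_simps(3)]

lemmas alpha_beta_closed [simp] = alpha_closed beta_closed

section \<open>Antipode functionals and the Hausser-Nill elements\<close>

definition "SS = tsum2 H2 (\<lambda>a b. e2 (S b) (S a))"
definition "AL = tsum2 H (\<lambda>a b. S a \<cdot> \<alpha> \<cdot> b)"
definition "BE = tsum2 H (\<lambda>a b. a \<cdot> \<beta> \<cdot> S b)"
definition "P3 = tsum3 H2 (\<lambda>a b c. e2 a (b \<cdot> \<beta> \<cdot> S c))"
definition "Q3 = tsum3 H2 (\<lambda>a b c. e2 (S a \<cdot> \<alpha> \<cdot> b) c)"
text \<open>Read at \<open>\<Phi>\<close>, this and \<open>Q3'\<close> are the flipped images under
  S \<otimes> S of the Hausser-Nill elements p_L = X^2 S^-1(X^1 \<beta>) \<otimes> X^3 and q_R = X^1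
  \<otimes> S^-1(\<alpha> X^3) X^2. In this form no S^-1 occurs.\<close>

definition "P3' = tsum3 H2 (\<lambda>a b c. e2 (S c) (a \<cdot> \<beta> \<cdot> S b))"
definition "Q3' = tsum3 H2 (\<lambda>a b c. e2 (S b \<cdot> \<alpha> \<cdot> c) (S a))"

lemma functional_klin [simp]:
  "klin K H2 H2 SS" "klin K H2 H AL" "klin K H2 H BE"
  "klin K H3 H2 P3" "klin K H3 H2 Q3" "klin K H3 H2 P3'" "klin K H3 H2 Q3'"
  unfolding SS_def AL_def BE_def P3_def Q3_def P3'_def Q3'_def
  by (auto intro!: klin_tsum2 tsum3_etens(2))

lemmas functional_closed [simp] = functional_klin[THEN klin_closed]
lemmas functional_klin_comp [simp] = functional_klin[THEN klin_comp]

lemma functional_pure [simp]: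
  assumes "a \<in> carrier H" "b \<in> carrier H"
  shows "SS (e2 a b) = e2 (S b) (S a)" "AL (e2 a b) = S a \<cdot> \<alpha> \<cdot> b" "BE (e2 a b) = a \<cdot> \<beta> \<cdot> S b"
    "c \<in> carrier H \<Longrightarrow> P3 (e3 a b c) = e2 a (b \<cdot> \<beta> \<cdot> S c)"
    "c \<in> carrier H \<Longrightarrow> Q3 (e3 a b c) = e2 (S a \<cdot> \<alpha> \<cdot> b) c"
    "c \<in> carrier H \<Longrightarrow> P3' (e3 a b c) = e2 (S c) (a \<cdot> \<beta> \<cdot> S b)"
    "c \<in> carrier H \<Longrightarrow> Q3' (e3 a b c) = e2 (S b \<cdot> \<alpha> \<cdot> c) (S a)"
  unfolding SS_def AL_def BE_def P3_def Q3_def P3'_def Q3'_def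
  using assms by (simp_all add: tsum2_etens tsum3_etens)

lemma SS_mult [simp]:
  assumes s: "s \<in> carrier H2" and t: "t \<in> carrier H2"
  shows "SS (s \<cdot>\<^sub>2 t) = SS t \<cdot>\<^sub>2 SS s"
  by (rule tens_eqI[OF s, where X = H2]; (rule tens_eqI[OF t, where X = H2])?; simp add: t)

abbreviation "gg h \<equiv> SS (\<Delta> h)"

lemma AL_BE_comult [simp]:
  "h \<in> carrier H \<Longrightarrow> AL (\<Delta> h) = \<epsilon> h \<odot>\<^bsub>H\<^esub> \<alpha>" "h \<in> carrier H \<Longrightarrow> BE (\<Delta> h) = \<epsilon> h \<odot>\<^bsub>H\<^esub> \<beta>"
  by (simp_all add: AL_def BE_def antipode_alpha antipode_beta)

text \<open>\<open>p\<close> and \<open>q\<close> are the elements \<open>p\<^sub>R\<close> and \<open>q\<^sub>L\<close> of Hausser and Nill.\<close>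

abbreviation "p \<equiv> P3 \<Phi>i"
abbreviation "q \<equiv> Q3 \<Phi>i"
abbreviation "p' \<equiv> P3' \<Phi>"
abbreviation "q' \<equiv> Q3' \<Phi>"

text \<open>\<open>alg_assoc\<close> brackets to the right and thereby hides neighbouring pure
  factors from \<open>etens_mult\<close>; this rule merges them under the bracket.\<close>

lemma etens_mult_left:
  assumes "a \<in> carrier H" "b \<in> carrier H" "c \<in> carrier H" "d \<in> carrier H" "x \<in> carrier H2"
  shows "e2 a b \<cdot>\<^sub>2 (e2 c d \<cdot>\<^sub>2 x) = e2 (a \<cdot> c) (b \<cdot> d) \<cdot>\<^sub>2 x"
  using assms by (simp add: alg_assoc[symmetric])

lemmas nf = alg_assoc comult_mult etens_mult_left

definition "Pp = tsum2 H2 (\<lambda>a b. \<Delta> a \<cdot>\<^sub>2 p \<cdot>\<^sub>2 e2 \<one>\<^sub>H (S b))"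
definition "Qq = tsum2 H2 (\<lambda>a b. e2 (S a) \<one>\<^sub>H \<cdot>\<^sub>2 q \<cdot>\<^sub>2 \<Delta> b)"
definition "Pp' = tsum2 H2 (\<lambda>a b. e2 \<one>\<^sub>H a \<cdot>\<^sub>2 p' \<cdot>\<^sub>2 gg b)"
definition "Qq' = tsum2 H2 (\<lambda>a b. gg a \<cdot>\<^sub>2 q' \<cdot>\<^sub>2 e2 b \<one>\<^sub>H)"

lemma pq_klin [simp]:
  "klin K H2 H2 Pp" "klin K H2 H2 Qq" "klin K H2 H2 Pp'" "klin K H2 H2 Qq'"
  unfolding Pp_def Qq_def Pp'_def Qq'_def by (auto intro!: klin_tsum2)

lemmas pq_closed [simp] = pq_klin[THEN klin_closed]

lemma pq_pure [simp]:
  assumes "a \<in> carrier H" "b \<in> carrier H"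
  shows "Pp (e2 a b) = \<Delta> a \<cdot>\<^sub>2 p \<cdot>\<^sub>2 e2 \<one>\<^sub>H (S b)" "Qq (e2 a b) = e2 (S a) \<one>\<^sub>H \<cdot>\<^sub>2 q \<cdot>\<^sub>2 \<Delta> b"
    "Pp' (e2 a b) = e2 \<one>\<^sub>H a \<cdot>\<^sub>2 p' \<cdot>\<^sub>2 gg b" "Qq' (e2 a b) = gg a \<cdot>\<^sub>2 q' \<cdot>\<^sub>2 e2 b \<one>\<^sub>H"
  unfolding Pp_def Qq_def Pp'_def Qq'_def
  using assms by (simp_all add: tsum2_etens)

abbreviation "LD \<equiv> ltens K H H H \<Delta>"
abbreviation "RD \<equiv> rtens K H H2 \<Delta>"

lemma LD_RD [simp]:
  "klin K H2 H3 LD" "klin K H2 H3 RD"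
  "\<lbrakk> a \<in> carrier H; b \<in> carrier H \<rbrakk> \<Longrightarrow> LD (e2 a b) = lassoc K H H H (\<Delta> a) b"
  "\<lbrakk> a \<in> carrier H; b \<in> carrier H \<rbrakk> \<Longrightarrow> RD (e2 a b) = etens K H H2 a (\<Delta> b)"
  by (simp_all add: ltens_etens[of H] rtens_etens[of H H2 H])

lemmas LD_RD_closed [simp] = LD_RD(1,2)[THEN klin_closed]

text \<open>Here the two-leg tensor stands on the side where its legs simply come out of the
  functional. On the other side, treated in \<open>pq_RD_LD\<close>, two legs meet across \<alpha>
  or \<beta> and collapse.\<close>

lemma legs3:
  assumes r: "r \<in> carrier H2" and x: "x \<in> carrier H3" and b: "b \<in> carrier H"
  shows "P3 (lassoc K H H H r b \<cdot>\<^sub>3 x) = r \<cdot>\<^sub>2 P3 x \<cdot>\<^sub>2 e2 \<one>\<^sub>H (S b)"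
    and "Q3 (x \<cdot>\<^sub>3 etens K H H2 b r) = e2 (S b) \<one>\<^sub>H \<cdot>\<^sub>2 Q3 x \<cdot>\<^sub>2 r"
    and "P3' (etens K H H2 b r \<cdot>\<^sub>3 x) = e2 \<one>\<^sub>H b \<cdot>\<^sub>2 P3' x \<cdot>\<^sub>2 SS r"
    and "Q3' (x \<cdot>\<^sub>3 lassoc K H H H r b) = SS r \<cdot>\<^sub>2 Q3' x \<cdot>\<^sub>2 e2 b \<one>\<^sub>H"
  by (rule tens_eqI[OF r, where X = H2]; (rule tens3_eqI[OF x, where X = H2])?; simp add: b x nf)+

lemma absorb3:
  assumes r: "r \<in> carrier H2" and "a \<in> carrier H" "b \<in> carrier H" "c \<in> carrier H"
  shows "P3 (etens K H H2 a (e2 b c \<cdot>\<^sub>2 r)) = e2 a (b \<cdot> BE r \<cdot> S c)"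
    and "Q3 (lassoc K H H H (r \<cdot>\<^sub>2 e2 a b) c) = e2 (S a \<cdot> AL r \<cdot> b) c"
    and "P3' (lassoc K H H H (e2 a b \<cdot>\<^sub>2 r) c) = e2 (S c) (a \<cdot> BE r \<cdot> S b)"
    and "Q3' (etens K H H2 a (r \<cdot>\<^sub>2 e2 b c)) = e2 (S b \<cdot> AL r \<cdot> c) (S a)"
  by (rule tens_eqI[OF r, where X = H2]; simp add: assms nf)+

lemma lassoc_mult_e3:
  assumes "r \<in> carrier H2" "a \<in> carrier H" "b \<in> carrier H" "c \<in> carrier H" "d \<in> carrier H"
  shows "lassoc K H H H r d \<cdot>\<^sub>3 e3 a b c = lassoc K H H H (r \<cdot>\<^sub>2 e2 a b) (d \<cdot> c)"
    and "e3 a b c \<cdot>\<^sub>3 lassoc K H H H r d = lassoc K H H H (e2 a b \<cdot>\<^sub>2 r) (c \<cdot> d)"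
  using lassoc_mult[of H H H r "e2 a b" d c] lassoc_mult[of H H H "e2 a b" r c d] assms by simp_all

lemma pq_RD_LD:
  assumes r: "r \<in> carrier H2" and x: "x \<in> carrier H3"
  shows "P3 (x \<cdot>\<^sub>3 RD r) = P3 x \<cdot>\<^sub>2 e2 (rcontr \<epsilon> H r) \<one>\<^sub>H"
    and "Q3 (LD r \<cdot>\<^sub>3 x) = e2 \<one>\<^sub>H (lcontr \<epsilon> H r) \<cdot>\<^sub>2 Q3 x"
    and "P3' (x \<cdot>\<^sub>3 LD r) = e2 (S (lcontr \<epsilon> H r)) \<one>\<^sub>H \<cdot>\<^sub>2 P3' x"
    and "Q3' (RD r \<cdot>\<^sub>3 x) = Q3' x \<cdot>\<^sub>2 e2 \<one>\<^sub>H (S (rcontr \<epsilon> H r))"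
  by (rule tens_eqI[OF r, where X = H2]; (rule tens3_eqI[OF x, where X = H2])?;
      simp add: x absorb3 lassoc_mult_e3 etens_smult klin_smult[OF antipode_simps(3)])+

text \<open>The Hausser-Nill relations. Each left side is a value of \<open>P3\<close>,
  \<open>Q3\<close>, \<open>P3'\<close> or \<open>Q3'\<close> on a reassociator times an iterated
  coproduct. Quasi-coassociativity moves that coproduct across the reassociator, where \<alpha> or
  \<beta> swallows two of its three legs.\<close>

lemma pq_comult [simp]:
  assumes h: "h \<in> carrier H"
  shows "Pp (\<Delta> h) = p \<cdot>\<^sub>2 e2 h \<one>\<^sub>H" (is ?g1) "Qq (\<Delta> h) = e2 \<one>\<^sub>H h \<cdot>\<^sub>2 q" (is ?g2)
    "Pp' (\<Delta> h) = e2 (S h) \<one>\<^sub>H \<cdot>\<^sub>2 p'" (is ?g3) "Qq' (\<Delta> h) = q' \<cdot>\<^sub>2 e2 \<one>\<^sub>H (S h)" (is ?g4)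
proof -
  have *: "Pp r = P3 (LD r \<cdot>\<^sub>3 \<Phi>i)" "Qq r = Q3 (\<Phi>i \<cdot>\<^sub>3 RD r)" "Pp' r = P3' (RD r \<cdot>\<^sub>3 \<Phi>)" "Qq' r = Q3' (\<Phi> \<cdot>\<^sub>3 LD r)"
    if "r \<in> carrier H2" for r
    by (rule tens_eqI[OF that, where X = H2]; simp add: legs3)+
  show ?g1 ?g4
    using h by (simp_all add: * pq_RD_LD flip: coassoc_left coassoc_right)
  show ?g2 ?g3
    using h by (simp_all add: * pq_RD_LD coassoc_left coassoc_right)
qed

text \<open>
  In each of these functionals a coproduct in two legs joined by \<open>S(_) \<alpha> _\<close> or \<open>_ \<beta> S(_)\<close> collapses to a counit.
  Evaluated on the two sides of a rearranged pentagon they lose all but one of the factors on one side.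
\<close>

definition "LA = tsum4 H2 (\<lambda>a b c d. e2 a (b \<cdot> \<beta> \<cdot> S c \<cdot> \<alpha> \<cdot> d))"
definition "LB = tsum4 H2 (\<lambda>a b c d. e2 (a \<cdot> \<beta> \<cdot> S b \<cdot> \<alpha> \<cdot> c) d)"
definition "LC = tsum4 H2 (\<lambda>a b c d. e2 (S b \<cdot> \<alpha> \<cdot> c \<cdot> \<beta> \<cdot> S d) (S a))"
definition "LE = tsum4 H2 (\<lambda>a b c d. e2 (S d) (S a \<cdot> \<alpha> \<cdot> b \<cdot> \<beta> \<cdot> S c))"
definition "LG = tsum4 H2 (\<lambda>a b c d. e2 (S b \<cdot> \<alpha> \<cdot> c) (S a \<cdot> \<alpha> \<cdot> d))"
definition "LF = tsum4 H2 (\<lambda>a b c d. e2 (a \<cdot> \<beta> \<cdot> S d) (b \<cdot> \<beta> \<cdot> S c))"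
definition "LN = tsum4 H2 (\<lambda>a b c d. \<Delta> a \<cdot>\<^sub>2 p \<cdot>\<^sub>2 e2 (\<beta> \<cdot> S c) (S b \<cdot> \<alpha>) \<cdot>\<^sub>2 q \<cdot>\<^sub>2 \<Delta> d)"
definition "LN' = tsum4 H2 (\<lambda>a b c d. gg a \<cdot>\<^sub>2 q' \<cdot>\<^sub>2 e2 (b \<cdot> \<beta>) (\<alpha> \<cdot> c) \<cdot>\<^sub>2 p' \<cdot>\<^sub>2 gg d)"

lemma L_klin [simp]:
  "klin K H4 H2 LA" "klin K H4 H2 LB" "klin K H4 H2 LC" "klin K H4 H2 LE" "klin K H4 H2 LG" "klin K H4 H2 LF"
  "klin K H4 H2 LN" "klin K H4 H2 LN'"
  unfolding LA_def LB_def LC_def LE_def LG_def LF_def LN_def LN'_def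
  by (auto intro!: tsum4_etens(2))

lemmas L_klin_comp [simp] = L_klin[THEN klin_comp]

lemma L_pure [simp]:
  assumes "a \<in> carrier H" "b \<in> carrier H" "c \<in> carrier H" "d \<in> carrier H"
  shows "LA (e4 a b c d) = e2 a (b \<cdot> \<beta> \<cdot> S c \<cdot> \<alpha> \<cdot> d)"
    "LB (e4 a b c d) = e2 (a \<cdot> \<beta> \<cdot> S b \<cdot> \<alpha> \<cdot> c) d"
    "LC (e4 a b c d) = e2 (S b \<cdot> \<alpha> \<cdot> c \<cdot> \<beta> \<cdot> S d) (S a)"
    "LE (e4 a b c d) = e2 (S d) (S a \<cdot> \<alpha> \<cdot> b \<cdot> \<beta> \<cdot> S c)"
    "LG (e4 a b c d) = e2 (S b \<cdot> \<alpha> \<cdot> c) (S a \<cdot> \<alpha> \<cdot> d)"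
    "LF (e4 a b c d) = e2 (a \<cdot> \<beta> \<cdot> S d) (b \<cdot> \<beta> \<cdot> S c)"
    "LN (e4 a b c d) = \<Delta> a \<cdot>\<^sub>2 p \<cdot>\<^sub>2 e2 (\<beta> \<cdot> S c) (S b \<cdot> \<alpha>) \<cdot>\<^sub>2 q \<cdot>\<^sub>2 \<Delta> d"
    "LN' (e4 a b c d) = gg a \<cdot>\<^sub>2 q' \<cdot>\<^sub>2 e2 (b \<cdot> \<beta>) (\<alpha> \<cdot> c) \<cdot>\<^sub>2 p' \<cdot>\<^sub>2 gg d"
  unfolding LA_def LB_def LC_def LE_def LG_def LF_def LN_def LN'_def
  using assms by (simp_all add: tsum4_etens)

definition "B1 = tsum3 H2 (\<lambda>a b c. \<Delta> a \<cdot>\<^sub>2 p \<cdot>\<^sub>2 e2 \<one>\<^sub>H (S b \<cdot> \<alpha> \<cdot> c))"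
definition "B2 = tsum3 H2 (\<lambda>a b c. e2 (a \<cdot> \<beta> \<cdot> S b) \<one>\<^sub>H \<cdot>\<^sub>2 q \<cdot>\<^sub>2 \<Delta> c)"
definition "B3 = tsum3 H2 (\<lambda>a b c. gg a \<cdot>\<^sub>2 q' \<cdot>\<^sub>2 e2 (b \<cdot> \<beta> \<cdot> S c) \<one>\<^sub>H)"
definition "B4 = tsum3 H2 (\<lambda>a b c. e2 \<one>\<^sub>H (S a \<cdot> \<alpha> \<cdot> b) \<cdot>\<^sub>2 p' \<cdot>\<^sub>2 gg c)"
definition "C3 = tsum3 H2 (\<lambda>a b c. e2 (S b) (S a \<cdot> \<alpha>) \<cdot>\<^sub>2 q \<cdot>\<^sub>2 \<Delta> c)"
definition "C3' = tsum3 H2 (\<lambda>a b c. gg a \<cdot>\<^sub>2 q' \<cdot>\<^sub>2 e2 b (\<alpha> \<cdot> c))"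
definition "D3 = tsum3 H2 (\<lambda>a b c. \<Delta> a \<cdot>\<^sub>2 p \<cdot>\<^sub>2 e2 (\<beta> \<cdot> S c) (S b))"
definition "D3' = tsum3 H2 (\<lambda>a b c. e2 (a \<cdot> \<beta>) b \<cdot>\<^sub>2 p' \<cdot>\<^sub>2 gg c)"

lemma B_klin [simp]:
  "klin K H3 H2 B1" "klin K H3 H2 B2" "klin K H3 H2 B3" "klin K H3 H2 B4"
  "klin K H3 H2 C3" "klin K H3 H2 C3'" "klin K H3 H2 D3" "klin K H3 H2 D3'"
  unfolding B1_def B2_def B3_def B4_def C3_def C3'_def D3_def D3'_def
  by (auto intro!: tsum3_etens(2))

lemmas B_closed [simp] = B_klin[THEN klin_closed]
lemmas B_klin_comp [simp] = B_klin[THEN klin_comp]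

lemma B_pure [simp]:
  assumes "a \<in> carrier H" "b \<in> carrier H" "c \<in> carrier H"
  shows "B1 (e3 a b c) = \<Delta> a \<cdot>\<^sub>2 p \<cdot>\<^sub>2 e2 \<one>\<^sub>H (S b \<cdot> \<alpha> \<cdot> c)"
    "B2 (e3 a b c) = e2 (a \<cdot> \<beta> \<cdot> S b) \<one>\<^sub>H \<cdot>\<^sub>2 q \<cdot>\<^sub>2 \<Delta> c"
    "B3 (e3 a b c) = gg a \<cdot>\<^sub>2 q' \<cdot>\<^sub>2 e2 (b \<cdot> \<beta> \<cdot> S c) \<one>\<^sub>H"
    "B4 (e3 a b c) = e2 \<one>\<^sub>H (S a \<cdot> \<alpha> \<cdot> b) \<cdot>\<^sub>2 p' \<cdot>\<^sub>2 gg c"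
    "C3 (e3 a b c) = e2 (S b) (S a \<cdot> \<alpha>) \<cdot>\<^sub>2 q \<cdot>\<^sub>2 \<Delta> c"
    "C3' (e3 a b c) = gg a \<cdot>\<^sub>2 q' \<cdot>\<^sub>2 e2 b (\<alpha> \<cdot> c)"
    "D3 (e3 a b c) = \<Delta> a \<cdot>\<^sub>2 p \<cdot>\<^sub>2 e2 (\<beta> \<cdot> S c) (S b)"
    "D3' (e3 a b c) = e2 (a \<cdot> \<beta>) b \<cdot>\<^sub>2 p' \<cdot>\<^sub>2 gg c"
  unfolding B1_def B2_def B3_def B4_def C3_def C3'_def D3_def D3'_def
  using assms by (simp_all add: tsum3_etens)

lemma L_absorb:
  assumes r: "r \<in> carrier H2" and "a \<in> carrier H" "b \<in> carrier H" "c \<in> carrier H" "d \<in> carrier H"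
  shows "LA (etens K H H3 a (etens K H H2 b (r \<cdot>\<^sub>2 e2 c d))) = e2 a (b \<cdot> \<beta> \<cdot> S c \<cdot> AL r \<cdot> d)"
    "LA (etens K H H3 a (lassoc K H H H (e2 b c \<cdot>\<^sub>2 r) d)) = e2 a (b \<cdot> BE r \<cdot> S c \<cdot> \<alpha> \<cdot> d)"
    "LB (etens K H H3 a (lassoc K H H H (r \<cdot>\<^sub>2 e2 b c) d)) = e2 (a \<cdot> \<beta> \<cdot> S b \<cdot> AL r \<cdot> c) d"
    "LB (lassoc K H H H2 (e2 a b \<cdot>\<^sub>2 r) (e2 c d)) = e2 (a \<cdot> BE r \<cdot> S b \<cdot> \<alpha> \<cdot> c) d"
    "LC (etens K H H3 a (lassoc K H H H (r \<cdot>\<^sub>2 e2 b c) d)) = e2 (S b \<cdot> AL r \<cdot> c \<cdot> \<beta> \<cdot> S d) (S a)"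
    "LC (etens K H H3 a (etens K H H2 b (e2 c d \<cdot>\<^sub>2 r))) = e2 (S b \<cdot> \<alpha> \<cdot> c \<cdot> BE r \<cdot> S d) (S a)"
    "LE (lassoc K H H H2 (r \<cdot>\<^sub>2 e2 a b) (e2 c d)) = e2 (S d) (S a \<cdot> AL r \<cdot> b \<cdot> \<beta> \<cdot> S c)"
    "LE (etens K H H3 a (lassoc K H H H (e2 b c \<cdot>\<^sub>2 r) d)) = e2 (S d) (S a \<cdot> \<alpha> \<cdot> b \<cdot> BE r \<cdot> S c)"
    "LG (etens K H H3 a (lassoc K H H H (r \<cdot>\<^sub>2 e2 b c) d)) = e2 (S b \<cdot> AL r \<cdot> c) (S a \<cdot> \<alpha> \<cdot> d)"
    "LF (etens K H H3 a (lassoc K H H H (e2 b c \<cdot>\<^sub>2 r) d)) = e2 (a \<cdot> \<beta> \<cdot> S d) (b \<cdot> BE r \<cdot> S c)"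
  by (rule tens_eqI[OF r, where X = H2]; simp add: assms nf)+

lemma L_legs:
  assumes bc: "b \<in> carrier H" "c \<in> carrier H" and r: "r \<in> carrier H2" and y: "y \<in> carrier H3"
  shows "LA (lassoc K H H H2 r (e2 b c) \<cdot>\<^sub>4 P1 y) = r \<cdot>\<^sub>2 P3 y \<cdot>\<^sub>2 e2 \<one>\<^sub>H (S b \<cdot> \<alpha> \<cdot> c)"
    and "LF (lassoc K H H H2 r (e2 b c) \<cdot>\<^sub>4 P1 y) = r \<cdot>\<^sub>2 P3 y \<cdot>\<^sub>2 e2 (\<beta> \<cdot> S c) (S b)"
    and "LC (P1 y \<cdot>\<^sub>4 lassoc K H H H2 r (e2 b c)) = SS r \<cdot>\<^sub>2 Q3' y \<cdot>\<^sub>2 e2 (b \<cdot> \<beta> \<cdot> S c) \<one>\<^sub>H"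
    and "LG (P1 y \<cdot>\<^sub>4 lassoc K H H H2 r (e2 b c)) = SS r \<cdot>\<^sub>2 Q3' y \<cdot>\<^sub>2 e2 b (\<alpha> \<cdot> c)"
    and "LB (P4 y \<cdot>\<^sub>4 etens K H H3 b (etens K H H2 c r)) = e2 (b \<cdot> \<beta> \<cdot> S c) \<one>\<^sub>H \<cdot>\<^sub>2 Q3 y \<cdot>\<^sub>2 r"
    and "LG (P4 y \<cdot>\<^sub>4 etens K H H3 b (etens K H H2 c r)) = e2 (S c) (S b \<cdot> \<alpha>) \<cdot>\<^sub>2 Q3 y \<cdot>\<^sub>2 r"
    and "LE (etens K H H3 b (etens K H H2 c r) \<cdot>\<^sub>4 P4 y) = e2 \<one>\<^sub>H (S b \<cdot> \<alpha> \<cdot> c) \<cdot>\<^sub>2 P3' y \<cdot>\<^sub>2 SS r"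
    and "LF (etens K H H3 b (etens K H H2 c r) \<cdot>\<^sub>4 P4 y) = e2 (b \<cdot> \<beta>) c \<cdot>\<^sub>2 P3' y \<cdot>\<^sub>2 SS r"
  by (rule tens_eqI[OF r, where X = H2]; (rule tens3_eqI[OF y, where X = H2])?; simp add: bc y nf)+

text \<open>The element p, q, p' or q' inside each bracket hides a second reassociator. Written out,
  it exhibits a product of two of the five factors of the pentagon, so that the rearranged pentagons
  apply.\<close>

lemma bracket_as_L:
  assumes x: "x \<in> carrier H3"
  shows "LA (PL x \<cdot>\<^sub>4 P1 \<Phi>i) = B1 x" "LF (PL x \<cdot>\<^sub>4 P1 \<Phi>i) = D3 x"
    "LC (P1 \<Phi> \<cdot>\<^sub>4 PL x) = B3 x" "LG (P1 \<Phi> \<cdot>\<^sub>4 PL x) = C3' x"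
    "LB (P4 \<Phi>i \<cdot>\<^sub>4 PR x) = B2 x" "LG (P4 \<Phi>i \<cdot>\<^sub>4 PR x) = C3 x"
    "LE (PR x \<cdot>\<^sub>4 P4 \<Phi>) = B4 x" "LF (PR x \<cdot>\<^sub>4 P4 \<Phi>) = D3' x"
  by (rule tens3_eqI[OF x, where X = H2]; simp add: L_legs del: etens_mult)+

definition "Z3 = tsum3 H (\<lambda>a b c. a \<cdot> \<beta> \<cdot> S b \<cdot> \<alpha> \<cdot> c)"
definition "Z3' = tsum3 H (\<lambda>a b c. S a \<cdot> \<alpha> \<cdot> b \<cdot> \<beta> \<cdot> S c)"

lemma Z_simps [simp]:
  "klin K H3 H Z3" "klin K H3 H Z3'" "Z3 \<Phi> = \<one>\<^sub>H" "Z3' \<Phi>i = \<one>\<^sub>H"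
  "\<lbrakk> a \<in> carrier H; b \<in> carrier H; c \<in> carrier H \<rbrakk> \<Longrightarrow> Z3 (e3 a b c) = a \<cdot> \<beta> \<cdot> S b \<cdot> \<alpha> \<cdot> c"
  "\<lbrakk> a \<in> carrier H; b \<in> carrier H; c \<in> carrier H \<rbrakk> \<Longrightarrow> Z3' (e3 a b c) = S a \<cdot> \<alpha> \<cdot> b \<cdot> \<beta> \<cdot> S c"
  unfolding Z3_def Z3'_def using antipode_reassoc antipode_inv_reassoc
  by (auto intro!: tsum3_etens)

text \<open>The Hausser-Nill inversion relations; the first is \<Delta>(q_R^1) p_R (1 \<otimes>
  S(q_R^2)) = 1 \<otimes> 1. In each rearranged pentagon the functional swallows the two
  comultiplied factors on the right side. What remains is a single \<open>P1\<close> or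
  \<open>P4\<close>, on which the functional is one of the two antipode axioms for the
  reassociator.\<close>

lemma brackets [simp]:
  "B1 \<Phi> = \<one>\<^bsub>H2\<^esub>" (is ?g1) "B2 \<Phi> = \<one>\<^bsub>H2\<^esub>" (is ?g2) "B3 \<Phi>i = \<one>\<^bsub>H2\<^esub>" (is ?g3) "B4 \<Phi>i = \<one>\<^bsub>H2\<^esub>" (is ?g4)
proof -
  have "LA (P4 x) = e2 \<one>\<^sub>H (Z3 x)" "LB (P1 x) = e2 (Z3 x) \<one>\<^sub>H"
    "LC (P4 x) = e2 (Z3' x) \<one>\<^sub>H" "LE (P1 x) = e2 \<one>\<^sub>H (Z3' x)" if "x \<in> carrier H3" for x
    by (rule tens3_eqI[OF that, where X = H2]; simp)+
  then have 1: "LA (P4 \<Phi>) = \<one>\<^bsub>H2\<^esub>" "LB (P1 \<Phi>) = \<one>\<^bsub>H2\<^esub>" "LC (P4 \<Phi>i) = \<one>\<^bsub>H2\<^esub>" "LE (P1 \<Phi>i) = \<one>\<^bsub>H2\<^esub>"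
    by (simp_all add: tens_one_def')
  show ?g1
    unfolding bracket_as_L(1)[OF reassoc_closed(1), symmetric] pentagon_form(1)
    using 1 by (simp add: contract_left_34[where X = H2] contract_right_23[where X = H2] L_absorb etens_smult reassoc_normal)
  show ?g2
    unfolding bracket_as_L(5)[OF reassoc_closed(1), symmetric] pentagon_form(2)
    using 1 by (simp add: contract_left_23[where X = H2] contract_right_12[where X = H2] L_absorb etens_smult reassoc_normal)
  show ?g3
    unfolding bracket_as_L(3)[OF reassoc_closed(2), symmetric] pentagon_form(3)
    using 1 by (simp add: contract_left_23[where X = H2] contract_right_34[where X = H2] L_absorb etens_smult reassoc_normal)
  show ?g4
    unfolding bracket_as_L(7)[OF reassoc_closed(2), symmetric] pentagon_form(4)
    using 1 by (simp add: contract_left_12[where X = H2] contract_right_23[where X = H2] L_absorb etens_smult reassoc_normal)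
qed

section \<open>Drinfeld's elements \<gamma> and \<delta>\<close>

definition "\<gamma> = C3 \<Phi>"
text \<open>Drinfeld's companion of \<gamma>, from which the inverse of f is built. It is unrelated
  to the two-sided coactions \<open>\<delta>l\<close> and \<open>\<delta>r\<close>.\<close>

definition "\<delta> = D3 \<Phi>"

lemma gamma_delta_closed [simp]: "\<gamma> \<in> carrier H2" "\<delta> \<in> carrier H2"
  by (simp_all add: \<gamma>_def \<delta>_def)

text \<open>\<open>LG\<close> joins legs 2 and 3 by S(_) \<alpha> _ and so swallows the factor
  \<open>PM \<Phi>i\<close> of the third rearranged pentagon; its values on the remaining products
  on both sides are the two expressions. This second one is the \<gamma> in the definition of the
  twist.\<close>

lemma gamma_alt: "\<gamma> = C3' \<Phi>i"
  unfolding \<gamma>_def bracket_as_L(6)[OF reassoc_closed(1), symmetric] bracket_as_L(4)[OF reassoc_closed(2), symmetric]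
    pentagon_form(3)
  by (simp add: contract_left_23[where X = H2] L_absorb etens_smult reassoc_normal)

text \<open>As for \<gamma>, now with \<open>LF\<close>: its legs 2 and 3 are joined by _ \<beta>
  S(_), which swallows \<open>PM \<Phi>\<close> from the right.\<close>

lemma delta_alt: "\<delta> = D3' \<Phi>i"
  unfolding \<delta>_def bracket_as_L(2)[OF reassoc_closed(1), symmetric] bracket_as_L(8)[OF reassoc_closed(2), symmetric]
    pentagon_form(1)
  by (simp add: alg_assoc[symmetric] contract_right_23[where X = H2] L_absorb etens_smult reassoc_normal)

lemma twist_gamma_eq: "twist_gamma K H = \<gamma>"
  unfolding gamma_alt bracket_as_L(4)[OF reassoc_closed(2), symmetric]
  by (simp add: twist_gamma_def twist_A_def LG_def)

text \<open>
  \<open>(gg, \<gamma>, \<delta>)\<close> satisfies the antipode axioms relative to \<open>\<Delta>\<close>: these are the values of \<open>G1\<close>, \<open>G2\<close> on coproducts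
  and of \<open>Y3\<close>, \<open>Y3'\<close> on the reassociator below.
\<close>

definition "G1 = tsum2 H2 (\<lambda>a b. gg a \<cdot>\<^sub>2 \<gamma> \<cdot>\<^sub>2 \<Delta> b)"
definition "G2 = tsum2 H2 (\<lambda>a b. \<Delta> a \<cdot>\<^sub>2 \<delta> \<cdot>\<^sub>2 gg b)"

lemma G_simps [simp]:
  "klin K H2 H2 G1" "klin K H2 H2 G2"
  "\<lbrakk> a \<in> carrier H; b \<in> carrier H \<rbrakk> \<Longrightarrow> G1 (e2 a b) = gg a \<cdot>\<^sub>2 \<gamma> \<cdot>\<^sub>2 \<Delta> b"
  "\<lbrakk> a \<in> carrier H; b \<in> carrier H \<rbrakk> \<Longrightarrow> G2 (e2 a b) = \<Delta> a \<cdot>\<^sub>2 \<delta> \<cdot>\<^sub>2 gg b"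
  unfolding G1_def G2_def by (simp_all add: klin_tsum2 tsum2_etens)

lemma gamma_delta_legs:
  assumes r: "r \<in> carrier H2" and x: "x \<in> carrier H3" and b: "b \<in> carrier H"
  shows "C3 (x \<cdot>\<^sub>3 lassoc K H H H r b) = SS r \<cdot>\<^sub>2 C3 x \<cdot>\<^sub>2 \<Delta> b"
    and "D3 (etens K H H2 b r \<cdot>\<^sub>3 x) = \<Delta> b \<cdot>\<^sub>2 D3 x \<cdot>\<^sub>2 SS r"
  by (rule tens_eqI[OF r, where X = H2]; (rule tens3_eqI[OF x, where X = H2])?; simp add: b x nf)+

lemma gamma_delta_absorb:
  assumes r: "r \<in> carrier H2" and x: "a \<in> carrier H" "x \<in> carrier H" "y \<in> carrier H" "z \<in> carrier H"
  shows "C3 (etens K H H2 a (r \<cdot>\<^sub>2 e2 y z)) = e2 (S y) (S a \<cdot> \<alpha>) \<cdot>\<^sub>2 Qq r \<cdot>\<^sub>2 \<Delta> z"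
    and "D3 (lassoc K H H H (e2 x y \<cdot>\<^sub>2 r) z) = \<Delta> x \<cdot>\<^sub>2 Pp r \<cdot>\<^sub>2 e2 (\<beta> \<cdot> S z) (S y)"
  by (rule tens_eqI[OF r, where X = H2]; simp add: x nf)+

lemma gamma_delta_RD_LD:
  assumes r: "r \<in> carrier H2" and x: "x \<in> carrier H" "y \<in> carrier H" "z \<in> carrier H"
  shows "C3 (RD r \<cdot>\<^sub>3 e3 x y z) = e2 (S y) (S x \<cdot> AL r) \<cdot>\<^sub>2 q \<cdot>\<^sub>2 \<Delta> z"
    and "D3 (e3 x y z \<cdot>\<^sub>3 LD r) = \<Delta> x \<cdot>\<^sub>2 p \<cdot>\<^sub>2 e2 (BE r \<cdot> S z) (S y)"
  by (rule tens_eqI[OF r, where X = H2]; simp add: x gamma_delta_absorb lassoc_mult_e3 nf)+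

text \<open>Two collapses in a row. Quasi-coassociativity moves the iterated coproduct across
  \<open>\<Phi>\<close>. Its comultiplied leg then passes through q or p by \<open>pq_comult\<close>
  and comes out as a single leg, which meets the other one across \<alpha> or \<beta>.\<close>

lemma G_comult [simp]:
  assumes h: "h \<in> carrier H"
  shows "G1 (\<Delta> h) = \<epsilon> h \<odot>\<^bsub>H2\<^esub> \<gamma>" (is ?g1) and "G2 (\<Delta> h) = \<epsilon> h \<odot>\<^bsub>H2\<^esub> \<delta>" (is ?g2)
proof -
  have 1: "G1 r = C3 (\<Phi> \<cdot>\<^sub>3 LD r)" "G2 r = D3 (RD r \<cdot>\<^sub>3 \<Phi>)" if "r \<in> carrier H2" for r
    by (rule tens_eqI[OF that, where X = H2]; simp add: gamma_delta_legs \<gamma>_def \<delta>_def)+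
  have 2: "C3 (RD (\<Delta> h) \<cdot>\<^sub>3 x) = \<epsilon> h \<odot>\<^bsub>H2\<^esub> C3 x" "D3 (x \<cdot>\<^sub>3 LD (\<Delta> h)) = \<epsilon> h \<odot>\<^bsub>H2\<^esub> D3 x"
    if "x \<in> carrier H3" for x
    by (rule tens3_eqI[OF that, where X = H2]; simp add: h gamma_delta_RD_LD etens_smult)+
  show ?g1 using h 2(1)[of \<Phi>] by (simp add: 1 coassoc_left[symmetric] \<gamma>_def)
  show ?g2 using h 2(2)[of \<Phi>] by (simp add: 1 coassoc_left \<delta>_def)
qed

definition "Y3 = tsum3 H2 (\<lambda>a b c. \<Delta> a \<cdot>\<^sub>2 \<delta> \<cdot>\<^sub>2 gg b \<cdot>\<^sub>2 \<gamma> \<cdot>\<^sub>2 \<Delta> c)"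
definition "Y3' = tsum3 H2 (\<lambda>a b c. gg a \<cdot>\<^sub>2 \<gamma> \<cdot>\<^sub>2 \<Delta> b \<cdot>\<^sub>2 \<delta> \<cdot>\<^sub>2 gg c)"

lemma Y_simps [simp]:
  "klin K H3 H2 Y3" "klin K H3 H2 Y3'"
  "\<lbrakk> a \<in> carrier H; b \<in> carrier H; c \<in> carrier H \<rbrakk> \<Longrightarrow> Y3 (e3 a b c) = \<Delta> a \<cdot>\<^sub>2 \<delta> \<cdot>\<^sub>2 gg b \<cdot>\<^sub>2 \<gamma> \<cdot>\<^sub>2 \<Delta> c"
  "\<lbrakk> a \<in> carrier H; b \<in> carrier H; c \<in> carrier H \<rbrakk> \<Longrightarrow> Y3' (e3 a b c) = gg a \<cdot>\<^sub>2 \<gamma> \<cdot>\<^sub>2 \<Delta> b \<cdot>\<^sub>2 \<delta> \<cdot>\<^sub>2 gg c"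
  unfolding Y3_def Y3'_def by (simp_all add: tsum3_etens)

text \<open>Writing out both \<delta> and \<gamma> contributes two further reassociators, and these
  frame the middle tensor exactly as \<open>P4\<close> and \<open>P1\<close> frame \<open>PM\<close>
  in the pentagon or its inverse.\<close>

lemma LN_expand:
  assumes ac: "a \<in> carrier H" "c \<in> carrier H" and r: "r \<in> carrier H2" and y: "y \<in> carrier H3" and z: "z \<in> carrier H3"
  shows "\<Delta> a \<cdot>\<^sub>2 D3 y \<cdot>\<^sub>2 SS r \<cdot>\<^sub>2 C3 z \<cdot>\<^sub>2 \<Delta> c = LN (P4 z \<cdot>\<^sub>4 (etens K H H3 a (lassoc K H H H r c) \<cdot>\<^sub>4 P1 y))"
    and "gg a \<cdot>\<^sub>2 C3' y \<cdot>\<^sub>2 r \<cdot>\<^sub>2 D3' z \<cdot>\<^sub>2 gg c = LN' (P1 y \<cdot>\<^sub>4 (etens K H H3 a (lassoc K H H H r c) \<cdot>\<^sub>4 P4 z))"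
  by (rule tens_eqI[OF r, where X = H2]; (rule tens3_eqI[OF y, where X = H2])?; (rule tens3_eqI[OF z, where X = H2])?;
      simp add: ac y z nf)+

lemma LN_split:
  assumes vw: "v1 \<in> carrier H" "v2 \<in> carrier H" "w2 \<in> carrier H" "w3 \<in> carrier H"
    and r: "r \<in> carrier H2" and s: "s \<in> carrier H2"
  shows "LN (etens K H H3 v1 (etens K H H2 v2 s) \<cdot>\<^sub>4 lassoc K H H H2 r (e2 w2 w3)) =
      \<Delta> v1 \<cdot>\<^sub>2 Pp r \<cdot>\<^sub>2 e2 (\<beta> \<cdot> S w2) (S v2 \<cdot> \<alpha>) \<cdot>\<^sub>2 Qq s \<cdot>\<^sub>2 \<Delta> w3"
    and "LN' (lassoc K H H H2 r (e2 w2 w3) \<cdot>\<^sub>4 etens K H H3 v1 (etens K H H2 v2 s)) =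
      gg v1 \<cdot>\<^sub>2 Qq' r \<cdot>\<^sub>2 e2 (v2 \<cdot> \<beta>) (\<alpha> \<cdot> w2) \<cdot>\<^sub>2 Pp' s \<cdot>\<^sub>2 gg w3"
  by (rule tens_eqI[OF r, where X = H2]; (rule tens_eqI[OF s, where X = H2])?; simp add: vw s nf)+

text \<open>On the other side of the pentagon the functional factorises: \<open>pq_comult\<close>
  lets each comultiplied leg slip through p or q, after which the legs of \<open>v\<close> and those
  of \<open>w\<close> sit in different tensor factors and can be sorted apart.\<close>

lemma LN_PR_PL:
  assumes v: "v \<in> carrier H3" and w: "w \<in> carrier H3"
  shows "LN (PR v \<cdot>\<^sub>4 PL w) = B1 v \<cdot>\<^sub>2 B2 w" and "LN' (PL w \<cdot>\<^sub>4 PR v) = B3 v \<cdot>\<^sub>2 B4 w"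
  by (rule tens3_eqI[OF v, where X = H2]; (rule tens3_eqI[OF w, where X = H2])?; simp add: w LN_split nf)+

text \<open>The pentagon trades the expanded left side for \<open>PR \<Phi>\<close> times
  \<open>PL \<Phi>\<close>, whose value is a product of two brackets, both equal to 1. The second
  claim uses the inverse pentagon in the same way.\<close>

lemma Y_reassoc [simp]: "Y3 \<Phi> = \<one>\<^bsub>H2\<^esub>" (is ?g1) "Y3' \<Phi>i = \<one>\<^bsub>H2\<^esub>" (is ?g2)
proof -
  have "Y3 x = LN (P4 \<Phi> \<cdot>\<^sub>4 (PM x \<cdot>\<^sub>4 P1 \<Phi>))" if "x \<in> carrier H3" for x
    by (rule tens3_eqI[OF that, where X = H2]) (simp_all add: \<gamma>_def \<delta>_def LN_expand(1)[symmetric] del: etens_mult)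
  then have "Y3 \<Phi> = LN (P4 \<Phi> \<cdot>\<^sub>4 PM \<Phi> \<cdot>\<^sub>4 P1 \<Phi>)" by (simp add: alg_assoc)
  also have "\<dots> = \<one>\<^bsub>H2\<^esub>" unfolding pentagon by (simp add: LN_PR_PL)
  finally show ?g1 .
  have "Y3' x = LN' (P1 \<Phi>i \<cdot>\<^sub>4 (PM x \<cdot>\<^sub>4 P4 \<Phi>i))" if "x \<in> carrier H3" for x
    by (rule tens3_eqI[OF that, where X = H2]) (simp_all add: gamma_alt delta_alt LN_expand(2)[symmetric] del: etens_mult)
  then have "Y3' \<Phi>i = LN' (P1 \<Phi>i \<cdot>\<^sub>4 (PM \<Phi>i \<cdot>\<^sub>4 P4 \<Phi>i))" by simp
  also have "\<dots> = \<one>\<^bsub>H2\<^esub>" unfolding pentagon_form(6) by (simp add: LN_PR_PL)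
  finally show ?g2 .
qed

section \<open>The twist, its inverse and its commutation rule\<close>

definition "F3 = tsum3 H2 (\<lambda>a b c. gg a \<cdot>\<^sub>2 \<gamma> \<cdot>\<^sub>2 \<Delta> (b \<cdot> \<beta> \<cdot> S c))"
text \<open>At the inverse reassociator this is Drinfeld's formula for the inverse of f, the
  comparison element in the opposite direction.\<close>

definition "F3i = tsum3 H2 (\<lambda>a b c. \<Delta> (S a \<cdot> \<alpha> \<cdot> b) \<cdot>\<^sub>2 \<delta> \<cdot>\<^sub>2 gg c)"
definition "LT = tsum4 H2 (\<lambda>a b c d. gg a \<cdot>\<^sub>2 \<gamma> \<cdot>\<^sub>2 \<Delta> (b \<cdot> \<beta> \<cdot> S c \<cdot> \<alpha> \<cdot> d))"
definition "LT' = tsum4 H2 (\<lambda>a b c d. \<Delta> (S a \<cdot> \<alpha> \<cdot> b) \<cdot>\<^sub>2 \<delta> \<cdot>\<^sub>2 gg c \<cdot>\<^sub>2 \<gamma> \<cdot>\<^sub>2 \<Delta> d)"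

lemma F_simps [simp]:
  "klin K H3 H2 F3" "klin K H3 H2 F3i" "klin K H4 H2 LT" "klin K H4 H2 LT'"
  "\<lbrakk> a \<in> carrier H; b \<in> carrier H; c \<in> carrier H \<rbrakk> \<Longrightarrow> F3 (e3 a b c) = gg a \<cdot>\<^sub>2 \<gamma> \<cdot>\<^sub>2 \<Delta> (b \<cdot> \<beta> \<cdot> S c)"
  "\<lbrakk> a \<in> carrier H; b \<in> carrier H; c \<in> carrier H \<rbrakk> \<Longrightarrow> F3i (e3 a b c) = \<Delta> (S a \<cdot> \<alpha> \<cdot> b) \<cdot>\<^sub>2 \<delta> \<cdot>\<^sub>2 gg c"
  "\<lbrakk> a \<in> carrier H; b \<in> carrier H; c \<in> carrier H; d \<in> carrier H \<rbrakk> \<Longrightarrow>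
    LT (e4 a b c d) = gg a \<cdot>\<^sub>2 \<gamma> \<cdot>\<^sub>2 \<Delta> (b \<cdot> \<beta> \<cdot> S c \<cdot> \<alpha> \<cdot> d)"
  "\<lbrakk> a \<in> carrier H; b \<in> carrier H; c \<in> carrier H; d \<in> carrier H \<rbrakk> \<Longrightarrow>
    LT' (e4 a b c d) = \<Delta> (S a \<cdot> \<alpha> \<cdot> b) \<cdot>\<^sub>2 \<delta> \<cdot>\<^sub>2 gg c \<cdot>\<^sub>2 \<gamma> \<cdot>\<^sub>2 \<Delta> d"
  unfolding F3_def F3i_def LT_def LT'_def by (simp_all add: tsum3_etens tsum4_etens)

lemmas F_closed [simp] = F_simps(1-4)[THEN klin_closed]
lemmas F_klin_comp [simp] = F_simps(1-4)[THEN klin_comp]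

abbreviation "FF \<equiv> F3 \<Phi>i"
abbreviation "FFi \<equiv> F3i \<Phi>i"

lemma drinfeld_twist_eq: "drinfeld_twist K H = FF"
  by (simp add: drinfeld_twist_def F3_def twist_gamma_eq SS_def)

lemma F_absorb:
  assumes r: "r \<in> carrier H2" and x: "a \<in> carrier H" "x \<in> carrier H" "y \<in> carrier H" "z \<in> carrier H"
  shows "F3 (etens K H H2 a (e2 y z \<cdot>\<^sub>2 r)) = gg a \<cdot>\<^sub>2 \<gamma> \<cdot>\<^sub>2 \<Delta> (y \<cdot> BE r \<cdot> S z)"
    and "F3 (lassoc K H H H (r \<cdot>\<^sub>2 e2 x y) z) = gg x \<cdot>\<^sub>2 G1 r \<cdot>\<^sub>2 \<Delta> (y \<cdot> \<beta> \<cdot> S z)"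
    and "F3i (etens K H H2 a (e2 y z \<cdot>\<^sub>2 r)) = \<Delta> (S a \<cdot> \<alpha>) \<cdot>\<^sub>2 \<Delta> y \<cdot>\<^sub>2 G2 r \<cdot>\<^sub>2 gg z"
    and "F3i (lassoc K H H H (r \<cdot>\<^sub>2 e2 x y) z) = \<Delta> (S x \<cdot> AL r \<cdot> y) \<cdot>\<^sub>2 \<delta> \<cdot>\<^sub>2 gg z"
  by (rule tens_eqI[OF r, where X = H2]; simp add: x nf)+

lemma F_RD_LD:
  assumes r: "r \<in> carrier H2" and x: "x \<in> carrier H3"
  shows "F3 (x \<cdot>\<^sub>3 RD r) = gg (rcontr \<epsilon> H r) \<cdot>\<^sub>2 F3 x" and "F3 (LD r \<cdot>\<^sub>3 x) = F3 x \<cdot>\<^sub>2 \<Delta> (S (lcontr \<epsilon> H r))"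
    and "F3i (x \<cdot>\<^sub>3 RD r) = \<Delta> (S (rcontr \<epsilon> H r)) \<cdot>\<^sub>2 F3i x" and "F3i (LD r \<cdot>\<^sub>3 x) = F3i x \<cdot>\<^sub>2 gg (lcontr \<epsilon> H r)"
  by (rule tens_eqI[OF r, where X = H2]; (rule tens3_eqI[OF x, where X = H2])?;
      simp add: x F_absorb lassoc_mult_e3 nf klin_smult[OF comult_simps(3)] klin_smult[OF antipode_simps(3)]
        klin_smult[OF functional_klin(1)])+

text \<open>Evaluate \<open>F3\<close> and \<open>F3i\<close> on the two sides of
  quasi-coassociativity for the inverse reassociator. On either side two of the three legs collapse,
  and h is left on the left or on the right of f.\<close>

lemma FF_comult:
  assumes h: "h \<in> carrier H"
  shows "FF \<cdot>\<^sub>2 \<Delta> (S h) = gg h \<cdot>\<^sub>2 FF" and "FFi \<cdot>\<^sub>2 gg h = \<Delta> (S h) \<cdot>\<^sub>2 FFi"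
  using h F_RD_LD[of "\<Delta> h" \<Phi>i] by (simp_all add: coassoc_right)

lemma LT_absorb:
  assumes r: "r \<in> carrier H2" and abcd: "a \<in> carrier H" "b \<in> carrier H" "c \<in> carrier H" "d \<in> carrier H"
  shows "LT (lassoc K H H H2 (r \<cdot>\<^sub>2 e2 a b) (e2 c d)) = gg a \<cdot>\<^sub>2 G1 r \<cdot>\<^sub>2 \<Delta> (b \<cdot> \<beta> \<cdot> S c \<cdot> \<alpha> \<cdot> d)"
    and "LT (etens K H H3 a (etens K H H2 b (r \<cdot>\<^sub>2 e2 c d))) = gg a \<cdot>\<^sub>2 \<gamma> \<cdot>\<^sub>2 \<Delta> (b \<cdot> \<beta> \<cdot> S c \<cdot> AL r \<cdot> d)"
    and "LT (etens K H H3 a (lassoc K H H H (e2 b c \<cdot>\<^sub>2 r) d)) = gg a \<cdot>\<^sub>2 \<gamma> \<cdot>\<^sub>2 \<Delta> (b \<cdot> BE r \<cdot> S c \<cdot> \<alpha> \<cdot> d)"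
    and "LT' (lassoc K H H H2 (r \<cdot>\<^sub>2 e2 a b) (e2 c d)) = \<Delta> (S a \<cdot> AL r \<cdot> b) \<cdot>\<^sub>2 \<delta> \<cdot>\<^sub>2 gg c \<cdot>\<^sub>2 \<gamma> \<cdot>\<^sub>2 \<Delta> d"
    and "LT' (etens K H H3 a (etens K H H2 b (r \<cdot>\<^sub>2 e2 c d))) = \<Delta> (S a \<cdot> \<alpha> \<cdot> b) \<cdot>\<^sub>2 \<delta> \<cdot>\<^sub>2 gg c \<cdot>\<^sub>2 G1 r \<cdot>\<^sub>2 \<Delta> d"
    and "LT' (etens K H H3 a (lassoc K H H H (e2 b c \<cdot>\<^sub>2 r) d)) = \<Delta> (S a \<cdot> \<alpha> \<cdot> b) \<cdot>\<^sub>2 G2 r \<cdot>\<^sub>2 gg c \<cdot>\<^sub>2 \<gamma> \<cdot>\<^sub>2 \<Delta> d"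
  by (rule tens_eqI[OF r, where X = H2]; simp add: abcd nf)+

text \<open>The fifth pentagon form expresses \<open>P1 \<Phi>i\<close> by four factors.
  \<open>LT\<close> and \<open>LT'\<close> swallow the three comultiplied ones, since their
  neighbouring legs are joined by the antipode axioms of one triple or the other. On the survivor
  \<open>P4 \<Phi>\<close> the functional is \<gamma> times \<Delta> of an antipode axiom,
  respectively \<Delta> \<alpha> times \<open>Y3 \<Phi>\<close>.\<close>

lemma FF_alpha: "FF \<cdot>\<^sub>2 \<Delta> \<alpha> = \<gamma>" (is ?g1) and FFi_gamma: "FFi \<cdot>\<^sub>2 \<gamma> = \<Delta> \<alpha>" (is ?g2)
proof -
  have 1: "F3 x \<cdot>\<^sub>2 \<Delta> \<alpha> = LT (P1 x)" "LT (P4 x) = \<gamma> \<cdot>\<^sub>2 \<Delta> (Z3 x)"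
    "F3i x \<cdot>\<^sub>2 \<gamma> = LT' (P1 x)" "LT' (P4 x) = \<Delta> \<alpha> \<cdot>\<^sub>2 Y3 x" if "x \<in> carrier H3" for x
    by (rule tens3_eqI[OF that, where X = H2]; simp add: nf)+
  have "LT (P1 \<Phi>i) = LT (P4 \<Phi>)" "LT' (P1 \<Phi>i) = LT' (P4 \<Phi>)"
    unfolding pentagon_form(5)
    by (simp_all add: contract_left_12[where X = H2] contract_left_34[where X = H2] contract_right_23[where X = H2]
      LT_absorb klin_smult[OF comult_simps(3)] reassoc_normal)
  then show ?g1 ?g2 using 1 by simp_all
qed

text \<open>Multiplication by f replaces \<Delta>(S a) \<Delta>(\<alpha>) by \<open>gg a\<close>
  times \<gamma>, and \<open>FFi\<close> does the reverse. Applied inside the sums for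
  \<open>FFi\<close> and f, this turns the products into \<open>Y3'\<close> and into \<Delta> of
  \<open>Z3'\<close>, both known at the inverse reassociator.\<close>

lemma FF_inverse: "FF \<cdot>\<^sub>2 FFi = \<one>\<^bsub>H2\<^esub>" (is ?g1) "FFi \<cdot>\<^sub>2 FF = \<one>\<^bsub>H2\<^esub>" (is ?g2)
proof -
  have move: "FF \<cdot>\<^sub>2 (\<Delta> (S a) \<cdot>\<^sub>2 (\<Delta> \<alpha> \<cdot>\<^sub>2 z)) = gg a \<cdot>\<^sub>2 (\<gamma> \<cdot>\<^sub>2 z)" "FFi \<cdot>\<^sub>2 (gg a \<cdot>\<^sub>2 (\<gamma> \<cdot>\<^sub>2 z)) = \<Delta> (S a) \<cdot>\<^sub>2 (\<Delta> \<alpha> \<cdot>\<^sub>2 z)"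
    if "a \<in> carrier H" "z \<in> carrier H2" for a z
  proof -
    have "FF \<cdot>\<^sub>2 \<Delta> (S a) \<cdot>\<^sub>2 \<Delta> \<alpha> = gg a \<cdot>\<^sub>2 \<gamma>" "FFi \<cdot>\<^sub>2 gg a \<cdot>\<^sub>2 \<gamma> = \<Delta> (S a) \<cdot>\<^sub>2 \<Delta> \<alpha>"
      using that by (simp_all add: FF_comult alg_assoc FF_alpha FFi_gamma)
    then show "FF \<cdot>\<^sub>2 (\<Delta> (S a) \<cdot>\<^sub>2 (\<Delta> \<alpha> \<cdot>\<^sub>2 z)) = gg a \<cdot>\<^sub>2 (\<gamma> \<cdot>\<^sub>2 z)" "FFi \<cdot>\<^sub>2 (gg a \<cdot>\<^sub>2 (\<gamma> \<cdot>\<^sub>2 z)) = \<Delta> (S a) \<cdot>\<^sub>2 (\<Delta> \<alpha> \<cdot>\<^sub>2 z)"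
      using that by (simp_all flip: alg_assoc)
  qed
  have "FF \<cdot>\<^sub>2 F3i x = Y3' x" "FFi \<cdot>\<^sub>2 F3 x = \<Delta> (Z3' x)" if "x \<in> carrier H3" for x
    by (rule tens3_eqI[OF that, where X = H2]; simp add: nf move)+
  then show ?g1 ?g2 by (simp_all add: tens_one_def')
qed

lemma drinfeld_twist_unit: "drinfeld_twist K H \<in> Units H2"
  unfolding drinfeld_twist_eq Units_def using FF_inverse by (auto intro!: bexI[of _ FFi])

lemma drinfeld_twist_comult:
  "h \<in> carrier H \<Longrightarrow> drinfeld_twist K H \<cdot>\<^sub>2 \<Delta> (S h) = gg h \<cdot>\<^sub>2 drinfeld_twist K H"
  unfolding drinfeld_twist_eq by (rule FF_comult(1))

end

section \<open>Twist equivalence of the two-sided coactions\<close>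

locale quasi_hopf_bicomodule_algebra = quasi_hopf_algebra K H + bicomodule_algebra K H B
  for K (structure) and H (structure) and B (structure)
begin

lemma assoc_algebra_B [simp]: "assoc_algebra K B"
  by (rule B.assoc_algebra_axioms)

abbreviation "HB \<equiv> H \<boxtimes> B"
abbreviation "BH \<equiv> B \<boxtimes> H"
abbreviation "BHH \<equiv> B \<boxtimes> H2"
abbreviation "HHB \<equiv> H \<boxtimes> HB"
abbreviation "R3 \<equiv> H \<boxtimes> BH"
abbreviation "R4 \<equiv> H \<boxtimes> BHH"
abbreviation "Q4 \<equiv> H \<boxtimes> R3"
abbreviation "R5 \<equiv> H \<boxtimes> R4"

abbreviation "lamB \<equiv> lcoact B"
abbreviation "rhoB \<equiv> rcoact B"
abbreviation "\<Phi>l \<equiv> lreassoc B"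
abbreviation "\<Phi>r \<equiv> rreassoc B"
abbreviation "\<Phi>ri \<equiv> inv\<^bsub>BHH\<^esub> (rreassoc B)"
abbreviation "\<U> \<equiv> lrreassoc B"
abbreviation "\<U>i \<equiv> inv\<^bsub>R3\<^esub> (lrreassoc B)"

abbreviation "lam1 \<equiv> ltens K H B H2 lamB"
abbreviation "A1 \<equiv> rtens K H R4 lam1"
abbreviation "rho1 \<equiv> ltens K B H H rhoB"
abbreviation "RB1 \<equiv> rtens K H BHH rho1"
abbreviation "A2 \<equiv> rtens K H R4 RB1"
abbreviation "RD2 \<equiv> rtens K H BHH (rtens K B H2 \<Delta>)"
abbreviation "W3 \<equiv> rtens K H R4 RD2"
abbreviation "T4 \<equiv> tens_one K H B H H"
abbreviation "T5 \<equiv> tens_one K H H B H2"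
abbreviation "rr \<equiv> rtens K H R3 (rtens K H BH rhoB)"
abbreviation "E5 \<equiv> etens K H R4 \<one>\<^sub>H"
abbreviation "E4 \<equiv> etens K H BHH \<one>\<^sub>H"

abbreviation mul5 (infixl \<open>\<cdot>\<^sub>5\<close> 70) where "x \<cdot>\<^sub>5 y \<equiv> x \<otimes>\<^bsub>R5\<^esub> y"
abbreviation mulB (infixl \<open>\<cdot>\<^sub>B\<close> 70) where "x \<cdot>\<^sub>B y \<equiv> x \<otimes>\<^bsub>B\<^esub> y"

definition "emb d = etens K H R4 \<one>\<^sub>H (tens_one K H B H H d)"
text \<open>This is id \<otimes> \<delta>_l \<otimes> id, with \<delta>_l split into its right and
  its left coaction.\<close>

definition "idl d = A1 (RB1 d)"
definition "DD d = ltens K H H BHH \<Delta> (RD2 d)"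

lemma coact_hom: "lamB \<in> alg_hom K B HB" "rhoB \<in> alg_hom K B BH"
  by (rule lam_hom, rule rho_hom)

lemma R_hom:
  "lam1 \<in> alg_hom K BHH R4" "A1 \<in> alg_hom K R4 R5" "rho1 \<in> alg_hom K BH BHH" "RB1 \<in> alg_hom K R3 R4"
  "A2 \<in> alg_hom K Q4 R5" "rtens K B H2 \<Delta> \<in> alg_hom K BH BHH" "RD2 \<in> alg_hom K R3 R4" "W3 \<in> alg_hom K Q4 R5"
  "T4 \<in> alg_hom K R3 R4" "T5 \<in> alg_hom K HHB R5"
  "rtens K H BH rhoB \<in> alg_hom K HB R3" "rr \<in> alg_hom K HHB Q4"
  "E5 \<in> alg_hom K R4 R5" "E4 \<in> alg_hom K BHH R4"
  "ltens K H B H lamB \<in> alg_hom K BH R3" "rtens K H R3 (ltens K H B H lamB) \<in> alg_hom K R3 Q4"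
  "tens_one K H H B H \<in> alg_hom K HHB Q4" "ltens K H H BH \<Delta> \<in> alg_hom K R3 Q4"
  "ltens K H H BHH \<Delta> \<in> alg_hom K R4 R5" "etens K H R3 \<one>\<^sub>H \<in> alg_hom K R3 Q4"
  by (intro tens_one_alg_hom etens_one_alg_hom rtens_alg_hom ltens_alg_hom comult_hom coact_hom assoc_algebra_tensor
      assoc_algebra_H assoc_algebra_B)+

lemma emb_hom: "emb \<in> alg_hom K R3 R5" "idl \<in> alg_hom K R3 R5" "DD \<in> alg_hom K R3 R5"
  using alg_hom_comp[OF R_hom(13) R_hom(9)] alg_hom_comp[OF R_hom(2) R_hom(4)]
    alg_hom_comp[OF R_hom(19) R_hom(7)]
  by (simp_all add: emb_def[abs_def] idl_def[abs_def] DD_def[abs_def])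

lemmas R_homs = coact_hom R_hom emb_hom
lemmas R_closed [simp] = R_homs[THEN alg_hom_closed]
lemmas R_klin [simp] = R_homs[THEN alg_hom_klin]
lemmas R_klin_comp [simp] = R_klin[THEN klin_comp]
declare rtens_etens(1) [simp] ltens_etens(1) [simp] tens_one_etens(1) [simp]

lemma BU [simp]:
  "\<U> \<in> carrier R3" "\<U>i \<in> carrier R3" "\<U> \<otimes>\<^bsub>R3\<^esub> \<U>i = \<one>\<^bsub>R3\<^esub>" "\<U>i \<otimes>\<^bsub>R3\<^esub> \<U> = \<one>\<^bsub>R3\<^esub>"
  "\<Phi>r \<in> carrier BHH" "\<Phi>ri \<in> carrier BHH" "\<Phi>r \<otimes>\<^bsub>BHH\<^esub> \<Phi>ri = \<one>\<^bsub>BHH\<^esub>" "\<Phi>ri \<otimes>\<^bsub>BHH\<^esub> \<Phi>r = \<one>\<^bsub>BHH\<^esub>"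
  "\<Phi>l \<in> carrier HHB"
  using alg_Units(1-4)[OF _ lrreassoc_unit] alg_Units(1-4)[OF _ Phi_rho_unit] alg_Units(1)[OF _ Phi_lam_unit]
  by simp_all

text \<open>Not an axiom of a bicomodule algebra but forced by the left mixed pentagon.\<close>

lemma lrreassoc_counit: "lcontr \<epsilon> BH \<U> = \<one>\<^bsub>BH\<^esub>"
proof (rule counit_left_from_pentagon[OF assoc_algebra_B coact_hom _ _ _ lrreassoc_unit lr_pentagon_left])
  show "lcontr \<epsilon> B (lamB u) = u" if "u \<in> carrier B" for u
    using lam_counit[OF that] by (simp add: lcontr_def)
  have "rtens K H B (lcontr \<epsilon> B) t = tsum3 HB (\<lambda>x1 x2 x3. etens K H B (\<epsilon> x2 \<odot>\<^bsub>H\<^esub> x1) x3) t"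
    if "t \<in> carrier HHB" for t
    by (rule tens3_eqI[OF that, where X = HB]) (simp_all add: tsum3_etens etens_smult)
  then show "rtens K H B (lcontr \<epsilon> B) \<Phi>l = \<one>\<^bsub>HB\<^esub>" using Phi_lam_counit_mid by simp
qed simp

text \<open>Both forms single out the product of \<open>T4 \<U>\<close> and
  \<open>lam1 \<Phi>ri\<close>, which is the part of \<Psi>_l built from U and the right
  reassociator.\<close>

lemma lr_pentagon_right':
  "RB1 \<U> \<otimes>\<^bsub>R4\<^esub> (T4 \<U> \<otimes>\<^bsub>R4\<^esub> lam1 \<Phi>ri) = E4 \<Phi>ri \<otimes>\<^bsub>R4\<^esub> RD2 \<U>" (is ?g1)
  "T4 \<U> \<otimes>\<^bsub>R4\<^esub> lam1 \<Phi>ri = RB1 \<U>i \<otimes>\<^bsub>R4\<^esub> (E4 \<Phi>ri \<otimes>\<^bsub>R4\<^esub> RD2 \<U>)" (is ?g2)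
proof -
  have eE: "E4 \<Phi>ri \<otimes>\<^bsub>R4\<^esub> E4 \<Phi>r = \<one>\<^bsub>R4\<^esub>" by (simp add: tens_one_def')
  have el: "lam1 \<Phi>r \<otimes>\<^bsub>R4\<^esub> lam1 \<Phi>ri = \<one>\<^bsub>R4\<^esub>"
    by (simp add: alg_hom_mult[OF R_hom(1), symmetric] alg_hom_one[OF R_hom(1)])
  have eB: "RB1 \<U>i \<otimes>\<^bsub>R4\<^esub> RB1 \<U> = \<one>\<^bsub>R4\<^esub>"
    by (simp add: alg_hom_mult[OF R_hom(4), symmetric] alg_hom_one[OF R_hom(4)])
  have "E4 \<Phi>ri \<otimes>\<^bsub>R4\<^esub> ((E4 \<Phi>r \<otimes>\<^bsub>R4\<^esub> RB1 \<U> \<otimes>\<^bsub>R4\<^esub> T4 \<U>) \<otimes>\<^bsub>R4\<^esub> lam1 \<Phi>ri)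
    = E4 \<Phi>ri \<otimes>\<^bsub>R4\<^esub> ((RD2 \<U> \<otimes>\<^bsub>R4\<^esub> lam1 \<Phi>r) \<otimes>\<^bsub>R4\<^esub> lam1 \<Phi>ri)"
    by (simp only: lr_pentagon_right)
  moreover have "E4 \<Phi>ri \<otimes>\<^bsub>R4\<^esub> ((E4 \<Phi>r \<otimes>\<^bsub>R4\<^esub> RB1 \<U> \<otimes>\<^bsub>R4\<^esub> T4 \<U>) \<otimes>\<^bsub>R4\<^esub> lam1 \<Phi>ri)
    = (E4 \<Phi>ri \<otimes>\<^bsub>R4\<^esub> E4 \<Phi>r) \<otimes>\<^bsub>R4\<^esub> (RB1 \<U> \<otimes>\<^bsub>R4\<^esub> (T4 \<U> \<otimes>\<^bsub>R4\<^esub> lam1 \<Phi>ri))"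
    by (simp add: alg_assoc del: etens_mult)
  moreover have "(RD2 \<U> \<otimes>\<^bsub>R4\<^esub> lam1 \<Phi>r) \<otimes>\<^bsub>R4\<^esub> lam1 \<Phi>ri = RD2 \<U> \<otimes>\<^bsub>R4\<^esub> (lam1 \<Phi>r \<otimes>\<^bsub>R4\<^esub> lam1 \<Phi>ri)"
    by (simp add: alg_assoc)
  ultimately show 1: ?g1
    unfolding eE el by simp
  have "(RB1 \<U>i \<otimes>\<^bsub>R4\<^esub> RB1 \<U>) \<otimes>\<^bsub>R4\<^esub> (T4 \<U> \<otimes>\<^bsub>R4\<^esub> lam1 \<Phi>ri) = RB1 \<U>i \<otimes>\<^bsub>R4\<^esub> (E4 \<Phi>ri \<otimes>\<^bsub>R4\<^esub> RD2 \<U>)"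
    unfolding 1[symmetric] by (simp add: alg_assoc)
  then show ?g2
    unfolding eB by simp
qed

lemma rho_coassoc_inv:
  assumes u: "u \<in> carrier B"
  shows "\<Phi>ri \<otimes>\<^bsub>BHH\<^esub> rtens K B H2 \<Delta> (rhoB u) = rho1 (rhoB u) \<otimes>\<^bsub>BHH\<^esub> \<Phi>ri"
proof -
  have "\<Phi>ri \<otimes>\<^bsub>BHH\<^esub> ((\<Phi>r \<otimes>\<^bsub>BHH\<^esub> rho1 (rhoB u)) \<otimes>\<^bsub>BHH\<^esub> \<Phi>ri) =
    \<Phi>ri \<otimes>\<^bsub>BHH\<^esub> ((rtens K B H2 \<Delta> (rhoB u) \<otimes>\<^bsub>BHH\<^esub> \<Phi>r) \<otimes>\<^bsub>BHH\<^esub> \<Phi>ri)"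
    by (simp only: rho_quasi_coassoc[OF u])
  then show ?thesis using u by (simp add: alg_assoc alg_cancel[OF _ Phi_rho_unit])
qed

text \<open>The two mixed pentagons live in different four-leg algebras; these rules carry their
  factors into the common five-leg one, \<open>W3\<close> being the coproduct of the last leg. The
  sixth rule carries the content: by \<open>rho_coassoc_inv\<close>, crossing the inverse right
  reassociator turns that coproduct into a second right coaction.\<close>

lemma transport:
  "t \<in> carrier BHH \<Longrightarrow> A1 (E4 t) = E5 (lam1 t)" (is "PROP ?g1")
  "v \<in> carrier R3 \<Longrightarrow> W3 (etens K H R3 \<one>\<^sub>H v) = E5 (RD2 v)" (is "PROP ?g2")
  "v \<in> carrier R3 \<Longrightarrow> W3 (rtens K H R3 (ltens K H B H lamB) v) = A1 (RD2 v)"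
  "w \<in> carrier HHB \<Longrightarrow> W3 (tens_one K H H B H w) = T5 w"
  "v \<in> carrier R3 \<Longrightarrow> W3 (ltens K H H BH \<Delta> v) = DD v"
  "w \<in> carrier HHB \<Longrightarrow> E5 (E4 \<Phi>ri) \<cdot>\<^sub>5 W3 (rr w) = A2 (rr w) \<cdot>\<^sub>5 E5 (E4 \<Phi>ri)"
  "v \<in> carrier R3 \<Longrightarrow> A2 (etens K H R3 \<one>\<^sub>H v) = E5 (RB1 v)" (is "PROP ?g7")
proof -
  have s: "RD2 (lassoc K H B H s c) = lassoc K H B H2 s (\<Delta> c)" if "s \<in> carrier HB" "c \<in> carrier H" for s c
    by (rule tens_eqI[OF that(1), where X = R4]) (use that in simp_all)
  have r: "W3 (lassoc K H H BH r s) = lassoc K H H BHH r (rtens K B H2 \<Delta> s)" if "r \<in> carrier H2" "s \<in> carrier BH" for r s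
    by (rule tens_eqI[OF that(1), where X = R5]) (use that in simp_all)
  show "PROP ?g1"
    "PROP ?g2"
    "PROP ?g7"
    by simp_all
  assume v: "v \<in> carrier R3"
  show "W3 (rtens K H R3 (ltens K H B H lamB) v) = A1 (RD2 v)"
    by (rule tens3_eqI[OF v, where X = R5]) (simp_all add: s)
  show "W3 (ltens K H H BH \<Delta> v) = DD v"
    by (rule tens_eqI[OF v, where X = R5]) (simp_all add: r DD_def)
next
  assume w: "w \<in> carrier HHB"
  show "W3 (tens_one K H H B H w) = T5 w"
    by (rule tens3_eqI[OF w, where X = R5]) (simp_all add: tens_one_def')
  show "E5 (E4 \<Phi>ri) \<cdot>\<^sub>5 W3 (rr w) = A2 (rr w) \<cdot>\<^sub>5 E5 (E4 \<Phi>ri)"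
    by (rule tens3_eqI[OF w, where X = R5]) (simp_all add: rho_coassoc_inv)
qed

lemma Psi_eqs:
  "Psi_l K H B = A1 (T4 \<U> \<otimes>\<^bsub>R4\<^esub> lam1 \<Phi>ri) \<cdot>\<^sub>5 T5 \<Phi>l"
  "Psi_r K H B = E5 (RB1 \<U>i) \<cdot>\<^sub>5 (A2 (rr \<Phi>l) \<cdot>\<^sub>5 E5 (E4 \<Phi>ri))"
  by (simp add: Psi_l_def)
    (simp add: Psi_r_def alg_hom_mult[OF R_hom(5)] transport(7) alg_assoc del: etens_mult rtens_etens)

lemma Psi_twist: "Psi_r K H B \<cdot>\<^sub>5 DD \<U> = emb \<U> \<cdot>\<^sub>5 (idl \<U> \<cdot>\<^sub>5 Psi_l K H B)"
proof -
  \<comment> \<open>The left mixed pentagon after a coproduct in its last leg.\<close>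
  have pl: "E5 (RD2 \<U>) \<cdot>\<^sub>5 (A1 (RD2 \<U>) \<cdot>\<^sub>5 T5 \<Phi>l) = W3 (rr \<Phi>l) \<cdot>\<^sub>5 DD \<U>"
    using arg_cong[OF lr_pentagon_left, of W3]
    by (simp add: alg_hom_mult[OF R_hom(8)] transport alg_assoc del: etens_mult rtens_etens)
  have "idl \<U> \<cdot>\<^sub>5 Psi_l K H B = A1 (RB1 \<U> \<otimes>\<^bsub>R4\<^esub> (T4 \<U> \<otimes>\<^bsub>R4\<^esub> lam1 \<Phi>ri)) \<cdot>\<^sub>5 T5 \<Phi>l"
    by (simp add: idl_def Psi_eqs alg_hom_mult[OF R_hom(2)] alg_assoc)
  \<comment> \<open>First use of the right mixed pentagon, under the left coaction
    \<open>A1\<close>.\<close>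
  also have "\<dots> = E5 (lam1 \<Phi>ri) \<cdot>\<^sub>5 (A1 (RD2 \<U>) \<cdot>\<^sub>5 T5 \<Phi>l)"
    unfolding lr_pentagon_right'(1)
    by (simp add: alg_hom_mult[OF R_hom(2)] transport(1) alg_assoc del: etens_mult rtens_etens)
  finally have "emb \<U> \<cdot>\<^sub>5 (idl \<U> \<cdot>\<^sub>5 Psi_l K H B) =
    E5 (T4 \<U> \<otimes>\<^bsub>R4\<^esub> lam1 \<Phi>ri) \<cdot>\<^sub>5 (A1 (RD2 \<U>) \<cdot>\<^sub>5 T5 \<Phi>l)"
    by (simp add: emb_def alg_hom_mult[OF R_hom(13)] alg_assoc del: etens_mult)
  \<comment> \<open>Second use of the right mixed pentagon, now shifted by one leg. It places
    \<open>E5 (RD2 \<U>)\<close> next to \<open>A1 (RD2 \<U>)\<close>, as \<open>pl\<close>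
    requires.\<close>
  also have "\<dots> = E5 (RB1 \<U>i) \<cdot>\<^sub>5 (E5 (E4 \<Phi>ri) \<cdot>\<^sub>5 (E5 (RD2 \<U>) \<cdot>\<^sub>5 (A1 (RD2 \<U>) \<cdot>\<^sub>5 T5 \<Phi>l)))"
    unfolding lr_pentagon_right'(2)
    by (simp add: alg_hom_mult[OF R_hom(13)] alg_assoc del: etens_mult)
  also have "\<dots> = E5 (RB1 \<U>i) \<cdot>\<^sub>5 ((E5 (E4 \<Phi>ri) \<cdot>\<^sub>5 W3 (rr \<Phi>l)) \<cdot>\<^sub>5 DD \<U>)"
    unfolding pl by (simp add: alg_assoc del: etens_mult)
  \<comment> \<open>The inverse right reassociator moves rightwards past the image of
    \<open>\<Phi>l\<close>, which produces the order of factors in \<Psi>_r.\<close>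
  also have "\<dots> = Psi_r K H B \<cdot>\<^sub>5 DD \<U>"
    unfolding transport(6)[OF BU(9)] Psi_eqs by (simp add: alg_assoc del: etens_mult)
  finally show ?thesis by simp
qed

lemma Units_mult: "\<lbrakk> assoc_algebra K V; x \<in> Units V; y \<in> Units V \<rbrakk> \<Longrightarrow> x \<otimes>\<^bsub>V\<^esub> y \<in> Units V"
  using monoid.Units_m_closed[OF alg_monoid] .

lemma Psi_units: "Psi_l K H B \<in> Units R5" (is ?g1) "Psi_r K H B \<in> Units R5" (is ?g2)
proof -
  have R: "assoc_algebra K R3" "assoc_algebra K BHH" "assoc_algebra K R4" "assoc_algebra K R5" "assoc_algebra K HHB" "assoc_algebra K Q4"
    by simp_all
  note u = alg_hom_Units(1)
  have U: "\<U>i \<in> Units R3" "\<Phi>ri \<in> Units BHH"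
    using alg_Units(5)[OF R(1) lrreassoc_unit] alg_Units(5)[OF R(2) Phi_rho_unit] by auto
  show ?g1
    unfolding Psi_eqs
    by (intro Units_mult u[OF R(3,4) R_hom(2)] u[OF R(1,3) R_hom(9)] u[OF R(2,3) R_hom(1)]
      u[OF R(5,4) R_hom(10)] lrreassoc_unit U Phi_lam_unit R)
  show ?g2
    unfolding Psi_eqs
    by (intro Units_mult u[OF R(3,4) R_hom(13)] u[OF R(1,3) R_hom(4)] u[OF R(6,4) R_hom(5)] u[OF R(5,6) R_hom(12)]
      u[OF R(2,3) R_hom(14)] lrreassoc_unit U Phi_lam_unit R)
qed

abbreviation "\<Psi>l \<equiv> Psi_l K H B"
abbreviation "\<Psi>r \<equiv> Psi_r K H B"
abbreviation "\<delta>l \<equiv> delta_l K H B"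
abbreviation "\<delta>r \<equiv> delta_r K H B"

lemma Psi_closed [simp]:
  "\<Psi>l \<in> carrier R5" "\<Psi>r \<in> carrier R5" "inv\<^bsub>R5\<^esub> \<Psi>l \<in> carrier R5" "inv\<^bsub>R5\<^esub> \<Psi>r \<in> carrier R5"
  using alg_Units[OF _ Psi_units(1)] alg_Units[OF _ Psi_units(2)] by simp_all

text \<open>The left crossed products are built on the inverses of \<Psi>, the right ones on \<Psi>
  itself; hence this form for the former and \<open>Psi_twist_right\<close> for the latter.\<close>

lemma Psi_twist_left:
  "inv\<^bsub>R5\<^esub> \<Psi>r \<cdot>\<^sub>5 (emb \<U> \<cdot>\<^sub>5 idl \<U>) = DD \<U> \<cdot>\<^sub>5 inv\<^bsub>R5\<^esub> \<Psi>l"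
proof -
  have "inv\<^bsub>R5\<^esub> \<Psi>r \<cdot>\<^sub>5 (emb \<U> \<cdot>\<^sub>5 (idl \<U> \<cdot>\<^sub>5 \<Psi>l)) \<cdot>\<^sub>5 inv\<^bsub>R5\<^esub> \<Psi>l
    = inv\<^bsub>R5\<^esub> \<Psi>r \<cdot>\<^sub>5 (\<Psi>r \<cdot>\<^sub>5 DD \<U>) \<cdot>\<^sub>5 inv\<^bsub>R5\<^esub> \<Psi>l"
    by (simp only: Psi_twist)
  then show ?thesis
    by (simp add: alg_assoc alg_cancel[OF _ Psi_units(1)] alg_cancel[OF _ Psi_units(2)] alg_Units(3)[OF _ Psi_units(1)])
qed

lemma Psi_twist_right:
  "idl \<U>i \<cdot>\<^sub>5 (emb \<U>i \<cdot>\<^sub>5 \<Psi>r) = \<Psi>l \<cdot>\<^sub>5 DD \<U>i"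
proof -
  have R: "assoc_algebra K R3" "assoc_algebra K R5" by simp_all
  note u = emb_hom[THEN alg_hom_Units(1)[OF R _ lrreassoc_unit]]
  note i = emb_hom[THEN alg_hom_Units(2)[OF R _ lrreassoc_unit]]
  note c = alg_cancel[OF R(2) u(1)] alg_cancel[OF R(2) u(2)] alg_cancel[OF R(2) u(3)] alg_Units[OF R(2) u(3)]
    alg_Units[OF R(2) u(1)] alg_Units[OF R(2) u(2)]
  have "inv\<^bsub>R5\<^esub> (idl \<U>) \<cdot>\<^sub>5 (inv\<^bsub>R5\<^esub> (emb \<U>) \<cdot>\<^sub>5 ((\<Psi>r \<cdot>\<^sub>5 DD \<U>) \<cdot>\<^sub>5 inv\<^bsub>R5\<^esub> (DD \<U>)))
    = inv\<^bsub>R5\<^esub> (idl \<U>) \<cdot>\<^sub>5 (inv\<^bsub>R5\<^esub> (emb \<U>) \<cdot>\<^sub>5 ((emb \<U> \<cdot>\<^sub>5 (idl \<U> \<cdot>\<^sub>5 \<Psi>l)) \<cdot>\<^sub>5 inv\<^bsub>R5\<^esub> (DD \<U>)))"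
    by (simp only: Psi_twist)
  then show ?thesis unfolding i by (simp add: alg_assoc c)
qed

lemma delta_hom: "\<delta>l \<in> alg_hom K B R3" "\<delta>r \<in> alg_hom K B R3"
  using alg_hom_comp[OF R_hom(15) coact_hom(2)] alg_hom_comp[OF R_hom(11) coact_hom(1)]
  by (simp_all add: delta_l_def[abs_def] delta_r_def[abs_def])

lemmas delta_closed [simp] = delta_hom[THEN alg_hom_closed]
lemmas delta_klin [simp] = delta_hom[THEN alg_hom_klin]

lemma delta_twist:
  assumes u: "u \<in> carrier B"
  shows "\<U> \<otimes>\<^bsub>R3\<^esub> \<delta>l u = \<delta>r u \<otimes>\<^bsub>R3\<^esub> \<U>" (is ?g1) and "\<U>i \<otimes>\<^bsub>R3\<^esub> \<delta>r u = \<delta>l u \<otimes>\<^bsub>R3\<^esub> \<U>i" (is ?g2)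
proof -
  show 1: ?g1
    using lr_commute[OF u] by (simp add: delta_l_def delta_r_def)
  have "\<U>i \<otimes>\<^bsub>R3\<^esub> ((\<U> \<otimes>\<^bsub>R3\<^esub> \<delta>l u) \<otimes>\<^bsub>R3\<^esub> \<U>i) = \<U>i \<otimes>\<^bsub>R3\<^esub> ((\<delta>r u \<otimes>\<^bsub>R3\<^esub> \<U>) \<otimes>\<^bsub>R3\<^esub> \<U>i)"
    by (simp only: 1)
  then show ?g2
    using u by (simp add: alg_assoc alg_cancel[OF _ lrreassoc_unit])
qed

end

section \<open>The left crossed products\<close>

locale crossed_product_setting =
  quasi_hopf_bicomodule_algebra K H B + bimodule_algebra K H A
  for K (structure) and H (structure) and A (structure) and B (structure)
begin

abbreviation "Sb \<equiv> antipode_inv H"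

lemma antipode_bij: "bij_betw S (carrier H) (carrier H)"
  using antipode_anti_auto by (simp add: alg_anti_automorphism_def)

lemma Sb_S [simp]:
  "h \<in> carrier H \<Longrightarrow> Sb h \<in> carrier H" (is "PROP ?g1") "h \<in> carrier H \<Longrightarrow> S (Sb h) = h" (is "PROP ?g2") "h \<in> carrier H \<Longrightarrow> Sb (S h) = h" (is "PROP ?g3")
proof -
  show "PROP ?g1"
    using bij_betwE[OF bij_betw_inv_into[OF antipode_bij]] by (simp add: antipode_inv_def)
  show "PROP ?g2"
    using bij_betw_inv_into_right[OF antipode_bij] by (simp add: antipode_inv_def)
  show "PROP ?g3"
    using bij_betw_inv_into_left[OF antipode_bij] by (simp add: antipode_inv_def)
qed

lemma Sb_eqI: "\<lbrakk> x \<in> carrier H; S x = h \<rbrakk> \<Longrightarrow> Sb h = x"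
  using Sb_S(3) by blast

lemma Sb_simps [simp]:
  "klin K H H Sb" "Sb \<one>\<^sub>H = \<one>\<^sub>H" (is ?g2)
  "\<lbrakk> g \<in> carrier H; h \<in> carrier H \<rbrakk> \<Longrightarrow> Sb (g \<cdot> h) = Sb h \<cdot> Sb g" (is "PROP ?g3")
  "h \<in> carrier H \<Longrightarrow> \<epsilon> (Sb h) = \<epsilon> h" (is "PROP ?g4")
proof -
  interpret MH: module K H by simp
  show "klin K H H Sb"
    by (rule klinI) (auto intro!: Sb_eqI simp: klin_add[OF antipode_simps(3)] klin_smult[OF antipode_simps(3)])
  show ?g2 by (rule Sb_eqI) simp_all
  show "PROP ?g3" by (rule Sb_eqI) simp_all
  show "PROP ?g4" using counit_antipode[of "Sb h"] by simp
qed

lemmas Sb_klin_comp [simp] = klin_comp[OF Sb_simps(1)]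

lemma module_A [simp]: "module K A"
  by (rule A.module_axioms)

abbreviation mulA (infixl \<open>\<star>\<close> 70) where "x \<star> y \<equiv> x \<otimes>\<^bsub>A\<^esub> y"

lemmas A_closed [simp] = lact_closed ract_closed mult_closed unit_closed

lemma A_klin [simp]:
  "\<lbrakk> klin K U A F; h \<in> carrier H \<rbrakk> \<Longrightarrow> klin K U A (\<lambda>x. lact A h (F x))"
  "\<lbrakk> klin K U H G; a \<in> carrier A \<rbrakk> \<Longrightarrow> klin K U A (\<lambda>x. lact A (G x) a)"
  "\<lbrakk> klin K U A F; h \<in> carrier H \<rbrakk> \<Longrightarrow> klin K U A (\<lambda>x. ract A (F x) h)"
  "\<lbrakk> klin K U H G; a \<in> carrier A \<rbrakk> \<Longrightarrow> klin K U A (\<lambda>x. ract A a (G x))"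
  "\<lbrakk> klin K U A F; a \<in> carrier A \<rbrakk> \<Longrightarrow> klin K U A (\<lambda>x. F x \<star> a)"
  "\<lbrakk> klin K U A F; a \<in> carrier A \<rbrakk> \<Longrightarrow> klin K U A (\<lambda>x. a \<star> F x)"
  by (rule klinI; simp add: klin_closed klin_add klin_smult lact_add_left lact_add_right lact_smult_left lact_smult_right
      ract_add_left ract_add_right ract_smult_left ract_smult_right mult_add_left mult_add_right
      mult_smult_left mult_smult_right)+

lemmas A_nf [simp] = lact_mult ract_mult lact_ract lact_one ract_one

abbreviation "X \<equiv> A \<boxtimes> B"
abbreviation "f \<equiv> drinfeld_twist K H"
abbreviation "fi \<equiv> inv\<^bsub>H2\<^esub> (drinfeld_twist K H)"

lemma f_closed [simp]: "f \<in> carrier H2" "fi \<in> carrier H2"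
  using alg_Units(1,2)[OF _ drinfeld_twist_unit] by simp_all

lemmas par5 [simp] = klin_tsum5_param[of H H B H H]
lemmas par3 [simp] = klin_tsum3_param[of H B H]
lemmas par2 [simp] = klin_tsum2_param[of H H]

abbreviation "pure3 a b c \<equiv> etens K H BH a (etens K B H b c)"
abbreviation "pure5 a b c d e \<equiv> etens K H R4 a (etens K H BHH b (etens K B H2 c (e2 d e)))"

lemma emb_pure [simp]:
  "\<lbrakk> a \<in> carrier H; b \<in> carrier B; c \<in> carrier H \<rbrakk> \<Longrightarrow> emb (pure3 a b c) = pure5 \<one>\<^sub>H a b c \<one>\<^sub>H"
  by (simp add: emb_def)

lemma DD_pure [simp]:
  "\<lbrakk> a \<in> carrier H; b \<in> carrier B; c \<in> carrier H \<rbrakk> \<Longrightarrow> DD (pure3 a b c) = lassoc K H H BHH (\<Delta> a) (etens K B H2 b (\<Delta> c))"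
  by (simp add: DD_def)

text \<open>Carries the outer legs of a three-leg tensor whose middle leg has gone into
  \<open>emb\<close>. It occupies legs 1 and 5, \<open>emb\<close> legs 2 to 4, so the two
  commute.\<close>

definition "JJ a c = pure5 a \<one>\<^sub>H \<one>\<^bsub>B\<^esub> \<one>\<^sub>H c"

lemma JJ_closed [simp]: "\<lbrakk> a \<in> carrier H; c \<in> carrier H \<rbrakk> \<Longrightarrow> JJ a c \<in> carrier R5"
  by (simp add: JJ_def)

lemma emb_JJ:
  assumes a: "a \<in> carrier H" "c \<in> carrier H" and d: "d \<in> carrier R3"
  shows "emb d \<cdot>\<^sub>5 JJ a c = JJ a c \<cdot>\<^sub>5 emb d"
  by (rule tens3_eqI[OF d, where X = R5]) (use a in \<open>simp_all add: JJ_def\<close>)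

lemma idl_pure:
  assumes abc: "a \<in> carrier H" "b \<in> carrier B" "c \<in> carrier H"
  shows "idl (pure3 a b c) = emb (\<delta>l b) \<cdot>\<^sub>5 JJ a c"
proof -
  have s: "etens K H R4 a (lassoc K H B H2 s (e2 h c)) = emb (lassoc K H B H s h) \<cdot>\<^sub>5 JJ a c"
    if "s \<in> carrier HB" "h \<in> carrier H" for s h
    by (rule tens_eqI[OF that(1), where X = R5]) (use abc that in \<open>simp_all add: JJ_def\<close>)
  have "A1 (etens K H BHH a (lassoc K B H H d c)) = emb (ltens K H B H lamB d) \<cdot>\<^sub>5 JJ a c" if "d \<in> carrier BH" for d
    by (rule tens_eqI[OF that, where X = R5]) (use abc in \<open>simp_all add: s\<close>)
  then show ?thesis using abc by (simp add: idl_def delta_l_def)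
qed

text \<open>Both orders of summation are needed: the left crossed product evaluates the coproduct of
  the right action first, the right crossed product that of the left action.\<close>

lemma lact_ract_distrib:
  assumes a: "a \<in> carrier H" "k \<in> carrier H" and x: "x \<in> carrier A" "y \<in> carrier A"
  shows "lact A a (ract A (x \<star> y) k) = tsum2 A (\<lambda>r1 r2. tsum2 A (\<lambda>s1 s2.
    lact A s1 (ract A x r1) \<star> lact A s2 (ract A y r2)) (\<Delta> a)) (\<Delta> k)" (is "_ = ?R")
    and "lact A a (ract A (x \<star> y) k) = tsum2 A (\<lambda>s1 s2. tsum2 A (\<lambda>r1 r2.
    lact A s1 (ract A x r1) \<star> lact A s2 (ract A y r2)) (\<Delta> k)) (\<Delta> a)" (is "_ = ?R'")
proof -
  have "lact A a (ract A (x \<star> y) k) = tsum2 A (\<lambda>r1 r2. lact A a (ract A x r1 \<star> ract A y r2)) (\<Delta> k)"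
    using a x klin_tsum2_out[of H H A A "\<Delta> k" "lact A a" "\<lambda>r1 r2. ract A x r1 \<star> ract A y r2"]
      A_klin(1)[OF klin_ident] by (simp add: ract_distrib)
  also have "\<dots> = ?R"
    by (rule tsum2_cong[of H H]) (use a x in \<open>simp_all add: lact_distrib\<close>)
  finally show "lact A a (ract A (x \<star> y) k) = ?R" .
  have "lact A a (ract A (x \<star> y) k) = ract A (lact A a (x \<star> y)) k" using a x by simp
  also have "\<dots> = tsum2 A (\<lambda>s1 s2. ract A (lact A s1 x \<star> lact A s2 y) k) (\<Delta> a)"
    using a x klin_tsum2_out[of H H A A "\<Delta> a" "\<lambda>z. ract A z k" "\<lambda>s1 s2. lact A s1 x \<star> lact A s2 y"]
      A_klin(3)[OF klin_ident] by (simp add: lact_distrib del: A_nf)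
  also have "\<dots> = ?R'"
  proof (rule tsum2_cong[of H H])
    fix v w assume "v \<in> carrier H" "w \<in> carrier H"
    then show "ract A (lact A v x \<star> lact A w y) k =
      tsum2 A (\<lambda>r1 r2. lact A v (ract A x r1) \<star> lact A w (ract A y r2)) (\<Delta> k)"
      using a x by (simp add: ract_distrib) (rule tsum2_cong[of H H], simp_all)
  qed (use a in simp_all)
  finally show "lact A a (ract A (x \<star> y) k) = ?R'" .
qed

text \<open>
  \<open>act \<U>\<close> will be the isomorphism.  The product of \<open>a \<bowtie> u\<close> and \<open>a' \<bowtie> u'\<close> is \<open>RB u' (MM a a' (\<Psi>\<^sup>-\<^sup>1 (1 \<otimes> \<delta>(u) \<otimes> 1)))\<close>,
  which keeps \<open>f\<close> apart from \<open>\<Psi>\<^sup>-\<^sup>1\<close> so that coproducts can be moved through it.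
\<close>

definition "act d = tsum2 X (\<lambda>a u. tsum3 X (\<lambda>h b k. etens K A B (lact A h (ract A a (Sb k))) (b \<cdot>\<^sub>B u)) d)"
definition "RB u = rtens K A B (\<lambda>b. b \<cdot>\<^sub>B u)"
text \<open>The legs \<open>w1\<close> and \<open>w2\<close> cross because \<Omega>^5, built from
  the last leg, acts on the first factor and \<Omega>^4 on the second.\<close>

definition "mm a a' p1 p2 p3 = tsum2 X (\<lambda>w1 w2.
  etens K A B (lact A p1 (ract A a (Sb w2)) \<star> lact A p2 (ract A a' (Sb w1))) p3)"
definition "MM a a' = tsum5 X (\<lambda>p1 p2 p3 p4 p5. mm a a' p1 p2 p3 (f \<cdot>\<^sub>2 e2 p4 p5))"

lemma act_pure [simp]:
  "\<lbrakk> h \<in> carrier H; b \<in> carrier B; k \<in> carrier H; a \<in> carrier A; u \<in> carrier B \<rbrakk> \<Longrightarrow>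
    act (pure3 h b k) (etens K A B a u) = etens K A B (lact A h (ract A a (Sb k))) (b \<cdot>\<^sub>B u)"
  by (simp add: act_def tsum2_etens tsum3_etens)

lemma act_klin1: "d \<in> carrier R3 \<Longrightarrow> klin K X X (act d)"
  unfolding act_def by (rule klin_tsum2) simp_all

lemma act_klin2: "s \<in> carrier X \<Longrightarrow> klin K R3 X (\<lambda>d. act d s)"
  unfolding act_def by (rule klin_tsum2_param[of A B]) (simp_all add: tsum3_etens)

lemmas act_klin [simp] = act_klin1 klin_comp[OF act_klin1] act_klin2 klin_comp[OF act_klin2] klin_closed[OF act_klin1]

lemma RB_simps [simp]:
  assumes "u \<in> carrier B"
  shows "klin K X X (RB u)" "klin K V X F \<Longrightarrow> klin K V X (\<lambda>x. RB u (F x))" (is "PROP ?g2") "s \<in> carrier X \<Longrightarrow> RB u s \<in> carrier X" (is "PROP ?g3")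
    "\<lbrakk> a \<in> carrier A; b \<in> carrier B \<rbrakk> \<Longrightarrow> RB u (etens K A B a b) = etens K A B a (b \<cdot>\<^sub>B u)" (is "PROP ?g4")
proof -
  show k: "klin K X X (RB u)" unfolding RB_def by (rule rtens_etens(2)) (use assms in simp_all)
  show "PROP ?g2" by (rule klin_comp[OF k])
  show "PROP ?g3" by (rule klin_closed[OF k])
  show "PROP ?g4"
    unfolding RB_def using assms by simp
qed

lemma mm_simps [simp]:
  assumes "a \<in> carrier A" "a' \<in> carrier A" "p1 \<in> carrier H" "p2 \<in> carrier H" "p3 \<in> carrier B"
  shows "klin K H2 X (mm a a' p1 p2 p3)" (is ?g1) "klin K V H2 F \<Longrightarrow> klin K V X (\<lambda>x. mm a a' p1 p2 p3 (F x))" (is "PROP ?g2")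
    "w \<in> carrier H2 \<Longrightarrow> mm a a' p1 p2 p3 w \<in> carrier X" (is "PROP ?g3")
    "\<lbrakk> w1 \<in> carrier H; w2 \<in> carrier H \<rbrakk> \<Longrightarrow> mm a a' p1 p2 p3 (e2 w1 w2) =
      etens K A B (lact A p1 (ract A a (Sb w2)) \<star> lact A p2 (ract A a' (Sb w1))) p3"
proof -
  show k: ?g1 unfolding mm_def by (rule klin_tsum2) (use assms in simp_all)
  show "PROP ?g2" by (rule klin_comp[OF k])
  show "PROP ?g3" by (rule klin_closed[OF k])
qed (simp add: mm_def tsum2_etens assms)

lemma mm_klin [simp]:
  assumes "w \<in> carrier H2" "a \<in> carrier A" "a' \<in> carrier A"
  shows "\<lbrakk> p2 \<in> carrier H; p3 \<in> carrier B; klin K V H F \<rbrakk> \<Longrightarrow> klin K V X (\<lambda>x. mm a a' (F x) p2 p3 w)"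
    "\<lbrakk> p1 \<in> carrier H; p3 \<in> carrier B; klin K V H F \<rbrakk> \<Longrightarrow> klin K V X (\<lambda>x. mm a a' p1 (F x) p3 w)"
    "\<lbrakk> p1 \<in> carrier H; p2 \<in> carrier H; klin K V B G \<rbrakk> \<Longrightarrow> klin K V X (\<lambda>x. mm a a' p1 p2 (G x) w)"
  unfolding mm_def using assms by simp_all

lemma MM_simps [simp]:
  assumes "a \<in> carrier A" "a' \<in> carrier A"
  shows "klin K R5 X (MM a a')" (is ?g1) "klin K V R5 F \<Longrightarrow> klin K V X (\<lambda>x. MM a a' (F x))" (is "PROP ?g2")
    "P \<in> carrier R5 \<Longrightarrow> MM a a' P \<in> carrier X" (is "PROP ?g3")
    "\<lbrakk> p1 \<in> carrier H; p2 \<in> carrier H; p3 \<in> carrier B; d \<in> carrier H2 \<rbrakk> \<Longrightarrow>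
      MM a a' (etens K H R4 p1 (etens K H BHH p2 (etens K B H2 p3 d))) = mm a a' p1 p2 p3 (f \<cdot>\<^sub>2 d)"
proof -
  show k: ?g1 unfolding MM_def by (rule tsum5_etens(2)) (use assms in simp_all)
  show "PROP ?g2" by (rule klin_comp[OF k])
  show "PROP ?g3" by (rule klin_closed[OF k])
  assume p: "p1 \<in> carrier H" "p2 \<in> carrier H" "p3 \<in> carrier B" and d: "d \<in> carrier H2"
  have pure: "MM a a' (pure5 p1 p2 p3 p4 p5) = mm a a' p1 p2 p3 (f \<cdot>\<^sub>2 e2 p4 p5)" if "p4 \<in> carrier H" "p5 \<in> carrier H" for p4 p5
    unfolding MM_def using assms p that by (simp add: tsum5_etens)
  show "MM a a' (etens K H R4 p1 (etens K H BHH p2 (etens K B H2 p3 d))) = mm a a' p1 p2 p3 (f \<cdot>\<^sub>2 d)"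
    by (rule tens_eqI[OF d, where X = X]) (use assms p in \<open>simp_all add: klin_comp[OF k] pure\<close>)
qed

lemma f_comult_mult:
  assumes c: "c \<in> carrier H" and z: "z \<in> carrier H2"
  shows "f \<cdot>\<^sub>2 (\<Delta> c \<cdot>\<^sub>2 z) = gg (Sb c) \<cdot>\<^sub>2 (f \<cdot>\<^sub>2 z)"
  using drinfeld_twist_comult[of "Sb c"] c z by (simp add: alg_assoc[symmetric])

text \<open>The left action distributes over the product by \<Delta> h, the right action by
  \<Delta>(S^-1 c). In the second case pulling the legs r into the arguments of S^-1 already present
  reverses their order and applies S, which is multiplication of \<open>w\<close> by
  \<open>SS r\<close>.\<close>

lemma act_mm:
  assumes a: "a \<in> carrier A" "a' \<in> carrier A" and u: "u \<in> carrier B" and h: "h \<in> carrier H" "b \<in> carrier B" "c \<in> carrier H"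
    and q: "q1 \<in> carrier H" "q2 \<in> carrier H" "q3 \<in> carrier B" and w: "w \<in> carrier H2"
  shows "act (pure3 h b c) (RB u (mm a a' q1 q2 q3 w)) =
    tsum2 X (\<lambda>s1 s2. RB u (mm a a' (s1 \<cdot> q1) (s2 \<cdot> q2) (b \<cdot>\<^sub>B q3) (gg (Sb c) \<cdot>\<^sub>2 w))) (\<Delta> h)"
proof (rule tens_eqI[OF w, where X = X])
  fix w1 w2 assume w: "w1 \<in> carrier H" "w2 \<in> carrier H"
  define x y where "x = lact A q1 (ract A a (Sb w2))" and "y = lact A q2 (ract A a' (Sb w1))"
  let ?E = "\<lambda>z. etens K A B z (b \<cdot>\<^sub>B (q3 \<cdot>\<^sub>B u))"
  let ?D = "\<lambda>s1 s2. tsum2 A (\<lambda>r1 r2. lact A s1 (ract A x r1) \<star> lact A s2 (ract A y r2))"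
  have xy: "x \<in> carrier A" "y \<in> carrier A" using a q w by (simp_all add: x_def y_def)
  have kE: "klin K A X ?E" using h q u by simp
  have r: "?E (?D s1 s2 r) = RB u (mm a a' (s1 \<cdot> q1) (s2 \<cdot> q2) (b \<cdot>\<^sub>B q3) (SS r \<cdot>\<^sub>2 e2 w1 w2))"
    if s: "s1 \<in> carrier H" "s2 \<in> carrier H" and r: "r \<in> carrier H2" for s1 s2 r
    by (rule tens_eqI[OF r, where X = X])
      (use s h q u w a xy in \<open>simp_all add: tsum2_etens klin_tsum2 alg_assoc, simp add: x_def y_def\<close>)
  have "act (pure3 h b c) (RB u (mm a a' q1 q2 q3 (e2 w1 w2))) = ?E (lact A h (ract A (x \<star> y) (Sb c)))"
    using h q u w a by (simp add: alg_assoc x_def y_def)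
  also have "\<dots> = ?E (tsum2 A (\<lambda>s1 s2. ?D s1 s2 (\<Delta> (Sb c))) (\<Delta> h))"
    using h xy by (simp only: lact_ract_distrib(2) Sb_S)
  also have "\<dots> = tsum2 X (\<lambda>s1 s2. ?E (?D s1 s2 (\<Delta> (Sb c)))) (\<Delta> h)"
    by (rule klin_tsum2_out[OF _ _ _ _ _ kE, of H H]) (use h xy in \<open>simp_all add: tsum2_closed[of H H]\<close>)
  also have "\<dots> = tsum2 X (\<lambda>s1 s2. RB u (mm a a' (s1 \<cdot> q1) (s2 \<cdot> q2) (b \<cdot>\<^sub>B q3) (gg (Sb c) \<cdot>\<^sub>2 e2 w1 w2))) (\<Delta> h)"
    by (rule tsum2_cong[of H H]) (use h r in simp_all)
  finally show "act (pure3 h b c) (RB u (mm a a' q1 q2 q3 (e2 w1 w2))) =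
    tsum2 X (\<lambda>s1 s2. RB u (mm a a' (s1 \<cdot> q1) (s2 \<cdot> q2) (b \<cdot>\<^sub>B q3) (gg (Sb c) \<cdot>\<^sub>2 e2 w1 w2))) (\<Delta> h)" .
qed (use assms in simp_all)

text \<open>The commutation rule of f is used here: it turns gg(S^-1 c) f back into f \<Delta>(c),
  so both coproducts can be read as factors to the left of \<open>Q\<close>.\<close>

lemma act_MM:
  assumes a: "a \<in> carrier A" "a' \<in> carrier A" and u: "u \<in> carrier B"
    and d: "d \<in> carrier R3" and Q: "Q \<in> carrier R5"
  shows "act d (RB u (MM a a' Q)) = RB u (MM a a' (DD d \<cdot>\<^sub>5 Q))"
proof -
  have *: "RB u (MM a a' (lassoc K H H BHH s (etens K B H2 b (\<Delta> c)) \<cdot>\<^sub>5 pure5 q1 q2 q3 q4 q5)) =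
      tsum2 X (\<lambda>s1 s2. RB u (mm a a' (s1 \<cdot> q1) (s2 \<cdot> q2) (b \<cdot>\<^sub>B q3) (gg (Sb c) \<cdot>\<^sub>2 (f \<cdot>\<^sub>2 e2 q4 q5)))) s"
    if "s \<in> carrier H2" "b \<in> carrier B" "c \<in> carrier H" "q1 \<in> carrier H" "q2 \<in> carrier H" "q3 \<in> carrier B"
      "q4 \<in> carrier H" "q5 \<in> carrier H" for s b c q1 q2 q3 q4 q5
    by (rule tens_eqI[OF that(1), where X = X])
      (use that a u in \<open>simp_all add: tsum2_etens klin_tsum2 f_comult_mult\<close>)
  show ?thesis
    by (rule tens3_eqI[OF d, where X = X]; (rule tens5_eqI[OF Q, where X = X])?;
        simp add: a u Q act_mm * del: etens_mult act_pure)
qed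

section \<open>The multiplication of the left crossed product\<close>

definition "cL a a' u' d = tsum5 X (\<lambda>w1 w2 w3 w4 w5. tsum3 X (\<lambda>um u0 up.
  etens K A B (ract A (lact A w1 a) w5 \<star> ract A (lact A (w2 \<cdot> um) a') (Sb up \<cdot> w4)) (w3 \<cdot>\<^sub>B u0 \<cdot>\<^sub>B u')) d)"

definition "OL1 p1 p2 p3 = tsum2 R5 (\<lambda>w1 w2. pure5 p1 p2 p3 (Sb w1) (Sb w2))"
definition "OL = tsum5 R5 (\<lambda>p1 p2 p3 p4 p5. tsum2 R5 (\<lambda>f1 f2. pure5 p1 p2 p3 (Sb (f1 \<cdot> p4)) (Sb (f2 \<cdot> p5))) f)"

lemma Omega_left_eq: "Omega_left K H B \<Psi> = OL (inv\<^bsub>R5\<^esub> \<Psi>)"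
  by (simp add: Omega_left_def OL_def etens5_def)

lemma cL_simps:
  assumes "a \<in> carrier A" "a' \<in> carrier A" "u' \<in> carrier B"
  shows "d \<in> carrier R3 \<Longrightarrow> klin K R5 X (cL a a' u' d)" (is "PROP ?g1")
    and "\<lbrakk> klin K V R3 F; Q \<in> carrier R5 \<rbrakk> \<Longrightarrow> klin K V X (\<lambda>x. cL a a' u' (F x) Q)"
    and "\<lbrakk> q1 \<in> carrier H; q2 \<in> carrier H; q3 \<in> carrier B; q4 \<in> carrier H; q5 \<in> carrier H; d1 \<in> carrier H; d2 \<in> carrier B; d3 \<in> carrier H \<rbrakk> \<Longrightarrow>
      cL a a' u' (pure3 d1 d2 d3) (pure5 q1 q2 q3 q4 q5) =
      etens K A B (ract A (lact A q1 a) q5 \<star> ract A (lact A (q2 \<cdot> d1) a') (Sb d3 \<cdot> q4)) (q3 \<cdot>\<^sub>B d2 \<cdot>\<^sub>B u')" (is "PROP ?g3")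
proof -
  show "PROP ?g1"
    unfolding cL_def by (rule tsum5_etens(2)) (use assms in simp_all)
  show "klin K V X (\<lambda>x. cL a a' u' (F x) Q)" if F: "klin K V R3 F" and Q: "Q \<in> carrier R5"
    unfolding cL_def
    by (rule par5[OF _ _ _ _ _ _ Q]) (use assms F in \<open>simp_all add: tsum3_etens(2)[of H B H, THEN klin_comp]\<close>)
  show "PROP ?g3"
    using assms by (simp add: cL_def tsum5_etens tsum3_etens)
qed

lemma cL_param:
  assumes "d \<in> carrier R3" "Q \<in> carrier R5"
  shows "\<lbrakk> klin K V A F; a' \<in> carrier A; u' \<in> carrier B \<rbrakk> \<Longrightarrow> klin K V X (\<lambda>x. cL (F x) a' u' d Q)"
    "\<lbrakk> a \<in> carrier A; klin K V A F; u' \<in> carrier B \<rbrakk> \<Longrightarrow> klin K V X (\<lambda>x. cL a (F x) u' d Q)"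
    "\<lbrakk> a \<in> carrier A; a' \<in> carrier A; klin K V B G \<rbrakk> \<Longrightarrow> klin K V X (\<lambda>x. cL a a' (G x) d Q)"
  unfolding cL_def using assms by simp_all

lemma OL_simps:
  assumes "p1 \<in> carrier H" "p2 \<in> carrier H" "p3 \<in> carrier B"
  shows "klin K H2 R5 (OL1 p1 p2 p3)" (is ?g1)
    and "\<lbrakk> w1 \<in> carrier H; w2 \<in> carrier H \<rbrakk> \<Longrightarrow> OL1 p1 p2 p3 (e2 w1 w2) = pure5 p1 p2 p3 (Sb w1) (Sb w2)"
    and "\<lbrakk> p4 \<in> carrier H; p5 \<in> carrier H \<rbrakk> \<Longrightarrow> OL (pure5 p1 p2 p3 p4 p5) = OL1 p1 p2 p3 (f \<cdot>\<^sub>2 e2 p4 p5)"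
proof -
  show k: ?g1 unfolding OL1_def by (rule klin_tsum2) (use assms in simp_all)
  show e: "\<lbrakk> w1 \<in> carrier H; w2 \<in> carrier H \<rbrakk> \<Longrightarrow> OL1 p1 p2 p3 (e2 w1 w2) = pure5 p1 p2 p3 (Sb w1) (Sb w2)" for w1 w2
    using assms by (simp add: OL1_def tsum2_etens)
  assume p: "p4 \<in> carrier H" "p5 \<in> carrier H"
  have "tsum2 R5 (\<lambda>f1 f2. pure5 p1 p2 p3 (Sb (f1 \<cdot> p4)) (Sb (f2 \<cdot> p5))) g = OL1 p1 p2 p3 (g \<cdot>\<^sub>2 e2 p4 p5)"
    if "g \<in> carrier H2" for g
    by (rule tens_eqI[OF that, where X = R5])
      (use assms p in \<open>simp_all add: tsum2_etens klin_tsum2 klin_comp[OF k] e del: Sb_simps(3)\<close>)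
  moreover have "OL (pure5 p1 p2 p3 p4 p5) = tsum2 R5 (\<lambda>f1 f2. pure5 p1 p2 p3 (Sb (f1 \<cdot> p4)) (Sb (f2 \<cdot> p5))) f"
    unfolding OL_def using assms p by (simp add: tsum5_etens)
  ultimately show "OL (pure5 p1 p2 p3 p4 p5) = OL1 p1 p2 p3 (f \<cdot>\<^sub>2 e2 p4 p5)" by simp
qed

lemma OL_klin: "klin K R5 R5 OL"
  unfolding OL_def by (rule tsum5_etens(2)) simp_all

text \<open>S^-1(u_(1)) S^-1(f^1 p_4) equals S^-1(f^1 p_4 u_(1)), so the coaction ends up to the
  right of \<open>P\<close> in legs 2 to 4, with f still in front.\<close>

lemma cL_OL:
  assumes a: "a \<in> carrier A" "a' \<in> carrier A" and u: "u' \<in> carrier B" and d: "d \<in> carrier R3" and P: "P \<in> carrier R5"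
  shows "cL a a' u' d (OL P) = RB u' (MM a a' (P \<cdot>\<^sub>5 emb d))"
proof -
  note k = cL_simps(1)[OF a u] cL_simps(2)[OF a u] klin_comp[OF cL_simps(1)[OF a u]]
  note [simp] = klin_closed[OF OL_klin]
  have *: "cL a a' u' (pure3 d1 d2 d3) (OL1 p1 p2 p3 w) = RB u' (mm a a' p1 (p2 \<cdot> d1) (p3 \<cdot>\<^sub>B d2) (w \<cdot>\<^sub>2 e2 d3 \<one>\<^sub>H))"
    if "w \<in> carrier H2" "d1 \<in> carrier H" "d2 \<in> carrier B" "d3 \<in> carrier H" "p1 \<in> carrier H" "p2 \<in> carrier H" "p3 \<in> carrier B"
    for w d1 d2 d3 p1 p2 p3
    by (rule tens_eqI[OF that(1), where X = X])
      (use a u that in \<open>simp_all add: klin_comp[OF _ OL_simps(1)] OL_simps cL_simps k\<close>)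
  show ?thesis
    by (rule tens5_eqI[OF P, where X = X]; (rule tens3_eqI[OF d, where X = X])?;
        simp add: a u d k OL_klin OL_simps klin_closed[OF OL_simps(1)] * alg_assoc)
qed

definition "mulL dd P s t = tsum2 X (\<lambda>a u. tsum2 X (\<lambda>a' u'. cL a a' u' (dd u) (OL P)) t) s"

lemma left_crossed_product_simps:
  "mult (left_crossed_product K H A B dd \<Psi>) = mulL dd (inv\<^bsub>R5\<^esub> \<Psi>)"
  "carrier (left_crossed_product K H A B dd \<Psi>) = carrier X"
  "add (left_crossed_product K H A B dd \<Psi>) = add X"
  "one (left_crossed_product K H A B dd \<Psi>) = one X"
  "smult (left_crossed_product K H A B dd \<Psi>) = smult X"
  by (simp_all add: left_crossed_product_def mulL_def[abs_def] cL_def Omega_left_eq)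

lemmas parX [simp] = klin_tsum2_param[of A B]

context
  fixes dd P
  assumes dd: "klin K B R3 dd" and P: "P \<in> carrier R5"
begin

lemma mulL_aux:
  "\<lbrakk> a \<in> carrier A; a' \<in> carrier A; u' \<in> carrier B \<rbrakk> \<Longrightarrow> klin K B X (\<lambda>u. cL a a' u' (dd u) (OL P))"
  "\<lbrakk> a' \<in> carrier A; u \<in> carrier B; u' \<in> carrier B \<rbrakk> \<Longrightarrow> klin K A X (\<lambda>a. cL a a' u' (dd u) (OL P))"
  "\<lbrakk> a \<in> carrier A; u \<in> carrier B; u' \<in> carrier B \<rbrakk> \<Longrightarrow> klin K A X (\<lambda>a'. cL a a' u' (dd u) (OL P))"
  "\<lbrakk> a \<in> carrier A; a' \<in> carrier A; u \<in> carrier B \<rbrakk> \<Longrightarrow> klin K B X (\<lambda>u'. cL a a' u' (dd u) (OL P))"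
  using klin_closed[OF OL_klin P] klin_closed[OF dd] dd by (auto intro!: cL_param cL_simps(2) klin_ident)

lemma mulL_klin:
  "t \<in> carrier X \<Longrightarrow> klin K X X (\<lambda>s. mulL dd P s t)"
  "s \<in> carrier X \<Longrightarrow> klin K X X (mulL dd P s)"
  unfolding mulL_def
  by (rule klin_tsum2; simp add: mulL_aux) (rule parX; simp add: mulL_aux klin_tsum2)

lemma mulL_pure:
  assumes a: "a \<in> carrier A" "u \<in> carrier B" "a' \<in> carrier A" "u' \<in> carrier B"
  shows "mulL dd P (etens K A B a u) (etens K A B a' u') = RB u' (MM a a' (P \<cdot>\<^sub>5 emb (dd u)))"
proof -
  have "mulL dd P (etens K A B a u) (etens K A B a' u') = cL a a' u' (dd u) (OL P)"
    unfolding mulL_def using a by (simp add: tsum2_etens mulL_aux)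
  then show ?thesis using a P klin_closed[OF dd] by (simp add: cL_OL)
qed

end

text \<open>The action on the second factor adds to legs 2 to 4 of \<open>P\<close>, that on the
  first factor to legs 1 and 5. The middle leg of the first tensor does not show: it will already be
  part of \<open>e\<close>, as an argument of the coaction.\<close>

lemma RB_MM_act:
  assumes a: "a \<in> carrier A" "a' \<in> carrier A" and h: "h \<in> carrier H" "k \<in> carrier H" "h' \<in> carrier H" "k' \<in> carrier H"
    and b: "b' \<in> carrier B" "u' \<in> carrier B" and P: "P \<in> carrier R5" and e: "e \<in> carrier R3"
  shows "RB (b' \<cdot>\<^sub>B u') (MM (lact A h (ract A a (Sb k))) (lact A h' (ract A a' (Sb k'))) (P \<cdot>\<^sub>5 emb e)) =
    RB u' (MM a a' (P \<cdot>\<^sub>5 (emb (e \<otimes>\<^bsub>R3\<^esub> pure3 h' b' k') \<cdot>\<^sub>5 JJ h k)))"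
proof -
  let ?a = "lact A h (ract A a (Sb k))" and ?a' = "lact A h' (ract A a' (Sb k'))"
  have *: "RB (b' \<cdot>\<^sub>B u') (mm ?a ?a' q1 q2 q3 w) = RB u' (mm a a' (q1 \<cdot> h) (q2 \<cdot> h') (q3 \<cdot>\<^sub>B b') (w \<cdot>\<^sub>2 e2 k' k))"
    if "w \<in> carrier H2" "q1 \<in> carrier H" "q2 \<in> carrier H" "q3 \<in> carrier B" for w q1 q2 q3
    by (rule tens_eqI[OF that(1), where X = X]) (use a h b that in \<open>simp_all add: alg_assoc\<close>)
  show ?thesis
    by (rule tens5_eqI[OF P, where X = X]; (rule tens3_eqI[OF e, where X = X])?;
        simp add: a h b e * JJ_def alg_assoc del: A_nf)
qed

text \<open>The two copies of U are treated one after the other. The second must be whole for the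
  intertwining rule, which is applied while the first is still pure; then the first is made whole,
  which is possible because the outcome is expressed by the linear map \<open>idl\<close>.\<close>

lemma mulL_act:
  assumes s: "s \<in> carrier X" and t: "t \<in> carrier X"
  shows "mulL \<delta>r (inv\<^bsub>R5\<^esub> \<Psi>r) (act \<U> s) (act \<U> t) = act \<U> (mulL \<delta>l (inv\<^bsub>R5\<^esub> \<Psi>l) s t)"
proof -
  let ?P = "inv\<^bsub>R5\<^esub> \<Psi>r"
  note kr = mulL_klin[OF delta_klin(2) Psi_closed(4)] and kl = mulL_klin[OF delta_klin(1) Psi_closed(3)]
  note [simp] = kr kr[THEN klin_comp] kl kl[THEN klin_comp] alg_hom_closed[OF delta_hom(1)] alg_hom_closed[OF delta_hom(2)]
  have pure: "mulL \<delta>r ?P (act \<U> (etens K A B a u)) (act \<U> (etens K A B a' u')) =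
    act \<U> (mulL \<delta>l (inv\<^bsub>R5\<^esub> \<Psi>l) (etens K A B a u) (etens K A B a' u'))"
    if a: "a \<in> carrier A" "u \<in> carrier B" "a' \<in> carrier A" "u' \<in> carrier B" for a u a' u'
  proof -
    have 1: "mulL \<delta>r ?P (act (pure3 h b k) (etens K A B a u)) (act d (etens K A B a' u')) =
      RB u' (MM a a' (?P \<cdot>\<^sub>5 (emb (\<delta>r (b \<cdot>\<^sub>B u) \<otimes>\<^bsub>R3\<^esub> d) \<cdot>\<^sub>5 JJ h k)))"
      if "d \<in> carrier R3" "h \<in> carrier H" "b \<in> carrier B" "k \<in> carrier H" for d h b k
      by (rule tens3_eqI[OF that(1), where X = X]) (use a that in \<open>simp_all add: mulL_pure RB_MM_act del: etens_mult\<close>)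
    \<comment> \<open>U moves to the left and changes \<delta>_r into \<delta>_l. The factor
      \<delta>_l(b) with the outer legs h and k is then \<open>idl\<close> of the first
      tensor.\<close>
    have 2: "emb (\<delta>r (b \<cdot>\<^sub>B u) \<otimes>\<^bsub>R3\<^esub> \<U>) \<cdot>\<^sub>5 JJ h k = emb \<U> \<cdot>\<^sub>5 (idl (pure3 h b k) \<cdot>\<^sub>5 emb (\<delta>l u))"
      if h: "h \<in> carrier H" "b \<in> carrier B" "k \<in> carrier H" for h b k
      using a h by (simp add: delta_twist(1)[symmetric] alg_hom_mult[OF delta_hom(1)] alg_hom_mult[OF emb_hom(1)]
        emb_JJ[OF h(1,3), of "\<delta>l u"] idl_pure alg_assoc)
    have 4: "mulL \<delta>r ?P (act d (etens K A B a u)) (act \<U> (etens K A B a' u')) =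
      RB u' (MM a a' (?P \<cdot>\<^sub>5 (emb \<U> \<cdot>\<^sub>5 (idl d \<cdot>\<^sub>5 emb (\<delta>l u)))))" if "d \<in> carrier R3" for d
      by (rule tens3_eqI[OF that, where X = X]) (use a in \<open>simp_all add: 1 2 del: act_pure\<close>)
    have "?P \<cdot>\<^sub>5 (emb \<U> \<cdot>\<^sub>5 (idl \<U> \<cdot>\<^sub>5 emb (\<delta>l u))) = (?P \<cdot>\<^sub>5 (emb \<U> \<cdot>\<^sub>5 idl \<U>)) \<cdot>\<^sub>5 emb (\<delta>l u)"
      using a by (simp add: alg_assoc)
    also have "\<dots> = DD \<U> \<cdot>\<^sub>5 (inv\<^bsub>R5\<^esub> \<Psi>l \<cdot>\<^sub>5 emb (\<delta>l u))"
      unfolding Psi_twist_left using a by (simp add: alg_assoc)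
    finally have 3: "?P \<cdot>\<^sub>5 (emb \<U> \<cdot>\<^sub>5 (idl \<U> \<cdot>\<^sub>5 emb (\<delta>l u))) = DD \<U> \<cdot>\<^sub>5 (inv\<^bsub>R5\<^esub> \<Psi>l \<cdot>\<^sub>5 emb (\<delta>l u))" .
    show ?thesis
      using a by (simp add: 4 3 mulL_pure act_MM)
  qed
  show ?thesis
    by (rule tens_eqI[OF s, where X = X]; (rule tens_eqI[OF t, where X = X])?; simp add: t pure)
qed

section \<open>The left isomorphism as the action of an invertible tensor\<close>

lemma act_act:
  assumes d: "d \<in> carrier R3" and d': "d' \<in> carrier R3" and s: "s \<in> carrier X"
  shows "act d (act d' s) = act (d \<otimes>\<^bsub>R3\<^esub> d') s"
  by (rule tens3_eqI[OF d, where X = X]; (rule tens3_eqI[OF d', where X = X])?; (rule tens_eqI[OF s, where X = X])?;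
      simp add: d' s alg_assoc)

lemma act_one: "s \<in> carrier X \<Longrightarrow> act \<one>\<^bsub>R3\<^esub> s = s"
  by (erule tens_eqI[where X = X]) (simp_all add: tens_one_def')

lemma normalized_contr: "rcontr \<epsilon> B (lcontr \<epsilon> BH \<U>) = \<one>\<^bsub>B\<^esub>" (is ?g1) "rcontr \<epsilon> B (lcontr \<epsilon> BH \<U>i) = \<one>\<^bsub>B\<^esub>" (is ?g2)
proof -
  have R: "assoc_algebra K R3" "assoc_algebra K BH" by simp_all
  have "lcontr \<epsilon> BH \<U>i = \<one>\<^bsub>BH\<^esub>"
    using alg_hom_Units(2)[OF R lcontr_alg_hom lrreassoc_unit] lrreassoc_counit by (simp add: alg_inv_one)
  then show ?g1 ?g2
    by (simp_all add: lrreassoc_counit tens_one_def')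
qed

text \<open>The unit of \<open>A\<close> absorbs both outer legs as counits, S^-1 preserving
  \<epsilon>, and the contraction of U is 1.\<close>

lemma act_unit:
  assumes u: "u \<in> carrier B"
  shows "act \<U> (etens K A B \<one>\<^bsub>A\<^esub> u) = etens K A B \<one>\<^bsub>A\<^esub> u"
proof -
  have "act d (etens K A B \<one>\<^bsub>A\<^esub> u) = etens K A B \<one>\<^bsub>A\<^esub> (rcontr \<epsilon> B (lcontr \<epsilon> BH d) \<cdot>\<^sub>B u)" if "d \<in> carrier R3" for d
    by (rule tens3_eqI[OF that, where X = X])
      (use u in \<open>simp_all add: lact_unit ract_unit lact_smult_right etens_smult klin_smult[OF klin_rcontr] smult_mult_swap m_comm\<close>)
  then show ?thesis using u by (simp add: normalized_contr)
qed

lemma act_bij: "bij_betw (act \<U>) (carrier X) (carrier X)"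
  by (rule bij_betw_byWitness[where f' = "act \<U>i"]) (auto simp: act_act act_one)

lemma left_iso:
  "act \<U> \<in> alg_iso K (left_crossed_product K H A B \<delta>l \<Psi>l) (left_crossed_product K H A B \<delta>r \<Psi>r)"
proof -
  have "act \<U> \<one>\<^bsub>X\<^esub> = \<one>\<^bsub>X\<^esub>" using act_unit[of "\<one>\<^bsub>B\<^esub>"] by (simp add: tens_one_def')
  then show ?thesis
    unfolding alg_iso_def alg_hom_def
    by (auto intro!: ring_hom_memI simp: left_crossed_product_simps act_bij mulL_act klin_add[OF act_klin1] klin_smult[OF act_klin1])
qed

section \<open>The right crossed products\<close>

abbreviation "Y \<equiv> B \<boxtimes> A"

lemmas parY [simp] = klin_tsum2_param[of B A]

text \<open>The mirror image of \<open>act\<close>: the middle leg multiplies from the right, so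
  composition reverses products. The coaction of the second factor now stands to the right of the
  first tensor, and the rule needed is U^-1 \<delta>_r(u) = \<delta>_l(u) U^-1; therefore U^-1 will
  act.\<close>

definition "act' d = tsum2 Y (\<lambda>u a. tsum3 Y (\<lambda>h b k. etens K B A (u \<cdot>\<^sub>B b) (lact A (Sb h) (ract A a k))) d)"
definition "BL u = tsum2 Y (\<lambda>b a. etens K B A (u \<cdot>\<^sub>B b) a)"
definition "mm' a a' p3 p4 p5 = tsum2 Y (\<lambda>w1 w2.
  etens K B A p3 (lact A (Sb w2) (ract A a p4) \<star> lact A (Sb w1) (ract A a' p5)))"
definition "MM' a a' = tsum5 Y (\<lambda>p1 p2 p3 p4 p5. mm' a a' p3 p4 p5 (e2 p1 p2 \<cdot>\<^sub>2 fi))"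

lemma act'_pure [simp]:
  "\<lbrakk> h \<in> carrier H; b \<in> carrier B; k \<in> carrier H; a \<in> carrier A; u \<in> carrier B \<rbrakk> \<Longrightarrow>
    act' (pure3 h b k) (etens K B A u a) = etens K B A (u \<cdot>\<^sub>B b) (lact A (Sb h) (ract A a k))"
  by (simp add: act'_def tsum2_etens tsum3_etens)

lemma act'_klin1: "d \<in> carrier R3 \<Longrightarrow> klin K Y Y (act' d)"
  unfolding act'_def by (rule klin_tsum2) simp_all

lemma act'_klin2: "s \<in> carrier Y \<Longrightarrow> klin K R3 Y (\<lambda>d. act' d s)"
  unfolding act'_def by (rule klin_tsum2_param[of B A]) (simp_all add: tsum3_etens)

lemmas act'_klin [simp] = act'_klin1 klin_comp[OF act'_klin1] act'_klin2 klin_comp[OF act'_klin2] klin_closed[OF act'_klin1]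

lemma BL_simps [simp]:
  assumes "u \<in> carrier B"
  shows "klin K Y Y (BL u)" "klin K V Y F \<Longrightarrow> klin K V Y (\<lambda>x. BL u (F x))" (is "PROP ?g2") "s \<in> carrier Y \<Longrightarrow> BL u s \<in> carrier Y" (is "PROP ?g3")
    "\<lbrakk> a \<in> carrier A; b \<in> carrier B \<rbrakk> \<Longrightarrow> BL u (etens K B A b a) = etens K B A (u \<cdot>\<^sub>B b) a" (is "PROP ?g4")
proof -
  show k: "klin K Y Y (BL u)" unfolding BL_def by (rule klin_tsum2) (use assms in simp_all)
  show "PROP ?g2" by (rule klin_comp[OF k])
  show "PROP ?g3" by (rule klin_closed[OF k])
  show "PROP ?g4"
    unfolding BL_def using assms by (simp add: tsum2_etens)
qed

lemma mm'_simps [simp]: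
  assumes "a \<in> carrier A" "a' \<in> carrier A" "p4 \<in> carrier H" "p5 \<in> carrier H" "p3 \<in> carrier B"
  shows "klin K H2 Y (mm' a a' p3 p4 p5)" (is ?g1) "klin K V H2 F \<Longrightarrow> klin K V Y (\<lambda>x. mm' a a' p3 p4 p5 (F x))" (is "PROP ?g2")
    "w \<in> carrier H2 \<Longrightarrow> mm' a a' p3 p4 p5 w \<in> carrier Y" (is "PROP ?g3")
    "\<lbrakk> w1 \<in> carrier H; w2 \<in> carrier H \<rbrakk> \<Longrightarrow> mm' a a' p3 p4 p5 (e2 w1 w2) =
      etens K B A p3 (lact A (Sb w2) (ract A a p4) \<star> lact A (Sb w1) (ract A a' p5))"
proof -
  show k: ?g1 unfolding mm'_def by (rule klin_tsum2) (use assms in simp_all)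
  show "PROP ?g2" by (rule klin_comp[OF k])
  show "PROP ?g3" by (rule klin_closed[OF k])
qed (simp add: mm'_def tsum2_etens assms)

lemma mm'_klin [simp]:
  assumes "w \<in> carrier H2" "a \<in> carrier A" "a' \<in> carrier A"
  shows "\<lbrakk> p4 \<in> carrier H; p3 \<in> carrier B; klin K V H F \<rbrakk> \<Longrightarrow> klin K V Y (\<lambda>x. mm' a a' p3 p4 (F x) w)"
    "\<lbrakk> p5 \<in> carrier H; p3 \<in> carrier B; klin K V H F \<rbrakk> \<Longrightarrow> klin K V Y (\<lambda>x. mm' a a' p3 (F x) p5 w)"
    "\<lbrakk> p4 \<in> carrier H; p5 \<in> carrier H; klin K V B G \<rbrakk> \<Longrightarrow> klin K V Y (\<lambda>x. mm' a a' (G x) p4 p5 w)"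
  unfolding mm'_def using assms by simp_all

lemma MM'_simps [simp]:
  assumes "a \<in> carrier A" "a' \<in> carrier A"
  shows "klin K R5 Y (MM' a a')" (is ?g1) "klin K V R5 F \<Longrightarrow> klin K V Y (\<lambda>x. MM' a a' (F x))" (is "PROP ?g2")
    "P \<in> carrier R5 \<Longrightarrow> MM' a a' P \<in> carrier Y" (is "PROP ?g3")
    "\<lbrakk> p3 \<in> carrier B; p4 \<in> carrier H; p5 \<in> carrier H; r \<in> carrier H2 \<rbrakk> \<Longrightarrow>
      MM' a a' (lassoc K H H BHH r (etens K B H2 p3 (e2 p4 p5))) = mm' a a' p3 p4 p5 (r \<cdot>\<^sub>2 fi)"
    "\<lbrakk> p1 \<in> carrier H; p2 \<in> carrier H; p3 \<in> carrier B; p4 \<in> carrier H; p5 \<in> carrier H \<rbrakk> \<Longrightarrow>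
      MM' a a' (pure5 p1 p2 p3 p4 p5) = mm' a a' p3 p4 p5 (e2 p1 p2 \<cdot>\<^sub>2 fi)"
proof -
  show k: ?g1 unfolding MM'_def by (rule tsum5_etens(2)) (use assms in simp_all)
  show "PROP ?g2" by (rule klin_comp[OF k])
  show "PROP ?g3" by (rule klin_closed[OF k])
  show pure: "MM' a a' (pure5 p1 p2 p3 p4 p5) = mm' a a' p3 p4 p5 (e2 p1 p2 \<cdot>\<^sub>2 fi)"
    if "p1 \<in> carrier H" "p2 \<in> carrier H" "p3 \<in> carrier B" "p4 \<in> carrier H" "p5 \<in> carrier H" for p1 p2 p3 p4 p5
    unfolding MM'_def using assms that by (simp add: tsum5_etens)
  assume p: "p3 \<in> carrier B" "p4 \<in> carrier H" "p5 \<in> carrier H" and r: "r \<in> carrier H2"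
  show "MM' a a' (lassoc K H H BHH r (etens K B H2 p3 (e2 p4 p5))) = mm' a a' p3 p4 p5 (r \<cdot>\<^sub>2 fi)"
    by (rule tens_eqI[OF r, where X = Y]) (use assms p in \<open>simp_all add: klin_comp[OF k] pure\<close>)
qed

lemma comult_fi:
  assumes c: "c \<in> carrier H"
  shows "\<Delta> c \<cdot>\<^sub>2 fi = fi \<cdot>\<^sub>2 gg (Sb c)"
proof -
  have H: "assoc_algebra K H2" by simp
  note u = drinfeld_twist_unit
  have "fi \<cdot>\<^sub>2 ((f \<cdot>\<^sub>2 \<Delta> (S (Sb c))) \<cdot>\<^sub>2 fi) = fi \<cdot>\<^sub>2 ((gg (Sb c) \<cdot>\<^sub>2 f) \<cdot>\<^sub>2 fi)"
    using drinfeld_twist_comult[of "Sb c"] c by simp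
  then show ?thesis using c by (simp add: alg_assoc alg_cancel[OF H u] alg_Units(3)[OF H u])
qed

lemma act'_mm':
  assumes a: "a \<in> carrier A" "a' \<in> carrier A" and u: "u \<in> carrier B" and h: "h \<in> carrier H" "b \<in> carrier B" "c \<in> carrier H"
    and q: "q3 \<in> carrier B" "q4 \<in> carrier H" "q5 \<in> carrier H" and w: "w \<in> carrier H2"
  shows "act' (pure3 h b c) (BL u (mm' a a' q3 q4 q5 w)) =
    tsum2 Y (\<lambda>r1 r2. BL u (mm' a a' (q3 \<cdot>\<^sub>B b) (q4 \<cdot> r1) (q5 \<cdot> r2) (w \<cdot>\<^sub>2 gg (Sb h)))) (\<Delta> c)"
proof (rule tens_eqI[OF w, where X = Y])
  fix w1 w2 assume w: "w1 \<in> carrier H" "w2 \<in> carrier H"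
  define x y where "x = lact A (Sb w2) (ract A a q4)" and "y = lact A (Sb w1) (ract A a' q5)"
  let ?E = "\<lambda>z. etens K B A (u \<cdot>\<^sub>B (q3 \<cdot>\<^sub>B b)) z"
  let ?D = "\<lambda>r1 r2. tsum2 A (\<lambda>s1 s2. lact A s1 (ract A x r1) \<star> lact A s2 (ract A y r2))"
  have xy: "x \<in> carrier A" "y \<in> carrier A" using a q w by (simp_all add: x_def y_def)
  have kE: "klin K A Y ?E" using h q u by simp
  have s: "?E (?D r1 r2 s) = BL u (mm' a a' (q3 \<cdot>\<^sub>B b) (q4 \<cdot> r1) (q5 \<cdot> r2) (e2 w1 w2 \<cdot>\<^sub>2 SS s))"
    if r: "r1 \<in> carrier H" "r2 \<in> carrier H" and s: "s \<in> carrier H2" for r1 r2 s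
    by (rule tens_eqI[OF s, where X = Y])
      (use r h q u w a xy in \<open>simp_all add: tsum2_etens klin_tsum2 alg_assoc, simp add: x_def y_def\<close>)
  have "act' (pure3 h b c) (BL u (mm' a a' q3 q4 q5 (e2 w1 w2))) = ?E (lact A (Sb h) (ract A (x \<star> y) c))"
    using h q u w a by (simp add: alg_assoc x_def y_def)
  also have "\<dots> = ?E (tsum2 A (\<lambda>r1 r2. ?D r1 r2 (\<Delta> (Sb h))) (\<Delta> c))"
    using h xy by (simp only: lact_ract_distrib(1) Sb_S)
  also have "\<dots> = tsum2 Y (\<lambda>r1 r2. ?E (?D r1 r2 (\<Delta> (Sb h)))) (\<Delta> c)"
    by (rule klin_tsum2_out[OF _ _ _ _ _ kE, of H H]) (use h xy in \<open>simp_all add: tsum2_closed[of H H]\<close>)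
  also have "\<dots> = tsum2 Y (\<lambda>r1 r2. BL u (mm' a a' (q3 \<cdot>\<^sub>B b) (q4 \<cdot> r1) (q5 \<cdot> r2) (e2 w1 w2 \<cdot>\<^sub>2 gg (Sb h)))) (\<Delta> c)"
    by (rule tsum2_cong[of H H]) (use h s in simp_all)
  finally show "act' (pure3 h b c) (BL u (mm' a a' q3 q4 q5 (e2 w1 w2))) =
    tsum2 Y (\<lambda>r1 r2. BL u (mm' a a' (q3 \<cdot>\<^sub>B b) (q4 \<cdot> r1) (q5 \<cdot> r2) (e2 w1 w2 \<cdot>\<^sub>2 gg (Sb h)))) (\<Delta> c)" .
qed (use assms in simp_all)

text \<open>Here the inverse of f stands to the right of the first two legs, and \<Delta>(h) f^-1 =
  f^-1 gg(S^-1 h) lets the coproduct of h enter between them and f^-1.\<close>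

lemma act'_MM':
  assumes a: "a \<in> carrier A" "a' \<in> carrier A" and u: "u \<in> carrier B"
    and d: "d \<in> carrier R3" and Q: "Q \<in> carrier R5"
  shows "act' d (BL u (MM' a a' Q)) = BL u (MM' a a' (Q \<cdot>\<^sub>5 DD d))"
proof -
  have *: "BL u (MM' a a' (pure5 q1 q2 q3 q4 q5 \<cdot>\<^sub>5 lassoc K H H BHH (\<Delta> h) (etens K B H2 b r))) =
      tsum2 Y (\<lambda>r1 r2. BL u (mm' a a' (q3 \<cdot>\<^sub>B b) (q4 \<cdot> r1) (q5 \<cdot> r2) (e2 q1 q2 \<cdot>\<^sub>2 fi \<cdot>\<^sub>2 gg (Sb h)))) r"
    if "r \<in> carrier H2" and q: "q1 \<in> carrier H" "q2 \<in> carrier H" "q3 \<in> carrier B" "q4 \<in> carrier H" "q5 \<in> carrier H"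
      and h: "h \<in> carrier H" "b \<in> carrier B" for r h b q1 q2 q3 q4 q5
  proof -
    \<comment> \<open>Legs 1 and 2 are bracketed together because they are multiplied jointly by
      \<Delta> h.\<close>
    have pq: "pure5 q1 q2 q3 q4 q5 = lassoc K H H BHH (e2 q1 q2) (etens K B H2 q3 (e2 q4 q5))" using q by simp
    show ?thesis
      unfolding pq
      by (rule tens_eqI[OF that(1), where X = Y])
        (use h q a u in \<open>simp_all add: tsum2_etens klin_tsum2 lassoc_mult comult_fi alg_assoc del: lassoc_etens\<close>)
  qed
  show ?thesis
    by (rule tens3_eqI[OF d, where X = Y]; (rule tens5_eqI[OF Q, where X = Y])?;
        simp add: a u Q act'_mm' * del: etens_mult act'_pure)
qed

section \<open>The multiplication of the right crossed product\<close>

definition "cR a a' u d = tsum5 Y (\<lambda>w1 w2 w3 w4 w5. tsum3 Y (\<lambda>um u0 up.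
  etens K B A (u \<cdot>\<^sub>B u0 \<cdot>\<^sub>B w3) (ract A (lact A (w2 \<cdot> Sb um) a) (up \<cdot> w4) \<star> ract A (lact A w1 a') w5)) d)"

definition "OR1 p3 p4 p5 = tsum2 R5 (\<lambda>w1 w2. pure5 (Sb w1) (Sb w2) p3 p4 p5)"
definition "OR = tsum5 R5 (\<lambda>p1 p2 p3 p4 p5. tsum2 R5 (\<lambda>g1 g2. pure5 (Sb (p1 \<cdot> g1)) (Sb (p2 \<cdot> g2)) p3 p4 p5) fi)"

lemma Omega_right_eq: "Omega_right K H B P = OR P"
  by (simp add: Omega_right_def OR_def etens5_def)

lemma cR_simps:
  assumes "a \<in> carrier A" "a' \<in> carrier A" "u \<in> carrier B"
  shows "d \<in> carrier R3 \<Longrightarrow> klin K R5 Y (cR a a' u d)" (is "PROP ?g1")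
    and "\<lbrakk> klin K V R3 F; Q \<in> carrier R5 \<rbrakk> \<Longrightarrow> klin K V Y (\<lambda>x. cR a a' u (F x) Q)"
    and "\<lbrakk> q1 \<in> carrier H; q2 \<in> carrier H; q3 \<in> carrier B; q4 \<in> carrier H; q5 \<in> carrier H; d1 \<in> carrier H; d2 \<in> carrier B; d3 \<in> carrier H \<rbrakk> \<Longrightarrow>
      cR a a' u (pure3 d1 d2 d3) (pure5 q1 q2 q3 q4 q5) =
      etens K B A (u \<cdot>\<^sub>B d2 \<cdot>\<^sub>B q3) (ract A (lact A (q2 \<cdot> Sb d1) a) (d3 \<cdot> q4) \<star> ract A (lact A q1 a') q5)" (is "PROP ?g3")
proof -
  show "PROP ?g1"
    unfolding cR_def by (rule tsum5_etens(2)) (use assms in simp_all)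
  show "klin K V Y (\<lambda>x. cR a a' u (F x) Q)" if F: "klin K V R3 F" and Q: "Q \<in> carrier R5"
    unfolding cR_def
    by (rule par5[OF _ _ _ _ _ _ Q]) (use assms F in \<open>simp_all add: tsum3_etens(2)[of H B H, THEN klin_comp]\<close>)
  show "PROP ?g3"
    using assms by (simp add: cR_def tsum5_etens tsum3_etens)
qed

lemma cR_param:
  assumes "d \<in> carrier R3" "Q \<in> carrier R5"
  shows "\<lbrakk> klin K V A F; a' \<in> carrier A; u \<in> carrier B \<rbrakk> \<Longrightarrow> klin K V Y (\<lambda>x. cR (F x) a' u d Q)"
    "\<lbrakk> a \<in> carrier A; klin K V A F; u \<in> carrier B \<rbrakk> \<Longrightarrow> klin K V Y (\<lambda>x. cR a (F x) u d Q)"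
    "\<lbrakk> a \<in> carrier A; a' \<in> carrier A; klin K V B G \<rbrakk> \<Longrightarrow> klin K V Y (\<lambda>x. cR a a' (G x) d Q)"
  unfolding cR_def using assms by simp_all

lemma OR_simps:
  assumes "p3 \<in> carrier B" "p4 \<in> carrier H" "p5 \<in> carrier H"
  shows "klin K H2 R5 (OR1 p3 p4 p5)" (is ?g1)
    and "\<lbrakk> w1 \<in> carrier H; w2 \<in> carrier H \<rbrakk> \<Longrightarrow> OR1 p3 p4 p5 (e2 w1 w2) = pure5 (Sb w1) (Sb w2) p3 p4 p5"
    and "\<lbrakk> p1 \<in> carrier H; p2 \<in> carrier H \<rbrakk> \<Longrightarrow> OR (pure5 p1 p2 p3 p4 p5) = OR1 p3 p4 p5 (e2 p1 p2 \<cdot>\<^sub>2 fi)"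
proof -
  show k: ?g1 unfolding OR1_def by (rule klin_tsum2) (use assms in simp_all)
  show e: "\<lbrakk> w1 \<in> carrier H; w2 \<in> carrier H \<rbrakk> \<Longrightarrow> OR1 p3 p4 p5 (e2 w1 w2) = pure5 (Sb w1) (Sb w2) p3 p4 p5" for w1 w2
    using assms by (simp add: OR1_def tsum2_etens)
  assume p: "p1 \<in> carrier H" "p2 \<in> carrier H"
  have "tsum2 R5 (\<lambda>g1 g2. pure5 (Sb (p1 \<cdot> g1)) (Sb (p2 \<cdot> g2)) p3 p4 p5) g = OR1 p3 p4 p5 (e2 p1 p2 \<cdot>\<^sub>2 g)"
    if "g \<in> carrier H2" for g
    by (rule tens_eqI[OF that, where X = R5])
      (use assms p in \<open>simp_all add: tsum2_etens klin_tsum2 klin_comp[OF k] e del: Sb_simps(3)\<close>)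
  moreover have "OR (pure5 p1 p2 p3 p4 p5) = tsum2 R5 (\<lambda>g1 g2. pure5 (Sb (p1 \<cdot> g1)) (Sb (p2 \<cdot> g2)) p3 p4 p5) fi"
    unfolding OR_def using assms p by (simp add: tsum5_etens)
  ultimately show "OR (pure5 p1 p2 p3 p4 p5) = OR1 p3 p4 p5 (e2 p1 p2 \<cdot>\<^sub>2 fi)" by simp
qed

lemma OR_klin: "klin K R5 R5 OR"
  unfolding OR_def by (rule tsum5_etens(2)) simp_all

text \<open>The mirror image of \<open>cL_OL\<close>: S^-1(p_2 g^2) S^-1(u_(-1)) equals S^-1(u_(-1)
  p_2 g^2), so the coaction stands to the left of \<open>P\<close> and f^-1 stays behind.\<close>

lemma cR_OR:
  assumes a: "a \<in> carrier A" "a' \<in> carrier A" and u: "u \<in> carrier B" and d: "d \<in> carrier R3" and P: "P \<in> carrier R5"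
  shows "cR a a' u d (OR P) = BL u (MM' a a' (emb d \<cdot>\<^sub>5 P))"
proof -
  note k = cR_simps(1)[OF a u] cR_simps(2)[OF a u] klin_comp[OF cR_simps(1)[OF a u]]
  note [simp] = klin_closed[OF OR_klin]
  have *: "cR a a' u (pure3 d1 d2 d3) (OR1 p3 p4 p5 w) = BL u (mm' a a' (d2 \<cdot>\<^sub>B p3) (d3 \<cdot> p4) p5 (e2 \<one>\<^sub>H d1 \<cdot>\<^sub>2 w))"
    if "w \<in> carrier H2" "d1 \<in> carrier H" "d2 \<in> carrier B" "d3 \<in> carrier H" "p3 \<in> carrier B" "p4 \<in> carrier H" "p5 \<in> carrier H"
    for w d1 d2 d3 p3 p4 p5
    by (rule tens_eqI[OF that(1), where X = Y])
      (use a u that in \<open>simp_all add: klin_comp[OF _ OR_simps(1)] OR_simps cR_simps k alg_assoc\<close>)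
  show ?thesis
    by (rule tens5_eqI[OF P, where X = Y]; (rule tens3_eqI[OF d, where X = Y])?;
        simp add: a u d k OR_klin OR_simps klin_closed[OF OR_simps(1)] * etens_mult_left)
qed

definition "mulR dd P s t = tsum2 Y (\<lambda>u a. tsum2 Y (\<lambda>u' a'. cR a a' u (dd u') (OR P)) t) s"

lemma right_crossed_product_simps:
  "mult (right_crossed_product K H A B dd P) = mulR dd P"
  "carrier (right_crossed_product K H A B dd P) = carrier Y"
  "add (right_crossed_product K H A B dd P) = add Y"
  "one (right_crossed_product K H A B dd P) = one Y"
  "smult (right_crossed_product K H A B dd P) = smult Y"
  by (simp_all add: right_crossed_product_def mulR_def[abs_def] cR_def Omega_right_eq)

context
  fixes dd P
  assumes dd: "klin K B R3 dd" and P: "P \<in> carrier R5"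
begin

lemma mulR_aux:
  "\<lbrakk> a \<in> carrier A; a' \<in> carrier A; u \<in> carrier B \<rbrakk> \<Longrightarrow> klin K B Y (\<lambda>u'. cR a a' u (dd u') (OR P))"
  "\<lbrakk> a' \<in> carrier A; u \<in> carrier B; u' \<in> carrier B \<rbrakk> \<Longrightarrow> klin K A Y (\<lambda>a. cR a a' u (dd u') (OR P))"
  "\<lbrakk> a \<in> carrier A; u \<in> carrier B; u' \<in> carrier B \<rbrakk> \<Longrightarrow> klin K A Y (\<lambda>a'. cR a a' u (dd u') (OR P))"
  "\<lbrakk> a \<in> carrier A; a' \<in> carrier A; u' \<in> carrier B \<rbrakk> \<Longrightarrow> klin K B Y (\<lambda>u. cR a a' u (dd u') (OR P))"
  using klin_closed[OF OR_klin P] klin_closed[OF dd] dd by (auto intro!: cR_param cR_simps(2) klin_ident)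

lemma mulR_klin:
  "t \<in> carrier Y \<Longrightarrow> klin K Y Y (\<lambda>s. mulR dd P s t)"
  "s \<in> carrier Y \<Longrightarrow> klin K Y Y (mulR dd P s)"
  unfolding mulR_def
  by (rule klin_tsum2; simp add: mulR_aux) (rule parY; simp add: mulR_aux klin_tsum2)

lemma mulR_pure:
  assumes a: "a \<in> carrier A" "u \<in> carrier B" "a' \<in> carrier A" "u' \<in> carrier B"
  shows "mulR dd P (etens K B A u a) (etens K B A u' a') = BL u (MM' a a' (emb (dd u') \<cdot>\<^sub>5 P))"
proof -
  have "mulR dd P (etens K B A u a) (etens K B A u' a') = cR a a' u (dd u') (OR P)"
    unfolding mulR_def using a by (simp add: tsum2_etens mulR_aux)
  then show ?thesis using a P klin_closed[OF dd] by (simp add: cR_OR)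
qed

end

lemma BL_MM'_act:
  assumes a: "a \<in> carrier A" "a' \<in> carrier A" and h: "h \<in> carrier H" "k \<in> carrier H" "h' \<in> carrier H" "k' \<in> carrier H"
    and b: "b \<in> carrier B" "u \<in> carrier B" and P: "P \<in> carrier R5" and e: "e \<in> carrier R3"
  shows "BL (u \<cdot>\<^sub>B b) (MM' (lact A (Sb h) (ract A a k)) (lact A (Sb h') (ract A a' k')) (emb e \<cdot>\<^sub>5 P)) =
    BL u (MM' a a' (JJ h' k' \<cdot>\<^sub>5 (emb (pure3 h b k \<otimes>\<^bsub>R3\<^esub> e) \<cdot>\<^sub>5 P)))"
proof -
  let ?a = "lact A (Sb h) (ract A a k)" and ?a' = "lact A (Sb h') (ract A a' k')"
  have *: "BL (u \<cdot>\<^sub>B b) (mm' ?a ?a' q3 q4 q5 w) = BL u (mm' a a' (b \<cdot>\<^sub>B q3) (k \<cdot> q4) (k' \<cdot> q5) (e2 h' h \<cdot>\<^sub>2 w))"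
    if "w \<in> carrier H2" "q3 \<in> carrier B" "q4 \<in> carrier H" "q5 \<in> carrier H" for w q3 q4 q5
    by (rule tens_eqI[OF that(1), where X = Y]) (use a h b that in \<open>simp_all add: alg_assoc\<close>)
  show ?thesis
    by (rule tens5_eqI[OF P, where X = Y]; (rule tens3_eqI[OF e, where X = Y])?;
        simp add: a h b e * JJ_def alg_assoc etens_mult_left del: A_nf)
qed

text \<open>Compared with \<open>mulL_act\<close> the roles are exchanged: the copy of U^-1 in the
  first factor is whole and does the intertwining, while the one in the second factor is pure at
  first.\<close>

lemma mulR_act':
  assumes s: "s \<in> carrier Y" and t: "t \<in> carrier Y"
  shows "mulR \<delta>r \<Psi>r (act' \<U>i s) (act' \<U>i t) = act' \<U>i (mulR \<delta>l \<Psi>l s t)"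
proof -
  note kr = mulR_klin[OF delta_klin(2) Psi_closed(2)] and kl = mulR_klin[OF delta_klin(1) Psi_closed(1)]
  note [simp] = kr kr[THEN klin_comp] kl kl[THEN klin_comp] alg_hom_closed[OF delta_hom(1)] alg_hom_closed[OF delta_hom(2)]
  have pure: "mulR \<delta>r \<Psi>r (act' \<U>i (etens K B A u a)) (act' \<U>i (etens K B A u' a')) =
    act' \<U>i (mulR \<delta>l \<Psi>l (etens K B A u a) (etens K B A u' a'))"
    if a: "a \<in> carrier A" "u \<in> carrier B" "a' \<in> carrier A" "u' \<in> carrier B" for a u a' u'
  proof -
    have 1: "mulR \<delta>r \<Psi>r (act' d (etens K B A u a)) (act' (pure3 h b k) (etens K B A u' a')) =
      BL u (MM' a a' (JJ h k \<cdot>\<^sub>5 (emb (d \<otimes>\<^bsub>R3\<^esub> \<delta>r (u' \<cdot>\<^sub>B b)) \<cdot>\<^sub>5 \<Psi>r)))"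
      if "d \<in> carrier R3" "h \<in> carrier H" "b \<in> carrier B" "k \<in> carrier H" for d h b k
      by (rule tens3_eqI[OF that(1), where X = Y]) (use a that in \<open>simp_all add: mulR_pure BL_MM'_act del: etens_mult\<close>)
    have JJ: "JJ h k \<cdot>\<^sub>5 (emb d \<cdot>\<^sub>5 y) = emb d \<cdot>\<^sub>5 (JJ h k \<cdot>\<^sub>5 y)"
      if "d \<in> carrier R3" "y \<in> carrier R5" "h \<in> carrier H" "k \<in> carrier H" for d y h k
      using that by (simp add: alg_assoc[symmetric] emb_JJ)
    \<comment> \<open>After the intertwining, \<delta>_l(b) remains between \<delta>_l(u') and U^-1.
      The outer legs h and k, which commute with \<open>emb\<close>, move next to it and complete
      \<open>idl\<close>.\<close>
    have 2: "JJ h k \<cdot>\<^sub>5 (emb (\<U>i \<otimes>\<^bsub>R3\<^esub> \<delta>r (u' \<cdot>\<^sub>B b)) \<cdot>\<^sub>5 \<Psi>r) =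
      emb (\<delta>l u') \<cdot>\<^sub>5 (idl (pure3 h b k) \<cdot>\<^sub>5 (emb \<U>i \<cdot>\<^sub>5 \<Psi>r))"
      if h: "h \<in> carrier H" "b \<in> carrier B" "k \<in> carrier H" for h b k
      using a h by (simp add: delta_twist(2) alg_hom_mult[OF delta_hom(1)] alg_hom_mult[OF emb_hom(1)] JJ idl_pure alg_assoc)
    have 4: "mulR \<delta>r \<Psi>r (act' \<U>i (etens K B A u a)) (act' d (etens K B A u' a')) =
      BL u (MM' a a' (emb (\<delta>l u') \<cdot>\<^sub>5 (idl d \<cdot>\<^sub>5 (emb \<U>i \<cdot>\<^sub>5 \<Psi>r))))" if "d \<in> carrier R3" for d
      by (rule tens3_eqI[OF that, where X = Y]) (use a in \<open>simp_all add: 1 2 del: act'_pure\<close>)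
    have 3: "emb (\<delta>l u') \<cdot>\<^sub>5 (idl \<U>i \<cdot>\<^sub>5 (emb \<U>i \<cdot>\<^sub>5 \<Psi>r)) = (emb (\<delta>l u') \<cdot>\<^sub>5 \<Psi>l) \<cdot>\<^sub>5 DD \<U>i"
      unfolding Psi_twist_right using a by (simp add: alg_assoc)
    show ?thesis
      using a by (simp add: 4 3 mulR_pure act'_MM')
  qed
  show ?thesis
    by (rule tens_eqI[OF s, where X = Y]; (rule tens_eqI[OF t, where X = Y])?; simp add: t pure)
qed

lemma act'_act':
  assumes d: "d \<in> carrier R3" and d': "d' \<in> carrier R3" and s: "s \<in> carrier Y"
  shows "act' d (act' d' s) = act' (d' \<otimes>\<^bsub>R3\<^esub> d) s"
  by (rule tens3_eqI[OF d, where X = Y]; (rule tens3_eqI[OF d', where X = Y])?; (rule tens_eqI[OF s, where X = Y])?;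
      simp add: d' s alg_assoc)

lemma act'_one: "s \<in> carrier Y \<Longrightarrow> act' \<one>\<^bsub>R3\<^esub> s = s"
  by (erule tens_eqI[where X = Y]) (simp_all add: tens_one_def')

lemma act'_unit:
  assumes u: "u \<in> carrier B"
  shows "act' \<U>i (etens K B A u \<one>\<^bsub>A\<^esub>) = etens K B A u \<one>\<^bsub>A\<^esub>"
proof -
  have "act' d (etens K B A u \<one>\<^bsub>A\<^esub>) = etens K B A (u \<cdot>\<^sub>B rcontr \<epsilon> B (lcontr \<epsilon> BH d)) \<one>\<^bsub>A\<^esub>" if "d \<in> carrier R3" for d
    by (rule tens3_eqI[OF that, where X = Y])
      (use u in \<open>simp_all add: lact_unit ract_unit lact_smult_right etens_smult klin_smult[OF klin_rcontr] smult_mult_swap m_comm\<close>)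
  then show ?thesis using u by (simp add: normalized_contr)
qed

lemma right_iso:
  "act' \<U>i \<in> alg_iso K (right_crossed_product K H A B \<delta>l \<Psi>l) (right_crossed_product K H A B \<delta>r \<Psi>r)"
proof -
  have "bij_betw (act' \<U>i) (carrier Y) (carrier Y)"
    by (rule bij_betw_byWitness[where f' = "act' \<U>"]) (auto simp: act'_act' act'_one)
  moreover have "act' \<U>i \<one>\<^bsub>Y\<^esub> = \<one>\<^bsub>Y\<^esub>" using act'_unit[of "\<one>\<^bsub>B\<^esub>"] by (simp add: tens_one_def')
  ultimately show ?thesis
    unfolding alg_iso_def alg_hom_def
    by (auto intro!: ring_hom_memI simp: right_crossed_product_simps mulR_act' klin_add[OF act'_klin1] klin_smult[OF act'_klin1])
qed

end

theorem corollary4p7: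
  fixes K :: "('k, 'm) ring_scheme"
    and H :: "('k, 'h, 'z) quasi_hopf_scheme"
    and A :: "('k, 'a, 'h, 'x) bimodule_algebra_scheme"
    and B :: "('k, 'b, 'h, 'y) bicomodule_algebra_scheme"
  assumes "quasi_hopf_algebra K H"
    and "bimodule_algebra K H A"
    and "bicomodule_algebra K H B"
  shows
    "alg_isomorphic K
       (left_crossed_product K H A B (delta_l K H B) (Psi_l K H B))
       (left_crossed_product K H A B (delta_r K H B) (Psi_r K H B))
     \<and> equivalent_extensions K B
       (left_crossed_product K H A B (delta_l K H B) (Psi_l K H B)) (\<lambda>u. etens K A B \<one>\<^bsub>A\<^esub> u)
       (left_crossed_product K H A B (delta_r K H B) (Psi_r K H B)) (\<lambda>u. etens K A B \<one>\<^bsub>A\<^esub> u)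
     \<and> alg_isomorphic K
       (right_crossed_product K H A B (delta_l K H B) (Psi_l K H B))
       (right_crossed_product K H A B (delta_r K H B) (Psi_r K H B))
     \<and> equivalent_extensions K B
       (right_crossed_product K H A B (delta_l K H B) (Psi_l K H B)) (\<lambda>u. etens K B A u \<one>\<^bsub>A\<^esub>)
       (right_crossed_product K H A B (delta_r K H B) (Psi_r K H B)) (\<lambda>u. etens K B A u \<one>\<^bsub>A\<^esub>)"
proof -
  interpret crossed_product_setting K H A B
    using assms by (simp add: crossed_product_setting_def quasi_hopf_bicomodule_algebra_def)
  show ?thesis
    unfolding alg_isomorphic_def equivalent_extensions_def
    using left_iso right_iso act_unit act'_unit by blast
qed

end
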